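(* Let $\Gamma=\left(M_{(1)1}^{(i)},N_{(1)j}^{(i)}\right)$ be a nonlinear connection on $E=J^1(\mathbb{R},M)$ and let $\nabla$ be a $\Gamma$-linear connection on $E$ with adapted coefficients $$\nabla\Gamma=\left(\bar G_{11}^1,\;G_{i1}^k,\;G_{(1)(j)1}^{(i)(1)},\;\bar L_{1j}^1,\;L_{ij}^k,\;L_{(1)(j)k}^{(i)(1)},\;\bar C_{1(k)}^{1(1)},\;C_{i(k)}^{j(1)},\;C_{(1)(j)(k)}^{(i)(1)(1)}\right).$$ The local curvature d-tensors of $\nabla$ are given by the following expressions. $h_{\mathbb{R}}$-components: 1. $\bar R_{11k}^1=\dfrac{\delta\bar G_{11}^1}{\delta x^k}-\dfrac{\delta\bar L_{1k}^1}{\delta t}+\bar C_{1(r)}^{1(1)}R_{(1)1k}^{(r)}$ 2. $\bar R_{1jk}^1=\dfrac{\delta\bar L_{1j}^1}{\delta x^k}-\dfrac{\delta\bar L_{1k}^1}{\delta x^j}+\bar C_{1(r)}^{1(1)}R_{(1)jk}^{(r)}$ 3. $\bar P_{11(k)}^{1\;\;(1)}=\dfrac{\partial\bar G_{11}^1}{\partial y_1^k}-\bar C_{1(k)/1}^{1(1)}+\bar C_{1(r)}^{1(1)}P_{(1)1(k)}^{(r)\;\;(1)}$ 4. $\bar P_{1j(k)}^{1\;\;(1)}=\dfrac{\partial\bar L_{1j}^1}{\partial y_1^k}-\bar C_{1(k)|j}^{1(1)}+\bar C_{1(r)}^{1(1)}P_{(1)j(k)}^{(r)\;\;(1)}$ 5.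 $\bar S_{1(j)(k)}^{1(1)(1)}=\dfrac{\partial\bar C_{1(j)}^{1(1)}}{\partial y_1^k}-\dfrac{\partial\bar C_{1(k)}^{1(1)}}{\partial y_1^j}$ $h_M$-components: 6. $R_{i1k}^l=\dfrac{\delta G_{i1}^l}{\delta x^k}-\dfrac{\delta L_{ik}^l}{\delta t}+G_{i1}^rL_{rk}^l-L_{ik}^rG_{r1}^l+C_{i(r)}^{l(1)}R_{(1)1k}^{(r)}$ 7. $R_{ijk}^l=\dfrac{\delta L_{ij}^l}{\delta x^k}-\dfrac{\delta L_{ik}^l}{\delta x^j}+L_{ij}^rL_{rk}^l-L_{ik}^rL_{rj}^l+C_{i(r)}^{l(1)}R_{(1)jk}^{(r)}$ 8. $P_{i1(k)}^{l\;\;(1)}=\dfrac{\partial G_{i1}^l}{\partial y_1^k}-C_{i(k)/1}^{l(1)}+C_{i(r)}^{l(1)}P_{(1)1(k)}^{(r)\;\;(1)}$ 9. $P_{ij(k)}^{l\;\;(1)}=\dfrac{\partial L_{ij}^l}{\partial y_1^k}-C_{i(k)|j}^{l(1)}+C_{i(r)}^{l(1)}P_{(1)j(k)}^{(r)\;\;(1)}$ 10. $S_{i(j)(k)}^{l(1)(1)}=\dfrac{\partial C_{i(j)}^{l(1)}}{\partial y_1^k}-\dfrac{\partial C_{i(k)}^{l(1)}}{\partial y_1^j}+C_{i(j)}^{r(1)}C_{r(k)}^{l(1)}-C_{i(k)}^{r(1)}C_{r(j)}^{l(1)}$ $v$-components: 11. $R_{(1)(i)1k}^{(l)(1)}=\dfrac{\delta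 G_{(1)(i)1}^{(l)(1)}}{\delta x^k}-\dfrac{\delta L_{(1)(i)k}^{(l)(1)}}{\delta t}+G_{(1)(i)1}^{(r)(1)}L_{(1)(r)k}^{(l)(1)}-L_{(1)(i)k}^{(r)(1)}G_{(1)(r)1}^{(l)(1)}+C_{(1)(i)(r)}^{(l)(1)(1)}R_{(1)1k}^{(r)}$ 12. $R_{(1)(i)jk}^{(l)(1)}=\dfrac{\delta L_{(1)(i)j}^{(l)(1)}}{\delta x^k}-\dfrac{\delta L_{(1)(i)k}^{(l)(1)}}{\delta x^j}+L_{(1)(i)j}^{(r)(1)}L_{(1)(r)k}^{(l)(1)}-L_{(1)(i)k}^{(r)(1)}L_{(1)(r)j}^{(l)(1)}+C_{(1)(i)(r)}^{(l)(1)(1)}R_{(1)jk}^{(r)}$ 13. $P_{(1)(i)1(k)}^{(l)(1)\;\;(1)}=\dfrac{\partial G_{(1)(i)1}^{(l)(1)}}{\partial y_1^k}-C_{(1)(i)(k)/1}^{(l)(1)(1)}+C_{(1)(i)(r)}^{(l)(1)(1)}P_{(1)1(k)}^{(r)\;\;(1)}$ 14. $P_{(1)(i)j(k)}^{(l)(1)\;\;(1)}=\dfrac{\partial L_{(1)(i)j}^{(l)(1)}}{\partial y_1^k}-C_{(1)(i)(k)|j}^{(l)(1)(1)}+C_{(1)(i)(r)}^{(l)(1)(1)}P_{(1)j(k)}^{(r)\;\;(1)}$ 15. $S_{(1)(i)(j)(k)}^{(l)(1)(1)(1)}=\dfrac{\partial C_{(1)(i)(j)}^{(l)(1)(1)}}{\partial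 y_1^k}-\dfrac{\partial C_{(1)(i)(k)}^{(l)(1)(1)}}{\partial y_1^j}+C_{(1)(i)(j)}^{(r)(1)(1)}C_{(1)(r)(k)}^{(l)(1)(1)}-C_{(1)(i)(k)}^{(r)(1)(1)}C_{(1)(r)(j)}^{(l)(1)(1)}$
   Context: $M$ is a smooth $n$-dimensional manifold with local coordinates $(x^i)_{i=\overline{1,n}}$, $\mathbb{R}$ is the time manifold with coordinate $t$, and $E=J^1(\mathbb{R},M)\to\mathbb{R}\times M$ is the 1-jet vector bundle, with local coordinates $(t,x^i,y_1^i)$ transforming by $$\tilde t=\tilde t(t),\quad \tilde x^i=\tilde x^i(x^j),\quad \tilde y_1^i=\frac{\partial\tilde x^i}{\partial x^j}\frac{dt}{d\tilde t}\,y_1^j .$$ Latin indices run over $1,\dots,n$ and repeated Latin indices are summed; the index $1$ refers to the single time direction. A nonlinear connection $\Gamma=\left(M_{(1)1}^{(i)},N_{(1)j}^{(i)}\right)$ on $E$ is a family of local functions on the charts of $E$ transforming by $$\tilde M_{(1)1}^{(k)}=M_{(1)1}^{(j)}\left(\frac{dt}{d\tilde t}\right)^2\frac{\partial\tilde x^k}{\partial x^j}-\frac{dt}{d\tilde t}\frac{\partial\tilde y_1^k}{\partial t},\qquad \tilde N_{(1)l}^{(k)}=N_{(1)i}^{(j)}\frac{dt}{d\tilde t}\frac{\partial x^i}{\partial\tilde x^l}\frac{\partial\tilde x^k}{\partial x^j}-\frac{\partial x^i}{\partial\tilde x^l}\frac{\partial\tilde y_1^k}{\partial x^i}.$$ The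 adapted basis of vector fields is $$\frac{\delta}{\delta t}=\frac{\partial}{\partial t}-M_{(1)1}^{(j)}\frac{\partial}{\partial y_1^j},\quad \frac{\delta}{\delta x^i}=\frac{\partial}{\partial x^i}-N_{(1)i}^{(j)}\frac{\partial}{\partial y_1^j},\quad \frac{\partial}{\partial y_1^i}.$$ $h_{\mathbb{R}}$, $h_M$, $v$ denote the projections of $\mathcal{X}(E)$ onto the summands locally spanned respectively by $\frac{\delta}{\delta t}$, by the $\frac{\delta}{\delta x^i}$, by the $\frac{\partial}{\partial y_1^i}$. A $\Gamma$-linear connection on $E$ is a linear connection $\nabla$ on $E$ with $\nabla h_{\mathbb{R}}=0$, $\nabla h_M=0$, $\nabla v=0$, i.e. $\nabla_X(hY)=h(\nabla_XY)$ for $h\in\{h_{\mathbb{R}},h_M,v\}$. Its adapted coefficients in a chart are defined by $$\nabla_{\frac{\delta}{\delta t}}\frac{\delta}{\delta t}=\bar G_{11}^1\frac{\delta}{\delta t},\quad \nabla_{\frac{\delta}{\delta t}}\frac{\delta}{\delta x^i}=G_{i1}^k\frac{\delta}{\delta x^k},\quad \nabla_{\frac{\delta}{\delta t}}\frac{\partial}{\partial y_1^i}=G_{(1)(i)1}^{(k)(1)}\frac{\partial}{\partial y_1^k},$$ $$\nabla_{\frac{\delta}{\delta x^j}}\frac{\delta}{\delta t}=\bar L_{1j}^1\frac{\delta}{\delta t},\quad \nabla_{\frac{\delta}{\delta x^j}}\frac{\delta}{\delta x^i}=L_{ij}^k\frac{\delta}{\delta x^k},\quad \nabla_{\frac{\delta}{\delta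 x^j}}\frac{\partial}{\partial y_1^i}=L_{(1)(i)j}^{(k)(1)}\frac{\partial}{\partial y_1^k},$$ $$\nabla_{\frac{\partial}{\partial y_1^j}}\frac{\delta}{\delta t}=\bar C_{1(j)}^{1(1)}\frac{\delta}{\delta t},\quad \nabla_{\frac{\partial}{\partial y_1^j}}\frac{\delta}{\delta x^i}=C_{i(j)}^{k(1)}\frac{\delta}{\delta x^k},\quad \nabla_{\frac{\partial}{\partial y_1^j}}\frac{\partial}{\partial y_1^i}=C_{(1)(i)(j)}^{(k)(1)(1)}\frac{\partial}{\partial y_1^k}.$$ Curvature d-tensors. With $\mathbf{R}(X,Y)Z=\nabla_X\nabla_YZ-\nabla_Y\nabla_XZ-\nabla_{[X,Y]}Z$, they are defined by $$\mathbf{R}\left(\tfrac{\delta}{\delta x^k},\tfrac{\delta}{\delta t}\right)\tfrac{\delta}{\delta t}=\bar R_{11k}^1\tfrac{\delta}{\delta t},\quad \mathbf{R}\left(\tfrac{\delta}{\delta x^k},\tfrac{\delta}{\delta t}\right)\tfrac{\delta}{\delta x^i}=R_{i1k}^l\tfrac{\delta}{\delta x^l},\quad \mathbf{R}\left(\tfrac{\delta}{\delta x^k},\tfrac{\delta}{\delta t}\right)\tfrac{\partial}{\partial y_1^i}=R_{(1)(i)1k}^{(l)(1)}\tfrac{\partial}{\partial y_1^l},$$ $$\mathbf{R}\left(\tfrac{\delta}{\delta x^k},\tfrac{\delta}{\delta x^j}\right)\tfrac{\delta}{\delta t}=\bar R_{1jk}^1\tfrac{\delta}{\delta t},\quad \mathbf{R}\left(\tfrac{\delta}{\delta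 x^k},\tfrac{\delta}{\delta x^j}\right)\tfrac{\delta}{\delta x^i}=R_{ijk}^l\tfrac{\delta}{\delta x^l},\quad \mathbf{R}\left(\tfrac{\delta}{\delta x^k},\tfrac{\delta}{\delta x^j}\right)\tfrac{\partial}{\partial y_1^i}=R_{(1)(i)jk}^{(l)(1)}\tfrac{\partial}{\partial y_1^l},$$ $$\mathbf{R}\left(\tfrac{\partial}{\partial y_1^k},\tfrac{\delta}{\delta t}\right)\tfrac{\delta}{\delta t}=\bar P_{11(k)}^{1\;\;(1)}\tfrac{\delta}{\delta t},\quad \mathbf{R}\left(\tfrac{\partial}{\partial y_1^k},\tfrac{\delta}{\delta t}\right)\tfrac{\delta}{\delta x^i}=P_{i1(k)}^{l\;\;(1)}\tfrac{\delta}{\delta x^l},\quad \mathbf{R}\left(\tfrac{\partial}{\partial y_1^k},\tfrac{\delta}{\delta t}\right)\tfrac{\partial}{\partial y_1^i}=P_{(1)(i)1(k)}^{(l)(1)\;(1)}\tfrac{\partial}{\partial y_1^l},$$ $$\mathbf{R}\left(\tfrac{\partial}{\partial y_1^k},\tfrac{\delta}{\delta x^j}\right)\tfrac{\delta}{\delta t}=\bar P_{1j(k)}^{1\;\;(1)}\tfrac{\delta}{\delta t},\quad \mathbf{R}\left(\tfrac{\partial}{\partial y_1^k},\tfrac{\delta}{\delta x^j}\right)\tfrac{\delta}{\delta x^i}=P_{ij(k)}^{l\;\;(1)}\tfrac{\delta}{\delta x^l},\quad \mathbf{R}\left(\tfrac{\partial}{\partial y_1^k},\tfrac{\delta}{\delta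 x^j}\right)\tfrac{\partial}{\partial y_1^i}=P_{(1)(i)j(k)}^{(l)(1)\;(1)}\tfrac{\partial}{\partial y_1^l},$$ $$\mathbf{R}\left(\tfrac{\partial}{\partial y_1^k},\tfrac{\partial}{\partial y_1^j}\right)\tfrac{\delta}{\delta t}=\bar S_{1(j)(k)}^{1(1)(1)}\tfrac{\delta}{\delta t},\quad \mathbf{R}\left(\tfrac{\partial}{\partial y_1^k},\tfrac{\partial}{\partial y_1^j}\right)\tfrac{\delta}{\delta x^i}=S_{i(j)(k)}^{l(1)(1)}\tfrac{\delta}{\delta x^l},\quad \mathbf{R}\left(\tfrac{\partial}{\partial y_1^k},\tfrac{\partial}{\partial y_1^j}\right)\tfrac{\partial}{\partial y_1^i}=S_{(1)(i)(j)(k)}^{(l)(1)(1)(1)}\tfrac{\partial}{\partial y_1^l}.$$ Torsion d-tensors used: $$R_{(1)1j}^{(r)}=\frac{\delta M_{(1)1}^{(r)}}{\delta x^j}-\frac{\delta N_{(1)j}^{(r)}}{\delta t},\quad R_{(1)ij}^{(r)}=\frac{\delta N_{(1)i}^{(r)}}{\delta x^j}-\frac{\delta N_{(1)j}^{(r)}}{\delta x^i},\quad P_{(1)1(j)}^{(r)\;(1)}=\frac{\partial M_{(1)1}^{(r)}}{\partial y_1^j}-G_{(1)(j)1}^{(r)(1)},\quad P_{(1)i(j)}^{(r)\;(1)}=\frac{\partial N_{(1)i}^{(r)}}{\partial y_1^j}-L_{(1)(j)i}^{(r)(1)}.$$ Covariant derivatives. For a d-tensor with components $D_{1k(1)(l)\ldots}^{1i(j)(1)\ldots}$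 (an upper $(j)$ paired with a lower $(1)$ is a vertical contravariant index, a lower $(l)$ paired with an upper $(1)$ is a vertical covariant index), $$D_{1k(1)(l)\ldots/1}^{1i(j)(1)\ldots}=\frac{\delta D_{1k(1)(l)\ldots}^{1i(j)(1)\ldots}}{\delta t}+D_{1k(1)(l)\ldots}^{1i(j)(1)\ldots}\bar G_{11}^1+D_{1k(1)(l)\ldots}^{1r(j)(1)\ldots}G_{r1}^i+D_{1k(1)(l)\ldots}^{1i(r)(1)\ldots}G_{(1)(r)1}^{(j)(1)}+\ldots$$ $$\qquad-D_{1k(1)(l)\ldots}^{1i(j)(1)\ldots}\bar G_{11}^1-D_{1r(1)(l)\ldots}^{1i(j)(1)\ldots}G_{k1}^r-D_{1k(1)(r)\ldots}^{1i(j)(1)\ldots}G_{(1)(l)1}^{(r)(1)}-\ldots,$$ with one plus-term for each contravariant index and one minus-term for each covariant index; $D_{\ldots|p}^{\ldots}$ is given by the same formula with $\frac{\delta}{\delta t},\bar G_{11}^1,G_{r1}^i,G_{(1)(r)1}^{(j)(1)}$ replaced by $\frac{\delta}{\delta x^p},\bar L_{1p}^1,L_{rp}^i,L_{(1)(r)p}^{(j)(1)}$ (and correspondingly for the other index letters). *)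

theory Defs
  imports "HOL-Analysis.Analysis"
begin

section \<open>Smooth maps and smooth manifolds\<close>

(* Meant for open S only: derivatives are taken at (at x), not within S. *)
primrec Ck_on :: "nat \<Rightarrow> 'a::euclidean_space set \<Rightarrow> ('a \<Rightarrow> 'b::real_normed_vector) \<Rightarrow> bool" where
  "Ck_on 0 S f \<longleftrightarrow> continuous_on S f"
| "Ck_on (Suc k) S f \<longleftrightarrow>
     (\<forall>x\<in>S. f differentiable (at x)) \<and> (\<forall>v. Ck_on k S (\<lambda>x. frechet_derivative f (at x) v))"

definition smooth_on :: "'a::euclidean_space set \<Rightarrow> ('a \<Rightarrow> 'b::real_normed_vector) \<Rightarrow> bool" where
  "smooth_on S f \<longleftrightarrow> (\<forall>k. Ck_on k S f)"

(* A chart is a pair (domain, coordinate map); the map is irrelevant outside the domain. *)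
type_synonym ('p, 'e) chart = "'p set \<times> ('p \<Rightarrow> 'e)"

abbreviation chart_inv :: "('p, 'e) chart \<Rightarrow> 'e \<Rightarrow> 'p" where
  "chart_inv c \<equiv> inv_into (fst c) (snd c)"

definition atlas_points :: "('p, 'e) chart set \<Rightarrow> 'p set" where
  "atlas_points \<A> = (\<Union>c\<in>\<A>. fst c)"

definition smooth_atlas :: "('p, 'e::euclidean_space) chart set \<Rightarrow> bool" where
  "smooth_atlas \<A> \<longleftrightarrow>
     (\<forall>c\<in>\<A>. inj_on (snd c) (fst c)) \<and>
     (\<forall>c\<in>\<A>. \<forall>d\<in>\<A>. open (snd c ` (fst c \<inter> fst d)) \<and>
        smooth_on (snd c ` (fst c \<inter> fst d)) (snd d \<circ> chart_inv c))"

definition atlas_open :: "('p, 'e::euclidean_space) chart set \<Rightarrow> 'p set \<Rightarrow> bool" where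
  "atlas_open \<A> Q \<longleftrightarrow> Q \<subseteq> atlas_points \<A> \<and> (\<forall>c\<in>\<A>. open (snd c ` (fst c \<inter> Q)))"

lemma istopology_atlas_open:
  assumes "smooth_atlas \<A>"
  shows "istopology (atlas_open \<A>)"
proof -
  have inj: "inj_on (snd c) (fst c)" if "c \<in> \<A>" for c
    using assms that by (simp add: smooth_atlas_def)
  have "atlas_open \<A> (S \<inter> T)" if "atlas_open \<A> S" "atlas_open \<A> T" for S T
  proof -
    have "snd c ` (fst c \<inter> (S \<inter> T)) = snd c ` (fst c \<inter> S) \<inter> snd c ` (fst c \<inter> T)"
      if "c \<in> \<A>" for c
      using inj[OF that] by (auto simp: inj_on_def)
    then show ?thesis using that by (auto simp: atlas_open_def)
  qed
  moreover have "atlas_open \<A> (\<Union>K)" if "\<forall>S\<in>K. atlas_open \<A> S" for K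
  proof -
    have eq: "snd c ` (fst c \<inter> \<Union>K) = (\<Union>S\<in>K. snd c ` (fst c \<inter> S))" for c :: "('a, 'b) chart"
      by auto
    have "open (snd c ` (fst c \<inter> \<Union>K))" if "c \<in> \<A>" for c
      unfolding eq using \<open>\<forall>S\<in>K. atlas_open \<A> S\<close> that by (intro open_UN) (simp add: atlas_open_def)
    then show ?thesis using that unfolding atlas_open_def by blast
  qed
  ultimately show ?thesis by (simp add: istopology_def)
qed

definition atlas_topology :: "('p, 'e::euclidean_space) chart set \<Rightarrow> 'p topology" where
  "atlas_topology \<A> = topology (atlas_open \<A>)"

(* The manifold is the set atlas_points A, with the topology and smooth structure determined by
   the (not necessarily maximal) atlas A. *)
definition smooth_manifold :: "('p, 'e::euclidean_space) chart set \<Rightarrow> bool" where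
  "smooth_manifold \<A> \<longleftrightarrow> smooth_atlas \<A> \<and>
     Hausdorff_space (atlas_topology \<A>) \<and> second_countable (atlas_topology \<A>)"

(* Derivative, in the chart c at the point p, of the function f on the manifold along the vector
   whose components in c are v. *)
definition chart_deriv ::
    "('p, 'e::euclidean_space) chart \<Rightarrow> ('p \<Rightarrow> 'b::real_normed_vector) \<Rightarrow> 'p \<Rightarrow> 'e \<Rightarrow> 'b" where
  "chart_deriv c f p v = frechet_derivative (f \<circ> chart_inv c) (at (snd c p)) v"

definition smooth_in_chart ::
    "('p, 'e::euclidean_space) chart \<Rightarrow> ('p \<Rightarrow> 'b::real_normed_vector) \<Rightarrow> bool" where
  "smooth_in_chart c f \<longleftrightarrow> smooth_on (snd c ` fst c) (f \<circ> chart_inv c)"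

definition smooth_fun :: "('p, 'e::euclidean_space) chart set \<Rightarrow> ('p \<Rightarrow> real) \<Rightarrow> bool" where
  "smooth_fun \<A> f \<longleftrightarrow> (\<forall>c\<in>\<A>. smooth_in_chart c f)"

section \<open>Vector fields and linear connections on a manifold\<close>

(* A vector field X is the family of its component functions: X c p is the vector of components of
   X at p in the chart c.  The components in two charts are related by the Jacobian of the
   coordinate change.  They are set to 0 where they are meaningless, so that equality of families
   is equality of vector fields. *)
type_synonym ('p, 'e) vfield = "('p, 'e) chart \<Rightarrow> 'p \<Rightarrow> 'e"

definition vector_field ::
    "('p, 'e::euclidean_space) chart set \<Rightarrow> ('p, 'e) vfield \<Rightarrow> bool" where
  "vector_field \<A> X \<longleftrightarrow>
     (\<forall>c\<in>\<A>. smooth_in_chart c (X c)) \<and>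
     (\<forall>c\<in>\<A>. \<forall>d\<in>\<A>. \<forall>p\<in>fst c \<inter> fst d. X d p = chart_deriv c (snd d) p (X c p)) \<and>
     (\<forall>c p. c \<notin> \<A> \<or> p \<notin> fst c \<longrightarrow> X c p = 0)"

(* The local vector field on the domain of c with components v in the chart c. *)
definition chart_field ::
    "('p, 'e::euclidean_space) chart set \<Rightarrow> ('p, 'e) chart \<Rightarrow> ('p \<Rightarrow> 'e) \<Rightarrow> ('p, 'e) vfield" where
  "chart_field \<A> c v =
     (\<lambda>d p. if d \<in> \<A> \<and> p \<in> fst c \<inter> fst d then chart_deriv c (snd d) p (v p) else 0)"

(* Lie bracket of two vector fields defined on the open set Q. *)
definition lie_bracket ::
    "('p, 'e::euclidean_space) chart set \<Rightarrow> 'p set \<Rightarrow> ('p, 'e) vfield \<Rightarrow> ('p, 'e) vfield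
      \<Rightarrow> ('p, 'e) vfield" where
  "lie_bracket \<A> Q X Y =
     (\<lambda>d p. if d \<in> \<A> \<and> p \<in> Q \<inter> fst d
            then chart_deriv d (Y d) p (X d p) - chart_deriv d (X d) p (Y d p) else 0)"

type_synonym ('p, 'e) conn = "('p, 'e) vfield \<Rightarrow> ('p, 'e) vfield \<Rightarrow> ('p, 'e) vfield"

definition linear_connection ::
    "('p, 'e::euclidean_space) chart set \<Rightarrow> ('p, 'e) conn \<Rightarrow> bool" where
  "linear_connection \<A> nab \<longleftrightarrow>
     (\<forall>X Y. vector_field \<A> X \<longrightarrow> vector_field \<A> Y \<longrightarrow> vector_field \<A> (nab X Y)) \<and>
     (\<forall>X X' Y. vector_field \<A> X \<longrightarrow> vector_field \<A> X' \<longrightarrow> vector_field \<A> Y \<longrightarrow>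
        nab (\<lambda>c p. X c p + X' c p) Y = (\<lambda>c p. nab X Y c p + nab X' Y c p)) \<and>
     (\<forall>f X Y. smooth_fun \<A> f \<longrightarrow> vector_field \<A> X \<longrightarrow> vector_field \<A> Y \<longrightarrow>
        nab (\<lambda>c p. f p *\<^sub>R X c p) Y = (\<lambda>c p. f p *\<^sub>R nab X Y c p)) \<and>
     (\<forall>X Y Y'. vector_field \<A> X \<longrightarrow> vector_field \<A> Y \<longrightarrow> vector_field \<A> Y' \<longrightarrow>
        nab X (\<lambda>c p. Y c p + Y' c p) = (\<lambda>c p. nab X Y c p + nab X Y' c p)) \<and>
     (\<forall>f X Y. smooth_fun \<A> f \<longrightarrow> vector_field \<A> X \<longrightarrow> vector_field \<A> Y \<longrightarrow>
        (\<forall>c\<in>\<A>. \<forall>p\<in>fst c.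
           nab X (\<lambda>c p. f p *\<^sub>R Y c p) c p
             = chart_deriv c f p (X c p) *\<^sub>R Y c p + f p *\<^sub>R nab X Y c p))"

(* The connection induced by nab on the open set Q, which is needed since local frames are not
   global vector fields: near each point of Q the arguments are replaced by global vector fields
   with the same germ; the result does not depend on the choice, nab being a local operator. *)
definition induced_conn ::
    "('p, 'e::euclidean_space) chart set \<Rightarrow> ('p, 'e) conn \<Rightarrow> 'p set \<Rightarrow> ('p, 'e) conn" where
  "induced_conn \<A> nab Q X Y =
     (\<lambda>c p. if p \<in> Q
        then (THE w. \<exists>X' Y' V. vector_field \<A> X' \<and> vector_field \<A> Y' \<and>
                openin (atlas_topology \<A>) V \<and> p \<in> V \<and> V \<subseteq> Q \<and>
                (\<forall>d. \<forall>q\<in>V. X' d q = X d q \<and> Y' d q = Y d q) \<and> w = nab X' Y' c p)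
        else 0)"

(* R(X,Y)Z for vector fields defined on the open set Q. *)
definition curvature ::
    "('p, 'e::euclidean_space) chart set \<Rightarrow> ('p, 'e) conn \<Rightarrow> 'p set
      \<Rightarrow> ('p, 'e) vfield \<Rightarrow> ('p, 'e) vfield \<Rightarrow> ('p, 'e) vfield \<Rightarrow> ('p, 'e) vfield" where
  "curvature \<A> nab Q X Y Z =
     (let D = induced_conn \<A> nab Q
      in (\<lambda>c p. D X (D Y Z) c p - D Y (D X Z) c p - D (lie_bracket \<A> Q X Y) Z c p))"

section \<open>The 1-jet bundle\<close>

(* The maximal atlas of the time manifold: all local coordinate systems of the real line. *)
definition time_atlas :: "(real, real) chart set" where
  "time_atlas = {(T, \<tau>). open T \<and> inj_on \<tau> T \<and> open (\<tau> ` T) \<and>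
                    smooth_on T \<tau> \<and> smooth_on (\<tau> ` T) (inv_into T \<tau>)}"

definition smooth_curve_at ::
    "('m, 'e::euclidean_space) chart set \<Rightarrow> real \<Rightarrow> (real \<Rightarrow> 'm) \<Rightarrow> bool" where
  "smooth_curve_at A t f \<longleftrightarrow>
     (\<exists>I. open I \<and> t \<in> I \<and> f ` I \<subseteq> atlas_points A \<and>
        (\<forall>c\<in>A. open {s\<in>I. f s \<in> fst c} \<and> smooth_on {s\<in>I. f s \<in> fst c} (snd c \<circ> f)))"

definition jet_rel ::
    "('m, 'e::euclidean_space) chart set \<Rightarrow> ((real \<times> (real \<Rightarrow> 'm)) \<times> (real \<times> (real \<Rightarrow> 'm))) set" where
  "jet_rel A = {((t, f), (s, g)). smooth_curve_at A t f \<and> smooth_curve_at A s g \<and>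
     t = s \<and> f t = g t \<and>
     (\<forall>c\<in>A. f t \<in> fst c \<longrightarrow>
        vector_derivative (snd c \<circ> f) (at t) = vector_derivative (snd c \<circ> g) (at t))}"

type_synonym 'm jet = "(real \<times> (real \<Rightarrow> 'm)) set"

definition jet_space :: "('m, 'e::euclidean_space) chart set \<Rightarrow> 'm jet set" where
  "jet_space A = {(t, f). smooth_curve_at A t f} // jet_rel A"

(* The chart with coordinates (t, x, y) induced by a coordinate of time and a chart of M. *)
definition jet_chart ::
    "('m, 'e::euclidean_space) chart set \<Rightarrow> (real, real) chart \<Rightarrow> ('m, 'e) chart
      \<Rightarrow> ('m jet, real \<times> 'e \<times> 'e) chart" where
  "jet_chart A a b =
     ({e \<in> jet_space A. \<exists>(t, f)\<in>e. t \<in> fst a \<and> f t \<in> fst b},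
      (\<lambda>e. let (t, f) = (SOME z. z \<in> e)
           in (snd a t, snd b (f t),
               vector_derivative (snd b \<circ> f \<circ> chart_inv a) (at (snd a t)))))"

definition jet_atlas ::
    "('m, 'e::euclidean_space) chart set \<Rightarrow> ('m jet, real \<times> 'e \<times> 'e) chart set" where
  "jet_atlas A = {jet_chart A a b | a b. a \<in> time_atlas \<and> b \<in> A}"

type_synonym 'n jcoord = "real \<times> (real^'n) \<times> (real^'n)"
type_synonym ('m, 'n) jchart = "('m jet, 'n jcoord) chart"

abbreviation t_part :: "'n::finite jcoord \<Rightarrow> real" where "t_part w \<equiv> fst w"
abbreviation x_part :: "'n::finite jcoord \<Rightarrow> real^'n" where "x_part w \<equiv> fst (snd w)"
abbreviation y_part :: "'n::finite jcoord \<Rightarrow> real^'n" where "y_part w \<equiv> snd (snd w)"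

abbreviation e_t :: "'n::finite jcoord" where "e_t \<equiv> (1, 0, 0)"
abbreviation e_x :: "'n::finite \<Rightarrow> 'n jcoord" where "e_x i \<equiv> (0, axis i 1, 0)"
abbreviation e_y :: "'n::finite \<Rightarrow> 'n jcoord" where "e_y i \<equiv> (0, 0, axis i 1)"

section \<open>Nonlinear connections and adapted frames\<close>

(* M_comp \<Gamma> c j p is the component M of \<Gamma> with upper index j, and N_comp \<Gamma> c j i p the component N
   with upper index j and lower index i, at the point p in the chart c. *)
record ('m, 'n) nonlinear_conn =
  M_comp :: "('m, 'n) jchart \<Rightarrow> 'n \<Rightarrow> 'm jet \<Rightarrow> real"
  N_comp :: "('m, 'n) jchart \<Rightarrow> 'n \<Rightarrow> 'n \<Rightarrow> 'm jet \<Rightarrow> real"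

(* c carries the coordinates (t, x, y) and d the coordinates with a tilde; J and K are the
   Jacobians of the two coordinate changes.  Thus t_part (K e_t) is dt/dt~,
   x_part (J (e_x j)) $ k is dx~^k/dx^j, x_part (K (e_x l)) $ i is dx^i/dx~^l, and
   y_part (J e_t) $ k, y_part (J (e_x i)) $ k are dy~^k/dt, dy~^k/dx^i. *)
definition nonlinear_connection ::
    "('m, real^'n::finite) chart set \<Rightarrow> ('m, 'n) nonlinear_conn \<Rightarrow> bool" where
  "nonlinear_connection A \<Gamma> \<longleftrightarrow>
     (\<forall>c\<in>jet_atlas A. \<forall>i j. smooth_in_chart c (M_comp \<Gamma> c j) \<and>
                              smooth_in_chart c (N_comp \<Gamma> c j i)) \<and>
     (\<forall>c\<in>jet_atlas A. \<forall>d\<in>jet_atlas A. \<forall>p\<in>fst c \<inter> fst d.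
        let J = chart_deriv c (snd d) p; K = chart_deriv d (snd c) p in
        (\<forall>k. M_comp \<Gamma> d k p =
               (\<Sum>j\<in>UNIV. M_comp \<Gamma> c j p * (t_part (K e_t))\<^sup>2 * x_part (J (e_x j)) $ k)
               - t_part (K e_t) * y_part (J e_t) $ k) \<and>
        (\<forall>k l. N_comp \<Gamma> d k l p =
               (\<Sum>i\<in>UNIV. \<Sum>j\<in>UNIV. N_comp \<Gamma> c j i p * t_part (K e_t)
                   * x_part (K (e_x l)) $ i * x_part (J (e_x j)) $ k)
               - (\<Sum>i\<in>UNIV. x_part (K (e_x l)) $ i * y_part (J (e_x i)) $ k)))"

(* Components, in the chart c, of the adapted basis. *)
definition delta_t ::
    "('m, 'n::finite) nonlinear_conn \<Rightarrow> ('m, 'n) jchart \<Rightarrow> 'm jet \<Rightarrow> 'n jcoord" where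
  "delta_t \<Gamma> c p = e_t - (\<Sum>j\<in>UNIV. M_comp \<Gamma> c j p *\<^sub>R e_y j)"

definition delta_x ::
    "('m, 'n::finite) nonlinear_conn \<Rightarrow> ('m, 'n) jchart \<Rightarrow> 'n \<Rightarrow> 'm jet \<Rightarrow> 'n jcoord" where
  "delta_x \<Gamma> c i p = e_x i - (\<Sum>j\<in>UNIV. N_comp \<Gamma> c j i p *\<^sub>R e_y j)"

definition partial_y :: "'n::finite \<Rightarrow> 'm jet \<Rightarrow> 'n jcoord" where
  "partial_y i p = e_y i"

(* Action of the adapted basis on functions. *)
definition d_t ::
    "('m, 'n::finite) nonlinear_conn \<Rightarrow> ('m, 'n) jchart \<Rightarrow> ('m jet \<Rightarrow> real) \<Rightarrow> 'm jet \<Rightarrow> real" where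
  "d_t \<Gamma> c f p = chart_deriv c f p (delta_t \<Gamma> c p)"

definition d_x ::
    "('m, 'n::finite) nonlinear_conn \<Rightarrow> ('m, 'n) jchart \<Rightarrow> 'n \<Rightarrow> ('m jet \<Rightarrow> real) \<Rightarrow> 'm jet \<Rightarrow> real" where
  "d_x \<Gamma> c i f p = chart_deriv c f p (delta_x \<Gamma> c i p)"

definition d_y :: "('m, 'n::finite) jchart \<Rightarrow> 'n \<Rightarrow> ('m jet \<Rightarrow> real) \<Rightarrow> 'm jet \<Rightarrow> real" where
  "d_y c i f p = chart_deriv c f p (partial_y i p)"

(* The projections onto the three summands.  A vector with components (a, u, w) in c is
   a delta_t + u^i delta_x_i + (w^j + M^j a + N^j_i u^i) partial_y_j. *)
definition h_R ::
    "('m, 'n::finite) nonlinear_conn \<Rightarrow> ('m jet, 'n jcoord) vfield \<Rightarrow> ('m jet, 'n jcoord) vfield" where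
  "h_R \<Gamma> X = (\<lambda>c p. t_part (X c p) *\<^sub>R delta_t \<Gamma> c p)"

definition h_M ::
    "('m, 'n::finite) nonlinear_conn \<Rightarrow> ('m jet, 'n jcoord) vfield \<Rightarrow> ('m jet, 'n jcoord) vfield" where
  "h_M \<Gamma> X = (\<lambda>c p. \<Sum>i\<in>UNIV. (x_part (X c p) $ i) *\<^sub>R delta_x \<Gamma> c i p)"

definition v_proj ::
    "('m, 'n::finite) nonlinear_conn \<Rightarrow> ('m jet, 'n jcoord) vfield \<Rightarrow> ('m jet, 'n jcoord) vfield" where
  "v_proj \<Gamma> X = (\<lambda>c p. \<Sum>j\<in>UNIV.
      (y_part (X c p) $ j + M_comp \<Gamma> c j p * t_part (X c p)
         + (\<Sum>i\<in>UNIV. N_comp \<Gamma> c j i p * x_part (X c p) $ i)) *\<^sub>R partial_y j p)"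

definition Gamma_linear_connection ::
    "('m, real^'n::finite) chart set \<Rightarrow> ('m, 'n) nonlinear_conn \<Rightarrow> ('m jet, 'n jcoord) conn \<Rightarrow> bool" where
  "Gamma_linear_connection A \<Gamma> nab \<longleftrightarrow>
     linear_connection (jet_atlas A) nab \<and>
     (\<forall>X Y. vector_field (jet_atlas A) X \<longrightarrow> vector_field (jet_atlas A) Y \<longrightarrow>
        nab X (h_R \<Gamma> Y) = h_R \<Gamma> (nab X Y) \<and>
        nab X (h_M \<Gamma> Y) = h_M \<Gamma> (nab X Y) \<and>
        nab X (v_proj \<Gamma> Y) = v_proj \<Gamma> (nab X Y))"

section \<open>Adapted coefficients and curvature d-tensors\<close>

(* Coefficients of a vector (given in the chart c) lying in one of the three summands. *)
definition t_coeff ::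
    "('m, 'n::finite) nonlinear_conn \<Rightarrow> ('m, 'n) jchart \<Rightarrow> 'm jet \<Rightarrow> 'n jcoord \<Rightarrow> real" where
  "t_coeff \<Gamma> c p w = (THE a. w = a *\<^sub>R delta_t \<Gamma> c p)"

definition x_coeff ::
    "('m, 'n::finite) nonlinear_conn \<Rightarrow> ('m, 'n) jchart \<Rightarrow> 'm jet \<Rightarrow> 'n jcoord \<Rightarrow> 'n \<Rightarrow> real" where
  "x_coeff \<Gamma> c p w = (THE a. w = (\<Sum>k\<in>UNIV. a k *\<^sub>R delta_x \<Gamma> c k p))"

definition y_coeff :: "'m jet \<Rightarrow> 'n::finite jcoord \<Rightarrow> 'n \<Rightarrow> real" where
  "y_coeff p w = (THE a. w = (\<Sum>k\<in>UNIV. a k *\<^sub>R partial_y k p))"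

(* Index convention for all coefficient and tensor families below: upper index first (if there is
   one other than the time index 1), then the lower indices from left to right, time indices being
   omitted. E.g. G k i, L k i j, C k i j are the coefficients G, L, C with upper index k. *)
definition adapted_coefficients ::
    "('m, real^'n::finite) chart set \<Rightarrow> ('m, 'n) nonlinear_conn \<Rightarrow> ('m jet, 'n jcoord) conn
      \<Rightarrow> ('m, 'n) jchart \<Rightarrow>
      ('m jet \<Rightarrow> real) \<times> ('n \<Rightarrow> 'n \<Rightarrow> 'm jet \<Rightarrow> real) \<times> ('n \<Rightarrow> 'n \<Rightarrow> 'm jet \<Rightarrow> real) \<times>
      ('n \<Rightarrow> 'm jet \<Rightarrow> real) \<times> ('n \<Rightarrow> 'n \<Rightarrow> 'n \<Rightarrow> 'm jet \<Rightarrow> real) \<times> ('n \<Rightarrow> 'n \<Rightarrow> 'n \<Rightarrow> 'm jet \<Rightarrow> real) \<times>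
      ('n \<Rightarrow> 'm jet \<Rightarrow> real) \<times> ('n \<Rightarrow> 'n \<Rightarrow> 'n \<Rightarrow> 'm jet \<Rightarrow> real) \<times> ('n \<Rightarrow> 'n \<Rightarrow> 'n \<Rightarrow> 'm jet \<Rightarrow> real)" where
  "adapted_coefficients A \<Gamma> nab c =
     (let D = induced_conn (jet_atlas A) nab (fst c);
          Et = chart_field (jet_atlas A) c (delta_t \<Gamma> c);
          Ex = (\<lambda>i. chart_field (jet_atlas A) c (delta_x \<Gamma> c i));
          Ey = (\<lambda>i. chart_field (jet_atlas A) c (partial_y i))
      in ((\<lambda>p. t_coeff \<Gamma> c p (D Et Et c p)),
          (\<lambda>k i p. x_coeff \<Gamma> c p (D Et (Ex i) c p) k),
          (\<lambda>k i p. y_coeff p (D Et (Ey i) c p) k),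
          (\<lambda>j p. t_coeff \<Gamma> c p (D (Ex j) Et c p)),
          (\<lambda>k i j p. x_coeff \<Gamma> c p (D (Ex j) (Ex i) c p) k),
          (\<lambda>k i j p. y_coeff p (D (Ex j) (Ey i) c p) k),
          (\<lambda>j p. t_coeff \<Gamma> c p (D (Ey j) Et c p)),
          (\<lambda>k i j p. x_coeff \<Gamma> c p (D (Ey j) (Ex i) c p) k),
          (\<lambda>k i j p. y_coeff p (D (Ey j) (Ey i) c p) k)))"

(* Curvature d-tensors of the three kinds of components (time, M, vertical); each consists of the
   tensors (R with indices 1k, R with jk, P with 1(k), P with j(k), S with (j)(k)). *)
definition curvature_t ::
    "('m, real^'n::finite) chart set \<Rightarrow> ('m, 'n) nonlinear_conn \<Rightarrow> ('m jet, 'n jcoord) conn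
      \<Rightarrow> ('m, 'n) jchart \<Rightarrow>
      ('n \<Rightarrow> 'm jet \<Rightarrow> real) \<times> ('n \<Rightarrow> 'n \<Rightarrow> 'm jet \<Rightarrow> real) \<times>
      ('n \<Rightarrow> 'm jet \<Rightarrow> real) \<times> ('n \<Rightarrow> 'n \<Rightarrow> 'm jet \<Rightarrow> real) \<times> ('n \<Rightarrow> 'n \<Rightarrow> 'm jet \<Rightarrow> real)" where
  "curvature_t A \<Gamma> nab c =
     (let R = curvature (jet_atlas A) nab (fst c);
          Et = chart_field (jet_atlas A) c (delta_t \<Gamma> c);
          Ex = (\<lambda>i. chart_field (jet_atlas A) c (delta_x \<Gamma> c i));
          Ey = (\<lambda>i. chart_field (jet_atlas A) c (partial_y i))
      in ((\<lambda>k p. t_coeff \<Gamma> c p (R (Ex k) Et Et c p)),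
          (\<lambda>j k p. t_coeff \<Gamma> c p (R (Ex k) (Ex j) Et c p)),
          (\<lambda>k p. t_coeff \<Gamma> c p (R (Ey k) Et Et c p)),
          (\<lambda>j k p. t_coeff \<Gamma> c p (R (Ey k) (Ex j) Et c p)),
          (\<lambda>j k p. t_coeff \<Gamma> c p (R (Ey k) (Ey j) Et c p))))"

definition curvature_x ::
    "('m, real^'n::finite) chart set \<Rightarrow> ('m, 'n) nonlinear_conn \<Rightarrow> ('m jet, 'n jcoord) conn
      \<Rightarrow> ('m, 'n) jchart \<Rightarrow>
      ('n \<Rightarrow> 'n \<Rightarrow> 'n \<Rightarrow> 'm jet \<Rightarrow> real) \<times> ('n \<Rightarrow> 'n \<Rightarrow> 'n \<Rightarrow> 'n \<Rightarrow> 'm jet \<Rightarrow> real) \<times>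
      ('n \<Rightarrow> 'n \<Rightarrow> 'n \<Rightarrow> 'm jet \<Rightarrow> real) \<times> ('n \<Rightarrow> 'n \<Rightarrow> 'n \<Rightarrow> 'n \<Rightarrow> 'm jet \<Rightarrow> real) \<times>
      ('n \<Rightarrow> 'n \<Rightarrow> 'n \<Rightarrow> 'n \<Rightarrow> 'm jet \<Rightarrow> real)" where
  "curvature_x A \<Gamma> nab c =
     (let R = curvature (jet_atlas A) nab (fst c);
          Et = chart_field (jet_atlas A) c (delta_t \<Gamma> c);
          Ex = (\<lambda>i. chart_field (jet_atlas A) c (delta_x \<Gamma> c i));
          Ey = (\<lambda>i. chart_field (jet_atlas A) c (partial_y i))
      in ((\<lambda>l i k p. x_coeff \<Gamma> c p (R (Ex k) Et (Ex i) c p) l),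
          (\<lambda>l i j k p. x_coeff \<Gamma> c p (R (Ex k) (Ex j) (Ex i) c p) l),
          (\<lambda>l i k p. x_coeff \<Gamma> c p (R (Ey k) Et (Ex i) c p) l),
          (\<lambda>l i j k p. x_coeff \<Gamma> c p (R (Ey k) (Ex j) (Ex i) c p) l),
          (\<lambda>l i j k p. x_coeff \<Gamma> c p (R (Ey k) (Ey j) (Ex i) c p) l)))"

definition curvature_y ::
    "('m, real^'n::finite) chart set \<Rightarrow> ('m, 'n) nonlinear_conn \<Rightarrow> ('m jet, 'n jcoord) conn
      \<Rightarrow> ('m, 'n) jchart \<Rightarrow>
      ('n \<Rightarrow> 'n \<Rightarrow> 'n \<Rightarrow> 'm jet \<Rightarrow> real) \<times> ('n \<Rightarrow> 'n \<Rightarrow> 'n \<Rightarrow> 'n \<Rightarrow> 'm jet \<Rightarrow> real) \<times>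
      ('n \<Rightarrow> 'n \<Rightarrow> 'n \<Rightarrow> 'm jet \<Rightarrow> real) \<times> ('n \<Rightarrow> 'n \<Rightarrow> 'n \<Rightarrow> 'n \<Rightarrow> 'm jet \<Rightarrow> real) \<times>
      ('n \<Rightarrow> 'n \<Rightarrow> 'n \<Rightarrow> 'n \<Rightarrow> 'm jet \<Rightarrow> real)" where
  "curvature_y A \<Gamma> nab c =
     (let R = curvature (jet_atlas A) nab (fst c);
          Et = chart_field (jet_atlas A) c (delta_t \<Gamma> c);
          Ex = (\<lambda>i. chart_field (jet_atlas A) c (delta_x \<Gamma> c i));
          Ey = (\<lambda>i. chart_field (jet_atlas A) c (partial_y i))
      in ((\<lambda>l i k p. y_coeff p (R (Ex k) Et (Ey i) c p) l),
          (\<lambda>l i j k p. y_coeff p (R (Ex k) (Ex j) (Ey i) c p) l),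
          (\<lambda>l i k p. y_coeff p (R (Ey k) Et (Ey i) c p) l),
          (\<lambda>l i j k p. y_coeff p (R (Ey k) (Ex j) (Ey i) c p) l),
          (\<lambda>l i j k p. y_coeff p (R (Ey k) (Ey j) (Ey i) c p) l)))"

section \<open>Torsion d-tensors and covariant derivatives of d-tensors\<close>

definition torsion_R1 ::
    "('m, 'n::finite) nonlinear_conn \<Rightarrow> ('m, 'n) jchart \<Rightarrow> 'n \<Rightarrow> 'n \<Rightarrow> 'm jet \<Rightarrow> real" where
  "torsion_R1 \<Gamma> c r j p = d_x \<Gamma> c j (M_comp \<Gamma> c r) p - d_t \<Gamma> c (N_comp \<Gamma> c r j) p"

definition torsion_R ::
    "('m, 'n::finite) nonlinear_conn \<Rightarrow> ('m, 'n) jchart \<Rightarrow> 'n \<Rightarrow> 'n \<Rightarrow> 'n \<Rightarrow> 'm jet \<Rightarrow> real" where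
  "torsion_R \<Gamma> c r i j p = d_x \<Gamma> c j (N_comp \<Gamma> c r i) p - d_x \<Gamma> c i (N_comp \<Gamma> c r j) p"

(* Gv and Lv stand for the vertical coefficients, with indices (k)(1)(1)(i)1 and (k)(1)(1)(i)j,
   of the connection. *)
definition torsion_P1 ::
    "('m, 'n::finite) nonlinear_conn \<Rightarrow> ('m, 'n) jchart \<Rightarrow> ('n \<Rightarrow> 'n \<Rightarrow> 'm jet \<Rightarrow> real)
      \<Rightarrow> 'n \<Rightarrow> 'n \<Rightarrow> 'm jet \<Rightarrow> real" where
  "torsion_P1 \<Gamma> c Gv r j p = d_y c j (M_comp \<Gamma> c r) p - Gv r j p"

definition torsion_P ::
    "('m, 'n::finite) nonlinear_conn \<Rightarrow> ('m, 'n) jchart \<Rightarrow> ('n \<Rightarrow> 'n \<Rightarrow> 'n \<Rightarrow> 'm jet \<Rightarrow> real)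
      \<Rightarrow> 'n \<Rightarrow> 'n \<Rightarrow> 'n \<Rightarrow> 'm jet \<Rightarrow> real" where
  "torsion_P \<Gamma> c Lv r i j p = d_y c j (N_comp \<Gamma> c r i) p - Lv r j i p"

(* A d-tensor index: the time index 1, a horizontal index i, or a vertical index, i.e. a pair
   (j), (1) on opposite levels, its level being that of the (j). *)
datatype 'n dindex = Tm | Hor 'n | Ver 'n

fun same_kind :: "'n dindex \<Rightarrow> 'n dindex set" where
  "same_kind Tm = {Tm}"
| "same_kind (Hor _) = range Hor"
| "same_kind (Ver _) = range Ver"

(* D us ls p is the component at p with contravariant indices us and covariant indices ls. *)
type_synonym ('m, 'n) dtensor = "'n dindex list \<Rightarrow> 'n dindex list \<Rightarrow> 'm jet \<Rightarrow> real"

(* The coefficients of a fixed direction of derivation, first argument upper, second lower. *)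
fun dir_coeff :: "real \<Rightarrow> ('n \<Rightarrow> 'n \<Rightarrow> real) \<Rightarrow> ('n \<Rightarrow> 'n \<Rightarrow> real) \<Rightarrow> 'n dindex \<Rightarrow> 'n dindex \<Rightarrow> real" where
  "dir_coeff a h v Tm Tm = a"
| "dir_coeff a h v (Hor k) (Hor i) = h k i"
| "dir_coeff a h v (Ver k) (Ver i) = v k i"
| "dir_coeff a h v _ _ = 0"

definition connection_terms ::
    "('n::finite dindex \<Rightarrow> 'n dindex \<Rightarrow> real) \<Rightarrow> ('m, 'n) dtensor \<Rightarrow> ('m, 'n) dtensor" where
  "connection_terms \<omega> D us ls p =
     (\<Sum>a<length us. \<Sum>r\<in>same_kind (us ! a). D (us[a := r]) ls p * \<omega> (us ! a) r)
     - (\<Sum>b<length ls. \<Sum>r\<in>same_kind (ls ! b). D us (ls[b := r]) p * \<omega> r (ls ! b))"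

definition cov_t ::
    "('m, 'n::finite) nonlinear_conn \<Rightarrow> ('m, 'n) jchart \<Rightarrow> ('m jet \<Rightarrow> real)
      \<Rightarrow> ('n \<Rightarrow> 'n \<Rightarrow> 'm jet \<Rightarrow> real) \<Rightarrow> ('n \<Rightarrow> 'n \<Rightarrow> 'm jet \<Rightarrow> real)
      \<Rightarrow> ('m, 'n) dtensor \<Rightarrow> ('m, 'n) dtensor" where
  "cov_t \<Gamma> c Gbar G Gv D us ls p = d_t \<Gamma> c (D us ls) p
     + connection_terms (dir_coeff (Gbar p) (\<lambda>k i. G k i p) (\<lambda>k i. Gv k i p)) D us ls p"

definition cov_x ::
    "('m, 'n::finite) nonlinear_conn \<Rightarrow> ('m, 'n) jchart \<Rightarrow> ('n \<Rightarrow> 'm jet \<Rightarrow> real)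
      \<Rightarrow> ('n \<Rightarrow> 'n \<Rightarrow> 'n \<Rightarrow> 'm jet \<Rightarrow> real) \<Rightarrow> ('n \<Rightarrow> 'n \<Rightarrow> 'n \<Rightarrow> 'm jet \<Rightarrow> real)
      \<Rightarrow> 'n \<Rightarrow> ('m, 'n) dtensor \<Rightarrow> ('m, 'n) dtensor" where
  "cov_x \<Gamma> c Lbar L Lv q D us ls p = d_x \<Gamma> c q (D us ls) p
     + connection_terms (dir_coeff (Lbar q p) (\<lambda>k i. L k i q p) (\<lambda>k i. Lv k i q p)) D us ls p"

(* The coefficients C as d-tensors. *)
definition Cbar_tensor :: "('n \<Rightarrow> 'm jet \<Rightarrow> real) \<Rightarrow> ('m, 'n) dtensor" where
  "Cbar_tensor Cbar us ls p =
     (case (us, ls) of ([Tm], [Tm, Ver k]) \<Rightarrow> Cbar k p | _ \<Rightarrow> 0)"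

definition C_tensor :: "('n \<Rightarrow> 'n \<Rightarrow> 'n \<Rightarrow> 'm jet \<Rightarrow> real) \<Rightarrow> ('m, 'n) dtensor" where
  "C_tensor C us ls p =
     (case (us, ls) of ([Hor l], [Hor i, Ver k]) \<Rightarrow> C l i k p | _ \<Rightarrow> 0)"

definition Cv_tensor :: "('n \<Rightarrow> 'n \<Rightarrow> 'n \<Rightarrow> 'm jet \<Rightarrow> real) \<Rightarrow> ('m, 'n) dtensor" where
  "Cv_tensor Cv us ls p =
     (case (us, ls) of ([Ver l], [Ver i, Ver k]) \<Rightarrow> Cv l i k p | _ \<Rightarrow> 0)"

end

theory Submission
  imports Defs
begin

text \<open>Over a chart of the jet bundle the curvature is computed in the adapted frame. Because the connection
  commutes with the three projections, $\nabla_w$ maps each of the three parts of the frame (the vector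
  $\delta / \delta t$, the vectors $\delta / \delta x^i$, the vectors $\partial / \partial y^i$) into its own span and is
  described there by a matrix $\omega(w)$ of functions, which is linear in $w$. For each part $(E_i)$ the Leibniz
  rule gives the structure equation (lemma \<open>curvature_frame\<close>)
  $$R(u, v) E_i = \bigl(u(\omega(v)^l_i) - v(\omega(u)^l_i) + \omega(v)^r_i \omega(u)^l_r
      - \omega(u)^r_i \omega(v)^l_r - \omega([u, v])^l_i\bigr) E_l .$$
  If \<open>u\<close> and \<open>v\<close> are frame vectors, the entries of $\omega(u)$ and $\omega(v)$ are adapted coefficients, and $[u, v]$
  is a vertical vector. For two horizontal vectors its components are the negatives of the torsion
  components $R$; for a vertical and a horizontal vector they are the negatives of the vertical derivatives
  of \<open>M\<close> or \<open>N\<close>. Hence $- \omega([u, v])$ is a sum over the coefficients $C$. In the mixed case the commutator of the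
  matrices is the part of the covariant derivative of $C$ that belongs to its first two indices; its part for
  the last index is what distinguishes the torsion component $P$ from the vertical derivative of \<open>M\<close> or \<open>N\<close>.

  For this computation one must know that frame vectors, brackets and covariant derivatives are legitimate
  arguments of the connection, which acts on global vector fields. Four facts are responsible. The
  connection is a local operator (\<open>nab_local\<close>), and every local field has the germ of a global one; both are
  proved with cutoff functions (\<open>cutoff_function\<close>), which exist because the jet bundle is a Hausdorff manifold
  (\<open>smooth_atlas_jet\<close>, \<open>Hausdorff_jet\<close>). The Lie bracket taken chart by chart is a vector field
  (\<open>lie_bracket_chart_field\<close>), because second derivatives are symmetric. The three parts of the frame span the
  same spaces in all charts (\<open>delta_t_transform\<close>, \<open>delta_x_transform\<close>), because the transformation laws of
  \<open>M\<close> and \<open>N\<close> absorb the derivatives of $\tilde y$ with respect to $t$ and $x$. On this basis the induced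
  connection has the usual algebraic properties on the components of fields in a single chart
  (\<open>local_conn_leibniz\<close>, \<open>local_conn_sum_left\<close>).\<close>

section \<open>Smooth maps\<close>

lemma frechet_derivativeI: "(f has_derivative f') (at x) \<Longrightarrow> frechet_derivative f (at x) = f'"
  by (rule frechet_derivative_at[symmetric])

lemma frechet_derivative_cong_open:
  assumes "open S" "x \<in> S" "\<And>y. y \<in> S \<Longrightarrow> f y = g y"
  shows "frechet_derivative f (at x) = frechet_derivative g (at x)"
proof -
  have "(f has_derivative D) (at x) \<longleftrightarrow> (g has_derivative D) (at x)" for D
    using has_derivative_transform_within_open[OF _ assms(1,2), of f D UNIV g]
      has_derivative_transform_within_open[OF _ assms(1,2), of g D UNIV f] assms(3) by auto
  then show ?thesis by (simp add: frechet_derivative_def)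
qed

lemma differentiable_cong_open:
  assumes "open S" "x \<in> S" "\<And>y. y \<in> S \<Longrightarrow> f y = g y"
  shows "f differentiable (at x) \<longleftrightarrow> g differentiable (at x)"
  unfolding differentiable_def
  using has_derivative_transform_within_open[OF _ assms(1,2), of f _ UNIV g]
      has_derivative_transform_within_open[OF _ assms(1,2), of g _ UNIV f] assms(3) by metis

lemma Ck_on_imp_continuous_on: "Ck_on k S f \<Longrightarrow> continuous_on S f"
  by (cases k) (auto intro!: continuous_at_imp_continuous_on differentiable_imp_continuous_within)

lemma Ck_on_SucD: "Ck_on (Suc k) S f \<Longrightarrow> Ck_on k S f"
proof (induction k arbitrary: f)
  case 0
  then show ?case using Ck_on_imp_continuous_on by (metis Ck_on.simps(1))
next
  case (Suc k)
  then show ?case by (metis Ck_on.simps(2))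
qed

lemma Ck_on_cong:
  assumes "open S" "\<And>x. x \<in> S \<Longrightarrow> f x = g x"
  shows "Ck_on k S f \<longleftrightarrow> Ck_on k S g"
  using assms(2)
proof (induction k arbitrary: f g)
  case 0
  then show ?case using continuous_on_cong[of S S f g] by simp
next
  case (Suc k)
  have "Ck_on k S (\<lambda>x. frechet_derivative f (at x) v) \<longleftrightarrow>
        Ck_on k S (\<lambda>x. frechet_derivative g (at x) v)" for v
    using Suc.prems
    by (intro Suc.IH) (metis frechet_derivative_cong_open[OF assms(1)])
  moreover have "f differentiable (at x) \<longleftrightarrow> g differentiable (at x)" if "x \<in> S" for x
    using differentiable_cong_open[OF assms(1) that Suc.prems] by simp
  ultimately show ?case by simp
qed

lemma Ck_on_subset: "Ck_on k S f \<Longrightarrow> T \<subseteq> S \<Longrightarrow> Ck_on k T f"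
  by (induction k arbitrary: f) (auto intro: continuous_on_subset)

lemma Ck_on_local:
  assumes "\<And>x. x \<in> S \<Longrightarrow> \<exists>T. open T \<and> x \<in> T \<and> Ck_on k T f"
  shows "Ck_on k S f"
  using assms
proof (induction k arbitrary: f)
  case 0
  have "isCont f x" if "x \<in> S" for x
    using 0[OF that] by (auto simp: continuous_on_eq_continuous_at)
  then show ?case by (auto intro: continuous_at_imp_continuous_on)
next
  case (Suc k)
  have "f differentiable (at x)" if "x \<in> S" for x
    using Suc.prems[OF that] by auto
  moreover have "Ck_on k S (\<lambda>x. frechet_derivative f (at x) v)" for v
    by (rule Suc.IH) (metis Suc.prems Ck_on.simps(2))
  ultimately show ?case by simp
qed

lemma Ck_on_const: "Ck_on k S (\<lambda>x. a)"
  by (induction k arbitrary: a) simp_all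

text \<open>The closure properties of \<^const>\<open>Ck_on\<close> are proved by induction on the order. In each of them the
  derivative is exhibited by a formula, and this rule replaces the Frechet derivative by the formula.\<close>

lemma Ck_on_SucI:
  assumes "open S" "\<And>x. x \<in> S \<Longrightarrow> (f has_derivative f' x) (at x)"
    "\<And>v. Ck_on k S (\<lambda>x. f' x v)"
  shows "Ck_on (Suc k) S f"
proof -
  have "Ck_on k S (\<lambda>x. frechet_derivative f (at x) v) \<longleftrightarrow> Ck_on k S (\<lambda>x. f' x v)" for v
    by (rule Ck_on_cong[OF assms(1)]) (simp add: frechet_derivativeI[OF assms(2)])
  then show ?thesis using assms by (auto simp: differentiable_def)
qed

lemma Ck_on_SucE:
  assumes "Ck_on (Suc k) S f"
  obtains f' where "\<And>x. x \<in> S \<Longrightarrow> (f has_derivative f' x) (at x)" "\<And>v. Ck_on k S (\<lambda>x. f' x v)"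
  using assms that[of "\<lambda>x. frechet_derivative f (at x)"] by (auto simp: frechet_derivative_works)

lemma Ck_on_add:
  assumes "open S" "Ck_on k S f" "Ck_on k S g"
  shows "Ck_on k S (\<lambda>x. f x + g x)"
  using assms(2,3)
proof (induction k arbitrary: f g)
  case 0
  then show ?case by (auto intro: continuous_on_add)
next
  case (Suc k)
  obtain f' where f': "\<And>x. x \<in> S \<Longrightarrow> (f has_derivative f' x) (at x)" "\<And>v. Ck_on k S (\<lambda>x. f' x v)"
    using Suc.prems(1) by (rule Ck_on_SucE) blast
  obtain g' where g': "\<And>x. x \<in> S \<Longrightarrow> (g has_derivative g' x) (at x)" "\<And>v. Ck_on k S (\<lambda>x. g' x v)"
    using Suc.prems(2) by (rule Ck_on_SucE) blast
  show ?case
    by (rule Ck_on_SucI[OF assms(1), where f' = "\<lambda>x v. f' x v + g' x v"])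
      (auto intro: has_derivative_add f' g' Suc.IH)
qed

lemma Ck_on_bilinear:
  assumes "open S" "bounded_bilinear h" "Ck_on k S f" "Ck_on k S g"
  shows "Ck_on k S (\<lambda>x. h (f x) (g x))"
  using assms(3,4)
proof (induction k arbitrary: f g)
  case 0
  then show ?case using bounded_bilinear.continuous_on[OF assms(2)] by auto
next
  case (Suc k)
  obtain f' where f': "\<And>x. x \<in> S \<Longrightarrow> (f has_derivative f' x) (at x)" "\<And>v. Ck_on k S (\<lambda>x. f' x v)"
    using Suc.prems(1) by (rule Ck_on_SucE) blast
  obtain g' where g': "\<And>x. x \<in> S \<Longrightarrow> (g has_derivative g' x) (at x)" "\<And>v. Ck_on k S (\<lambda>x. g' x v)"
    using Suc.prems(2) by (rule Ck_on_SucE) blast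
  show ?case
    by (rule Ck_on_SucI[OF assms(1), where f' = "\<lambda>x v. h (f x) (g' x v) + h (f' x v) (g x)"])
      (auto intro!: bounded_bilinear.FDERIV[OF assms(2)] Ck_on_add[OF assms(1)] f' g' Suc.IH
        intro: Suc.prems[THEN Ck_on_SucD])
qed

lemma Ck_on_bounded_linear:
  assumes "open S" "bounded_linear h" "Ck_on k S f"
  shows "Ck_on k S (\<lambda>x. h (f x))"
  using assms(3)
proof (induction k arbitrary: f)
  case 0
  then show ?case using bounded_linear.continuous_on[OF assms(2)] by auto
next
  case (Suc k)
  obtain f' where f': "\<And>x. x \<in> S \<Longrightarrow> (f has_derivative f' x) (at x)" "\<And>v. Ck_on k S (\<lambda>x. f' x v)"
    using Suc.prems(1) by (rule Ck_on_SucE) blast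
  show ?case
    by (rule Ck_on_SucI[OF assms(1), where f' = "\<lambda>x v. h (f' x v)"])
      (auto intro!: bounded_linear.has_derivative[OF assms(2)] f' Suc.IH)
qed

lemma Ck_on_ident: assumes "open S" shows "Ck_on k S (\<lambda>x. x)"
proof (cases k)
  case (Suc m)
  then show ?thesis
    by (auto intro!: Ck_on_SucI[OF assms, where f' = "\<lambda>x v. v"] has_derivative_ident Ck_on_const
        simp del: Ck_on.simps(2))
qed (simp add: continuous_on_id)

lemma Ck_on_sum:
  assumes "open S" "\<And>i. i \<in> I \<Longrightarrow> Ck_on k S (f i)"
  shows "Ck_on k S (\<lambda>x. \<Sum>i\<in>I. f i x)"
  using assms(2)
  by (induction I rule: infinite_finite_induct) (auto intro!: Ck_on_add[OF assms(1)] Ck_on_const)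

lemma linear_sum_Basis:
  fixes h :: "'a::euclidean_space \<Rightarrow> 'b::real_vector"
  assumes "linear h"
  shows "h v = (\<Sum>b\<in>Basis. (v \<bullet> b) *\<^sub>R h b)"
  by (metis (no_types, lifting) assms euclidean_representation linear_cmul linear_sum sum.cong)

text \<open>The induction hypothesis is available only for derivatives of \<open>g\<close> along constant vectors. For this
  reason the chain rule is expanded in a basis.\<close>

lemma Ck_on_compose:
  fixes f :: "'a::euclidean_space \<Rightarrow> 'b::euclidean_space" and g :: "'b \<Rightarrow> 'c::real_normed_vector"
  assumes "open S" "open T" "f ` S \<subseteq> T" "Ck_on k S f" "Ck_on k T g"
  shows "Ck_on k S (\<lambda>x. g (f x))"
  using assms(4,5)
proof (induction k arbitrary: g)
  case 0
  then show ?case using assms(3) by (auto intro: continuous_on_compose2)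
next
  case (Suc k)
  obtain f' where f': "\<And>x. x \<in> S \<Longrightarrow> (f has_derivative f' x) (at x)" "\<And>v. Ck_on k S (\<lambda>x. f' x v)"
    using Suc.prems(1) by (rule Ck_on_SucE) blast
  obtain g' where g': "\<And>x. x \<in> T \<Longrightarrow> (g has_derivative g' x) (at x)" "\<And>v. Ck_on k T (\<lambda>x. g' x v)"
    using Suc.prems(2) by (rule Ck_on_SucE) blast
  have "((\<lambda>x. g (f x)) has_derivative (\<lambda>v. \<Sum>b\<in>Basis. (f' x v \<bullet> b) *\<^sub>R g' (f x) b)) (at x)"
    if "x \<in> S" for x
  proof -
    have g: "(g has_derivative g' (f x)) (at (f x))"
      using g'(1) assms(3) that by auto
    have "((\<lambda>x. g (f x)) has_derivative (\<lambda>v. g' (f x) (f' x v))) (at x)"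
      using has_derivative_compose[OF f'(1)[OF that] g] .
    moreover have "g' (f x) (f' x v) = (\<Sum>b\<in>Basis. (f' x v \<bullet> b) *\<^sub>R g' (f x) b)" for v
      by (intro linear_sum_Basis has_derivative_linear[OF g])
    ultimately show ?thesis by simp
  qed
  then show ?case
    by (rule Ck_on_SucI[OF assms(1)])
      (auto intro!: Ck_on_sum[OF assms(1)] Ck_on_bilinear[OF assms(1) bounded_bilinear_scaleR]
        Ck_on_bounded_linear[OF assms(1) bounded_linear_inner_left] f' Suc.IH g'
        intro: Suc.prems(1)[THEN Ck_on_SucD])
qed

lemma smooth_on_cong:
  "open S \<Longrightarrow> (\<And>x. x \<in> S \<Longrightarrow> f x = g x) \<Longrightarrow> smooth_on S f \<longleftrightarrow> smooth_on S g"
  using Ck_on_cong unfolding smooth_on_def by blast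

lemma smooth_on_subset: "smooth_on S f \<Longrightarrow> T \<subseteq> S \<Longrightarrow> smooth_on T f"
  using Ck_on_subset unfolding smooth_on_def by blast

lemma smooth_on_local:
  "(\<And>x. x \<in> S \<Longrightarrow> \<exists>T. open T \<and> x \<in> T \<and> smooth_on T f) \<Longrightarrow> smooth_on S f"
  unfolding smooth_on_def by (meson Ck_on_local)

lemma smooth_on_const: "smooth_on S (\<lambda>x. a)"
  by (simp add: smooth_on_def Ck_on_const)

lemma smooth_on_ident: "open S \<Longrightarrow> smooth_on S (\<lambda>x. x)"
  by (simp add: smooth_on_def Ck_on_ident)

lemma smooth_on_add: "open S \<Longrightarrow> smooth_on S f \<Longrightarrow> smooth_on S g \<Longrightarrow> smooth_on S (\<lambda>x. f x + g x)"
  by (simp add: smooth_on_def Ck_on_add)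

lemma smooth_on_sum:
  "open S \<Longrightarrow> (\<And>i. i \<in> I \<Longrightarrow> smooth_on S (f i)) \<Longrightarrow> smooth_on S (\<lambda>x. \<Sum>i\<in>I. f i x)"
  by (simp add: smooth_on_def Ck_on_sum)

lemma smooth_on_bilinear:
  "open S \<Longrightarrow> bounded_bilinear h \<Longrightarrow> smooth_on S f \<Longrightarrow> smooth_on S g \<Longrightarrow> smooth_on S (\<lambda>x. h (f x) (g x))"
  by (simp add: smooth_on_def Ck_on_bilinear)

lemmas smooth_on_scaleR = smooth_on_bilinear[OF _ bounded_bilinear_scaleR]
lemmas smooth_on_mult = smooth_on_bilinear[OF _ bounded_bilinear_mult]

lemma smooth_on_bounded_linear:
  "open S \<Longrightarrow> bounded_linear h \<Longrightarrow> smooth_on S f \<Longrightarrow> smooth_on S (\<lambda>x. h (f x))"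
  by (simp add: smooth_on_def Ck_on_bounded_linear)

lemma smooth_on_diff:
  assumes "open S" "smooth_on S f" "smooth_on S g" shows "smooth_on S (\<lambda>x. f x - g x)"
  using smooth_on_add[OF assms(1,2) smooth_on_bounded_linear[OF assms(1) bounded_linear_minus[OF bounded_linear_ident] assms(3)]]
  by simp

lemma smooth_on_compose:
  fixes f :: "'a::euclidean_space \<Rightarrow> 'b::euclidean_space"
  shows "open S \<Longrightarrow> open T \<Longrightarrow> f ` S \<subseteq> T \<Longrightarrow> smooth_on S f \<Longrightarrow> smooth_on T g \<Longrightarrow> smooth_on S (\<lambda>x. g (f x))"
  by (simp add: smooth_on_def Ck_on_compose)

lemma smooth_on_Pair:
  assumes "open S" "smooth_on S f" "smooth_on S g"
  shows "smooth_on S (\<lambda>x. (f x, g x))"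
proof -
  have "bounded_linear (\<lambda>a. (a, 0))" "bounded_linear (\<lambda>a. (0, a))"
    by (auto intro!: bounded_linear_Pair bounded_linear_ident bounded_linear_zero)
  then have "smooth_on S (\<lambda>x. (f x, 0) + (0, g x))"
    using assms by (intro smooth_on_add[OF assms(1)]) (auto intro: smooth_on_bounded_linear[OF assms(1)])
  then show ?thesis by simp
qed

lemma smooth_on_imp_continuous_on: "smooth_on S f \<Longrightarrow> continuous_on S f"
  using Ck_on_imp_continuous_on unfolding smooth_on_def by blast

lemma smooth_on_differentiable: "smooth_on S f \<Longrightarrow> x \<in> S \<Longrightarrow> f differentiable (at x)"
  unfolding smooth_on_def by (metis Ck_on.simps(2))

lemma smooth_on_has_derivative:
  "smooth_on S f \<Longrightarrow> x \<in> S \<Longrightarrow> (f has_derivative frechet_derivative f (at x)) (at x)"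
  using smooth_on_differentiable frechet_derivative_works by blast

lemma smooth_on_derivative_const:
  "smooth_on S f \<Longrightarrow> smooth_on S (\<lambda>x. frechet_derivative f (at x) v)"
  unfolding smooth_on_def by (metis Ck_on.simps(2))

text \<open>The definition of smoothness differentiates along constant vectors only. A direction that varies with
  the point is treated by expanding it in a basis.\<close>

lemma smooth_on_derivative:
  fixes f :: "'a::euclidean_space \<Rightarrow> 'b::real_normed_vector"
  assumes "open S" "open T" "g ` S \<subseteq> T" "smooth_on T f" "smooth_on S g" "smooth_on S v"
  shows "smooth_on S (\<lambda>x. frechet_derivative f (at (g x)) (v x))"
proof -
  have "frechet_derivative f (at (g x)) (v x)
      = (\<Sum>b\<in>Basis. (v x \<bullet> b) *\<^sub>R frechet_derivative f (at (g x)) b)" if "x \<in> S" for x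
    using that assms(3,4)
    by (intro linear_sum_Basis linear_frechet_derivative) (auto intro: smooth_on_differentiable)
  moreover have "smooth_on S (\<lambda>x. \<Sum>b\<in>Basis. (v x \<bullet> b) *\<^sub>R frechet_derivative f (at (g x)) b)"
    using assms
    by (intro smooth_on_sum smooth_on_scaleR smooth_on_bounded_linear[OF _ bounded_linear_inner_left]
          smooth_on_compose[OF assms(1-3,5)] smooth_on_derivative_const) auto
  ultimately show ?thesis using smooth_on_cong[OF assms(1)] by (metis (no_types, lifting))
qed

lemma Ck_on_inverse: "Ck_on k {x::real. x \<noteq> 0} inverse"
proof (induction k)
  case 0
  then show ?case by (auto intro!: continuous_intros)
next
  case (Suc k)
  have o: "open {x::real. x \<noteq> 0}" by (simp add: open_Collect_neq)
  show ?case
    by (rule Ck_on_SucI[OF o, where f' = "\<lambda>x v. - (inverse x * v * inverse x)"])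
      (auto intro!: has_derivative_inverse' Ck_on_bounded_linear[OF o bounded_linear_minus[OF bounded_linear_ident]]
        Ck_on_bilinear[OF o bounded_bilinear_mult] Suc.IH Ck_on_const)
qed

lemma smooth_on_inverse:
  fixes f :: "'a::euclidean_space \<Rightarrow> real"
  assumes "open S" "smooth_on S f" "\<And>x. x \<in> S \<Longrightarrow> f x \<noteq> 0"
  shows "smooth_on S (\<lambda>x. inverse (f x))"
  using assms(3)
  by (intro smooth_on_compose[OF assms(1) _ _ assms(2), of "{x. x \<noteq> 0}" inverse])
    (auto simp: open_Collect_neq smooth_on_def Ck_on_inverse)

section \<open>Cutoff functions on Euclidean spaces\<close>


text \<open>The functions $r^{-n} e^{-1/r}$, continued by $0$. The derivative of one of them is a linear combination of two
  others, so that all of them are shown to be smooth by one induction.\<close>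

definition flat_exp :: "nat \<Rightarrow> real \<Rightarrow> real" where
  "flat_exp n r = (if r > 0 then inverse r ^ n * exp (- inverse r) else 0)"

lemma flat_exp_tendsto_0: "(flat_exp n \<longlongrightarrow> 0) (at 0)"
proof -
  have "((\<lambda>r::real. inverse r ^ n / exp (inverse r)) \<longlongrightarrow> 0) (at_right 0)"
    using filterlim_compose[OF tendsto_power_div_exp_0 filterlim_inverse_at_top_right] by simp
  then have "(flat_exp n \<longlongrightarrow> 0) (at_right 0)"
    by (rule Lim_transform_eventually)
      (auto simp: flat_exp_def exp_minus divide_inverse eventually_at_filter)
  moreover have "(flat_exp n \<longlongrightarrow> 0) (at_left 0)"
    by (rule Lim_transform_eventually[OF tendsto_const])
      (auto simp: flat_exp_def eventually_at_filter)
  ultimately show ?thesis by (simp add: filterlim_at_split)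
qed

text \<open>At $0$ the difference quotient of the function with exponent $n$ is the function with exponent $n + 1$,
  which tends to $0$.\<close>

lemma flat_exp_has_derivative:
  "(flat_exp n has_real_derivative flat_exp (n + 2) r - n * flat_exp (n + 1) r) (at r)"
proof -
  consider "r < 0" | "r = 0" | "r > 0" by linarith
  then show ?thesis
  proof cases
    case 1
    have "((\<lambda>_. 0) has_real_derivative flat_exp (n + 2) r - n * flat_exp (n + 1) r) (at r)"
      using 1 by (auto simp: flat_exp_def)
    then show ?thesis
      by (rule has_field_derivative_transform_within_open[where S = "{..<0}"])
        (use 1 in \<open>auto simp: flat_exp_def\<close>)
  next
    case 2
    have "((\<lambda>h. (flat_exp n (0 + h) - flat_exp n 0) / h) \<longlongrightarrow> 0) (at 0)"
      by (rule Lim_transform_eventually[OF flat_exp_tendsto_0[of "n + 1"]])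
        (auto simp: flat_exp_def eventually_at_filter divide_inverse)
    then show ?thesis using 2 by (simp add: DERIV_def) (simp add: flat_exp_def)
  next
    case 3
    have P: "((\<lambda>r. inverse r ^ n) has_real_derivative - (real n * inverse r ^ (n + 1))) (at r)"
      using DERIV_power[OF DERIV_inverse[of r UNIV], of n] 3 by (cases n) (simp_all add: power2_eq_square mult.assoc)
    have E: "((\<lambda>r. exp (- inverse r)) has_real_derivative exp (- inverse r) * (inverse r)\<^sup>2) (at r)"
      using 3 by (auto intro!: derivative_eq_intros simp: power2_eq_square)
    have "((\<lambda>r. inverse r ^ n * exp (- inverse r)) has_real_derivative
        flat_exp (n + 2) r - n * flat_exp (n + 1) r) (at r)"
      using DERIV_mult[OF P E] 3 by (simp add: flat_exp_def power2_eq_square algebra_simps)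
    then show ?thesis
      by (rule has_field_derivative_transform_within_open[where S = "{0<..}"])
        (use 3 in \<open>auto simp: flat_exp_def\<close>)
  qed
qed

lemma smooth_on_flat_exp: "smooth_on UNIV (flat_exp n)"
proof -
  have "Ck_on k UNIV (flat_exp n)" for k
  proof (induction k arbitrary: n)
    case 0
    then show ?case
      by (auto intro!: continuous_at_imp_continuous_on DERIV_isCont flat_exp_has_derivative)
  next
    case (Suc k)
    have "Ck_on k UNIV (\<lambda>x. (flat_exp (n + 2) x + (- real n) * flat_exp (n + 1) x) * v)" for v
      by (intro Ck_on_bilinear[OF open_UNIV bounded_bilinear_mult] Ck_on_add Ck_on_const Suc.IH open_UNIV)
    then show ?case
      by (intro Ck_on_SucI[where f' = "\<lambda>x v. (flat_exp (n + 2) x - n * flat_exp (n + 1) x) * v"])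
        (use flat_exp_has_derivative in \<open>auto simp: has_field_derivative_def\<close>)
  qed
  then show ?thesis by (simp add: smooth_on_def)
qed

text \<open>The usual quotient $a / (a + b)$, where $a$ vanishes outside the larger ball, $b$ vanishes on the smaller
  ball and the two have no common zero.\<close>

lemma bump_function:
  fixes x0 :: "'a::euclidean_space"
  assumes "0 < r"
  obtains \<phi> :: "'a \<Rightarrow> real" where "smooth_on UNIV \<phi>"
    "\<And>x. x \<in> ball x0 r \<Longrightarrow> \<phi> x = 1" "\<And>x. x \<notin> cball x0 (2 * r) \<Longrightarrow> \<phi> x = 0"
proof -
  define s where "s x = ((x - x0) \<bullet> (x - x0)) - r\<^sup>2" for x
  have s_eq: "s x = (dist x0 x)\<^sup>2 - r\<^sup>2" for x
    by (simp add: s_def dist_norm power2_norm_eq_inner inner_diff_left inner_diff_right inner_commute)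
  (* a vanishes where s \<ge> 3 r^2, that is at distance at least 2 r from x0; b vanishes where s \<le> 0 *)
  define a where "a x = flat_exp 0 (3 * r\<^sup>2 - s x)" for x
  define b where "b x = flat_exp 0 (s x)" for x
  have sm: "smooth_on UNIV s"
    unfolding s_def by (intro smooth_on_diff smooth_on_bilinear[OF _ bounded_bilinear_inner] smooth_on_const smooth_on_ident open_UNIV)
  have sa: "smooth_on UNIV a" unfolding a_def
    by (rule smooth_on_compose[OF _ open_UNIV _ _ smooth_on_flat_exp])
      (auto intro!: smooth_on_diff smooth_on_const sm)
  have sb: "smooth_on UNIV b" unfolding b_def
    by (rule smooth_on_compose[OF _ open_UNIV _ _ smooth_on_flat_exp]) (auto intro!: sm)
  have pos: "a x + b x > 0" for x
  proof (cases "s x > 0")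
    case True then show ?thesis by (simp add: a_def b_def flat_exp_def add_nonneg_pos)
  next
    case False
    moreover have "r\<^sup>2 > 0" using assms by simp
    ultimately have "3 * r\<^sup>2 - s x > 0" by linarith
    then show ?thesis by (simp add: a_def b_def flat_exp_def add_pos_nonneg)
  qed
  show ?thesis
  proof (rule that[of "\<lambda>x. a x * inverse (a x + b x)"])
    show "smooth_on UNIV (\<lambda>x. a x * inverse (a x + b x))"
      using pos by (intro smooth_on_mult smooth_on_inverse smooth_on_add sa sb open_UNIV) (metis less_irrefl)
  next
    fix x assume "x \<in> ball x0 r"
    then have "(dist x0 x)\<^sup>2 < r\<^sup>2" by (intro power_strict_mono) auto
    then have "b x = 0" by (simp add: b_def flat_exp_def s_eq)
    then show "a x * inverse (a x + b x) = 1" using pos[of x] by simp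
  next
    fix x assume "x \<notin> cball x0 (2 * r)"
    then have "(dist x0 x)\<^sup>2 > (2 * r)\<^sup>2" using assms by (intro power_strict_mono) auto
    then have "a x = 0" by (simp add: a_def flat_exp_def s_eq power_mult_distrib)
    then show "a x * inverse (a x + b x) = 0" by simp
  qed
qed

section \<open>Symmetry of second derivatives\<close>

text \<open>The second difference of \<open>f\<close> over a parallelogram does not change when its two sides are exchanged.
  Two applications of the mean value theorem turn it into a mixed second derivative at a point of the
  parallelogram, the order of differentiation being given by the order of the sides.\<close>

lemma second_difference_mvt:
  fixes f :: "'a::real_normed_vector \<Rightarrow> real"
  assumes "0 < h"
    and f: "\<And>s t. 0 \<le> s \<Longrightarrow> s \<le> h \<Longrightarrow> 0 \<le> t \<Longrightarrow> t \<le> h \<Longrightarrow>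
              (f has_derivative f' (x + s *\<^sub>R u + t *\<^sub>R v)) (at (x + s *\<^sub>R u + t *\<^sub>R v))"
    and f': "\<And>s t. 0 \<le> s \<Longrightarrow> s \<le> h \<Longrightarrow> 0 \<le> t \<Longrightarrow> t \<le> h \<Longrightarrow>
              ((\<lambda>y. f' y u) has_derivative f'' (x + s *\<^sub>R u + t *\<^sub>R v)) (at (x + s *\<^sub>R u + t *\<^sub>R v))"
  shows "\<exists>s t. 0 \<le> s \<and> s \<le> h \<and> 0 \<le> t \<and> t \<le> h \<and>
    f (x + h *\<^sub>R u + h *\<^sub>R v) - f (x + h *\<^sub>R u) - f (x + h *\<^sub>R v) + f x
      = h * (h * f'' (x + s *\<^sub>R u + t *\<^sub>R v) v)"
proof -
  define g where "g s = f (x + s *\<^sub>R u + h *\<^sub>R v) - f (x + s *\<^sub>R u + 0 *\<^sub>R v)" for s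
  have line: "((\<lambda>s. x + s *\<^sub>R u + t *\<^sub>R v) has_derivative (\<lambda>d. d *\<^sub>R u)) (at s)"
    "((\<lambda>t. x + s *\<^sub>R u + t *\<^sub>R v) has_derivative (\<lambda>d. d *\<^sub>R v)) (at t)" for s t
    by (auto intro!: derivative_eq_intros)
  have g: "(g has_derivative
      (\<lambda>d. d * (f' (x + s *\<^sub>R u + h *\<^sub>R v) u - f' (x + s *\<^sub>R u + 0 *\<^sub>R v) u))) (at s)"
    if "0 \<le> s" "s \<le> h" for s
  proof -
    have D: "(f has_derivative f' (x + s *\<^sub>R u + t *\<^sub>R v)) (at (x + s *\<^sub>R u + t *\<^sub>R v))"
      if "t = h \<or> t = 0" for t
      using \<open>0 \<le> s\<close> \<open>s \<le> h\<close> that \<open>0 < h\<close> by (intro f) auto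
    have "(g has_derivative
      (\<lambda>d. f' (x + s *\<^sub>R u + h *\<^sub>R v) (d *\<^sub>R u) - f' (x + s *\<^sub>R u + 0 *\<^sub>R v) (d *\<^sub>R u))) (at s)"
      unfolding g_def
      by (intro has_derivative_diff has_derivative_compose[OF line(1) D]) auto
    moreover have "f' (x + s *\<^sub>R u + t *\<^sub>R v) (d *\<^sub>R u) = d * f' (x + s *\<^sub>R u + t *\<^sub>R v) u"
      if "t = h \<or> t = 0" for t d
      using linear_cmul[OF has_derivative_linear[OF D[OF that]]] by simp
    ultimately show ?thesis by (simp only: right_diff_distrib simp_thms)
  qed
  obtain s where s: "s \<in> {0<..<h}"
    and gs: "g h - g 0 = (h - 0) * (f' (x + s *\<^sub>R u + h *\<^sub>R v) u - f' (x + s *\<^sub>R u + 0 *\<^sub>R v) u)"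
    using mvt_simple[OF \<open>0 < h\<close>, of g, OF has_derivative_at_withinI[OF g]] by auto
  have D2: "((\<lambda>t. f' (x + s *\<^sub>R u + t *\<^sub>R v) u) has_derivative
      (\<lambda>d. d * f'' (x + s *\<^sub>R u + t *\<^sub>R v) v)) (at t)" if "0 \<le> t" "t \<le> h" for t
  proof -
    have D: "((\<lambda>y. f' y u) has_derivative f'' (x + s *\<^sub>R u + t *\<^sub>R v)) (at (x + s *\<^sub>R u + t *\<^sub>R v))"
      using s that by (intro f') auto
    show ?thesis
      using has_derivative_compose[OF line(2) D] linear_cmul[OF has_derivative_linear[OF D]] by simp
  qed
  obtain t where t: "t \<in> {0<..<h}"
    and ft: "f' (x + s *\<^sub>R u + h *\<^sub>R v) u - f' (x + s *\<^sub>R u + 0 *\<^sub>R v) u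
       = (h - 0) * f'' (x + s *\<^sub>R u + t *\<^sub>R v) v"
    using mvt_simple[OF \<open>0 < h\<close>, of "\<lambda>t. f' (x + s *\<^sub>R u + t *\<^sub>R v) u", OF has_derivative_at_withinI[OF D2]]
    by auto
  have "g h - g 0 = h * (h * f'' (x + s *\<^sub>R u + t *\<^sub>R v) v)"
    using gs ft by simp
  then show ?thesis using s t by (intro exI[of _ s] exI[of _ t]) (auto simp: g_def)
qed

text \<open>Both mixed derivatives are continuous, and on arbitrarily small parallelograms they take, each at some
  point, the same value.\<close>

lemma second_derivative_symmetric_real:
  fixes f :: "'a::euclidean_space \<Rightarrow> real"
  assumes S: "open S" "x \<in> S" and f: "smooth_on S f"
  shows "frechet_derivative (\<lambda>y. frechet_derivative f (at y) u) (at x) v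
       = frechet_derivative (\<lambda>y. frechet_derivative f (at y) v) (at x) u"
    (is "?D u v x = ?D v u x")
proof (rule ccontr)
  assume neq: "?D u v x \<noteq> ?D v u x"
  define e where "e = \<bar>?D u v x - ?D v u x\<bar> / 2"
  have e: "e > 0" using neq by (simp add: e_def)
  have cont: "isCont (?D u' v') x" for u' v'
    using smooth_on_imp_continuous_on[OF smooth_on_derivative_const[OF smooth_on_derivative_const[OF f]]] S
    by (auto simp: continuous_on_eq_continuous_at)
  obtain d1 where d1: "d1 > 0" "\<And>y. dist y x < d1 \<Longrightarrow> \<bar>?D u v y - ?D u v x\<bar> < e"
    using cont[of u v] e unfolding continuous_at_eps_delta by (auto simp: dist_real_def)
  obtain d2 where d2: "d2 > 0" "\<And>y. dist y x < d2 \<Longrightarrow> \<bar>?D v u y - ?D v u x\<bar> < e"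
    using cont[of v u] e unfolding continuous_at_eps_delta by (auto simp: dist_real_def)
  obtain d3 where d3: "d3 > 0" "\<And>y. dist y x < d3 \<Longrightarrow> y \<in> S"
    using S by (metis dist_commute mem_ball openE subset_eq)
  define d where "d = min d1 (min d2 d3)"
  have d: "d > 0" using d1 d2 d3 by (simp add: d_def)
  (* the factor 2 makes all points of the parallelogram with sides h u and h v lie strictly inside the ball of radius d *)
  define N where "N = norm u + norm v + 1"
  have nn: "N > 0" by (simp add: N_def add_nonneg_pos)
  define h where "h = d / (2 * N)"
  have h: "h > 0" using d nn by (simp add: h_def)
  have near: "dist (x + s *\<^sub>R u + t *\<^sub>R v) x < d" if "0 \<le> s" "s \<le> h" "0 \<le> t" "t \<le> h" for s t
  proof -
    have "dist (x + s *\<^sub>R u + t *\<^sub>R v) x = norm (s *\<^sub>R u + t *\<^sub>R v)"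
      by (simp add: dist_norm algebra_simps)
    also have "\<dots> \<le> s * norm u + t * norm v"
      using norm_triangle_ineq[of "s *\<^sub>R u" "t *\<^sub>R v"] that by simp
    also have "\<dots> \<le> h * norm u + h * norm v"
      using that by (intro add_mono mult_right_mono) auto
    also have "\<dots> \<le> h * N"
      using h by (simp add: algebra_simps N_def)
    also have "\<dots> = d / 2" using nn by (simp add: h_def)
    also have "\<dots> < d" using d by simp
    finally show ?thesis .
  qed
  have D: "(f has_derivative frechet_derivative f (at y)) (at y)" if "dist y x < d" for y
    using that d3 by (intro smooth_on_has_derivative[OF f]) (auto simp: d_def)
  have D': "((\<lambda>y. frechet_derivative f (at y) u') has_derivative frechet_derivative (\<lambda>y. frechet_derivative f (at y) u') (at y)) (at y)"
    if "dist y x < d" for y u'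
    using that d3 by (intro smooth_on_has_derivative[OF smooth_on_derivative_const[OF f]]) (auto simp: d_def)
  define F where "F = f (x + h *\<^sub>R u + h *\<^sub>R v) - f (x + h *\<^sub>R u) - f (x + h *\<^sub>R v) + f x"
  obtain y where y: "dist y x < d" "F = h * (h * ?D u v y)"
    using second_difference_mvt[OF h, of f "\<lambda>y. frechet_derivative f (at y)" x u v
        "\<lambda>y. frechet_derivative (\<lambda>y. frechet_derivative f (at y) u) (at y)"] near D D'
    unfolding F_def by blast
  obtain z where z: "dist z x < d" "F = h * (h * ?D v u z)"
  proof -
    have near': "dist (x + s *\<^sub>R v + t *\<^sub>R u) x < d" if "0 \<le> s" "s \<le> h" "0 \<le> t" "t \<le> h" for s t
      using near[OF that(3,4,1,2)] by (simp add: add.assoc add.commute[of "s *\<^sub>R v"])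
    obtain s t where st: "0 \<le> s" "s \<le> h" "0 \<le> t" "t \<le> h"
      and eq: "f (x + h *\<^sub>R v + h *\<^sub>R u) - f (x + h *\<^sub>R v) - f (x + h *\<^sub>R u) + f x
        = h * (h * ?D v u (x + s *\<^sub>R v + t *\<^sub>R u))"
      using second_difference_mvt[OF h D[OF near'] D'[OF near']] by blast
    have "f (x + h *\<^sub>R v + h *\<^sub>R u) - f (x + h *\<^sub>R v) - f (x + h *\<^sub>R u) + f x = F"
      by (simp add: F_def add.assoc add.commute[of "h *\<^sub>R v"])
    then show ?thesis using that[OF near'[OF st]] eq by simp
  qed
  have "?D u v y = ?D v u z" using y z h by simp
  moreover have "\<bar>?D u v y - ?D u v x\<bar> < e" "\<bar>?D v u z - ?D v u x\<bar> < e"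
    using y z d1 d2 by (auto simp: d_def)
  ultimately show False by (simp add: e_def abs_if split: if_splits)
qed

lemma second_derivative_symmetric:
  fixes f :: "'a::euclidean_space \<Rightarrow> 'b::euclidean_space"
  assumes S: "open S" "x \<in> S" and f: "smooth_on S f"
  shows "frechet_derivative (\<lambda>y. frechet_derivative f (at y) u) (at x) v
       = frechet_derivative (\<lambda>y. frechet_derivative f (at y) v) (at x) u"
proof (rule euclidean_eqI)
  fix b :: 'b
  have 1: "frechet_derivative (\<lambda>y. f y \<bullet> b) (at y) w = frechet_derivative f (at y) w \<bullet> b"
    if "y \<in> S" for y w
    by (subst frechet_derivativeI[OF bounded_linear.has_derivative[OF bounded_linear_inner_left
          smooth_on_has_derivative[OF f that]]]) simp
  have 2: "frechet_derivative (\<lambda>y. frechet_derivative (\<lambda>y. f y \<bullet> b) (at y) w) (at x) w'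
      = frechet_derivative (\<lambda>y. frechet_derivative f (at y) w) (at x) w' \<bullet> b" for w w'
    by (subst frechet_derivative_cong_open[OF S 1], assumption,
        subst frechet_derivativeI[OF bounded_linear.has_derivative[OF bounded_linear_inner_left
          smooth_on_has_derivative[OF smooth_on_derivative_const[OF f] S(2)]]]) simp
  have "smooth_on S (\<lambda>y. f y \<bullet> b)"
    by (rule smooth_on_bounded_linear[OF S(1) bounded_linear_inner_left f])
  from second_derivative_symmetric_real[OF S this, of u v]
  show "frechet_derivative (\<lambda>y. frechet_derivative f (at y) u) (at x) v \<bullet> b
       = frechet_derivative (\<lambda>y. frechet_derivative f (at y) v) (at x) u \<bullet> b"
    by (simp add: 2)
qed

section \<open>Calculus in the charts of a smooth atlas\<close>

text \<open>If \<open>\<psi>\<close> is a coordinate change and \<open>w\<close> a vector field, the function differentiated here is the transformed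
  field. The order of the two directions in the second derivative has been exchanged, as is needed below
  to compare the two terms of a Lie bracket.\<close>

lemma frechet_derivative_along_field:
  fixes \<psi> :: "'a::euclidean_space \<Rightarrow> 'b::euclidean_space"
  assumes S: "open S" "x \<in> S" and \<psi>: "smooth_on S \<psi>" and w: "smooth_on S w"
  shows "frechet_derivative (\<lambda>y. frechet_derivative \<psi> (at y) (w y)) (at x) h
    = frechet_derivative (\<lambda>y. frechet_derivative \<psi> (at y) h) (at x) (w x)
      + frechet_derivative \<psi> (at x) (frechet_derivative w (at x) h)"
proof -
  let ?D = "\<lambda>y. frechet_derivative \<psi> (at y)"
  have lin: "linear (?D y)" if "y \<in> S" for y
    using that by (intro linear_frechet_derivative smooth_on_differentiable[OF \<psi>])
  have lin2: "linear (frechet_derivative (\<lambda>y. ?D y h) (at x))"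
    by (intro linear_frechet_derivative smooth_on_differentiable[OF smooth_on_derivative_const[OF \<psi>] S(2)])
  have "frechet_derivative (\<lambda>y. ?D y (w y)) (at x)
      = frechet_derivative (\<lambda>y. \<Sum>b\<in>Basis. (w y \<bullet> b) *\<^sub>R ?D y b) (at x)"
    by (rule frechet_derivative_cong_open[OF S]) (rule linear_sum_Basis[OF lin])
  also have "\<dots> = (\<lambda>h. \<Sum>b\<in>Basis. (w x \<bullet> b) *\<^sub>R frechet_derivative (\<lambda>y. ?D y b) (at x) h
        + (frechet_derivative w (at x) h \<bullet> b) *\<^sub>R ?D x b)"
    by (intro frechet_derivativeI has_derivative_sum bounded_bilinear.FDERIV[OF bounded_bilinear_scaleR]
        bounded_linear.has_derivative[OF bounded_linear_inner_left]
        smooth_on_has_derivative[OF w S(2)]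
        smooth_on_has_derivative[OF smooth_on_derivative_const[OF \<psi>] S(2)])
  finally have "frechet_derivative (\<lambda>y. ?D y (w y)) (at x) h
    = (\<Sum>b\<in>Basis. (w x \<bullet> b) *\<^sub>R frechet_derivative (\<lambda>y. ?D y b) (at x) h)
      + (\<Sum>b\<in>Basis. (frechet_derivative w (at x) h \<bullet> b) *\<^sub>R ?D x b)"
    by (simp add: sum.distrib)
  also have "(\<Sum>b\<in>Basis. (w x \<bullet> b) *\<^sub>R frechet_derivative (\<lambda>y. ?D y b) (at x) h)
      = (\<Sum>b\<in>Basis. (w x \<bullet> b) *\<^sub>R frechet_derivative (\<lambda>y. ?D y h) (at x) b)"
    by (intro sum.cong refl) (simp add: second_derivative_symmetric[OF S \<psi>, of _ h])
  finally show ?thesis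
    by (simp add: linear_sum_Basis[OF lin[OF S(2)], symmetric] linear_sum_Basis[OF lin2, symmetric])
qed

lemma openin_atlas_topology: "smooth_atlas A \<Longrightarrow> openin (atlas_topology A) = atlas_open A"
  unfolding atlas_topology_def by (rule topology_inverse'[OF istopology_atlas_open])

locale smooth_charts =
  fixes A :: "('p, 'e::euclidean_space) chart set"
  assumes A: "smooth_atlas A"
begin

lemma chart_inv_apply: "c \<in> A \<Longrightarrow> q \<in> fst c \<Longrightarrow> chart_inv c (snd c q) = q"
  using A by (simp add: smooth_atlas_def)

lemma open_overlap: "c \<in> A \<Longrightarrow> d \<in> A \<Longrightarrow> open (snd c ` (fst c \<inter> fst d))"
  using A by (simp add: smooth_atlas_def)

lemma open_chart_image: "c \<in> A \<Longrightarrow> open (snd c ` fst c)"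
  using open_overlap[of c c] by simp

lemma smooth_transition: "c \<in> A \<Longrightarrow> d \<in> A \<Longrightarrow> smooth_on (snd c ` (fst c \<inter> fst d)) (snd d \<circ> chart_inv c)"
  using A by (simp add: smooth_atlas_def)

lemma atlas_open_Int: "atlas_open A S \<Longrightarrow> atlas_open A T \<Longrightarrow> atlas_open A (S \<inter> T)"
  using openin_Int[of "atlas_topology A" S T] openin_atlas_topology[OF A] by simp

lemma atlas_open_chart: "c \<in> A \<Longrightarrow> atlas_open A (fst c)"
  using open_overlap by (auto simp: atlas_open_def atlas_points_def)

lemma atlas_openD: "atlas_open A Q \<Longrightarrow> c \<in> A \<Longrightarrow> open (snd c ` (fst c \<inter> Q))"
  by (simp add: atlas_open_def)

lemma atlas_open_preimage:
  assumes "c \<in> A" "open B"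
  shows "atlas_open A {q \<in> fst c. snd c q \<in> B}"
proof -
  have "open (snd d ` (fst d \<inter> {q \<in> fst c. snd c q \<in> B}))" if "d \<in> A" for d
  proof -
    have "snd d ` (fst d \<inter> {q \<in> fst c. snd c q \<in> B})
        = (snd c \<circ> chart_inv d) -` B \<inter> snd d ` (fst d \<inter> fst c)"
      using chart_inv_apply[OF that] by (auto simp: image_iff)
    moreover have "open ((snd c \<circ> chart_inv d) -` B \<inter> snd d ` (fst d \<inter> fst c))"
      using continuous_open_preimage[OF smooth_on_imp_continuous_on[OF smooth_transition[OF that assms(1)]]
        open_overlap[OF that assms(1)] assms(2)] by (simp add: Int_commute)
    ultimately show ?thesis by simp
  qed
  then show ?thesis using assms(1) by (auto simp: atlas_open_def atlas_points_def)
qed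

lemma topspace_atlas_topology: "topspace (atlas_topology A) = atlas_points A"
proof -
  have "atlas_open A (atlas_points A)"
    unfolding atlas_open_def
  proof (intro conjI ballI order_refl)
    fix c assume "c \<in> A"
    then have "fst c \<inter> atlas_points A = fst c" by (auto simp: atlas_points_def)
    then show "open (snd c ` (fst c \<inter> atlas_points A))" using open_chart_image[OF \<open>c \<in> A\<close>] by simp
  qed
  moreover have "Q \<subseteq> atlas_points A" if "atlas_open A Q" for Q
    using that by (simp add: atlas_open_def)
  ultimately show ?thesis
    unfolding topspace_def openin_atlas_topology[OF A] by blast
qed

lemma chart_deriv_cong:
  assumes "c \<in> A" "atlas_open A Q" "p \<in> fst c" "p \<in> Q" "\<And>q. q \<in> fst c \<Longrightarrow> q \<in> Q \<Longrightarrow> f q = g q"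
  shows "chart_deriv c f p = chart_deriv c g p"
proof
  have "frechet_derivative (f \<circ> chart_inv c) (at (snd c p)) = frechet_derivative (g \<circ> chart_inv c) (at (snd c p))"
    by (rule frechet_derivative_cong_open[OF atlas_openD[OF assms(2,1)]])
      (use assms chart_inv_apply in auto)
  then show "chart_deriv c f p v = chart_deriv c g p v" for v by (simp add: chart_deriv_def)
qed

lemma smooth_in_chart_has_derivative:
  assumes "smooth_in_chart c f" "p \<in> fst c"
  shows "((f \<circ> chart_inv c) has_derivative chart_deriv c f p) (at (snd c p))"
  using smooth_on_has_derivative[of "snd c ` fst c" "f \<circ> chart_inv c" "snd c p"] assms
  by (simp add: smooth_in_chart_def chart_deriv_def[abs_def])

lemma transition_has_derivative:
  assumes "c \<in> A" "d \<in> A" "p \<in> fst c" "p \<in> fst d"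
  shows "((snd d \<circ> chart_inv c) has_derivative chart_deriv c (snd d) p) (at (snd c p))"
  using smooth_on_has_derivative[OF smooth_transition[OF assms(1,2)], of "snd c p"] assms(3,4)
  by (simp add: chart_deriv_def[abs_def])

lemma linear_transition:
  assumes "c \<in> A" "d \<in> A" "p \<in> fst c" "p \<in> fst d"
  shows "linear (chart_deriv c (snd d) p)"
  using transition_has_derivative[OF assms] by (rule has_derivative_linear)

text \<open>The chain rule: the derivative of a function along a vector does not depend on the chart, the
  components of the vector being transformed by the Jacobian.\<close>

lemma chart_deriv_change:
  assumes c: "c \<in> A" "p \<in> fst c" and d: "d \<in> A" "p \<in> fst d"
    and f: "((f \<circ> chart_inv d) has_derivative f') (at (snd d p))"
  shows "chart_deriv c f p v = f' (chart_deriv c (snd d) p v)"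
proof -
  have "((f \<circ> chart_inv d) has_derivative f') (at ((snd d \<circ> chart_inv c) (snd c p)))"
    using f c chart_inv_apply by simp
  from diff_chain_at[OF transition_has_derivative[OF c(1) d(1) c(2) d(2)] this]
  have "((f \<circ> chart_inv d) \<circ> (snd d \<circ> chart_inv c) has_derivative f' \<circ> chart_deriv c (snd d) p) (at (snd c p))" .
  then have "(f \<circ> chart_inv c has_derivative f' \<circ> chart_deriv c (snd d) p) (at (snd c p))"
    by (rule has_derivative_transform_within_open[OF _ open_overlap[OF c(1) d(1)]])
      (use c d chart_inv_apply in auto)
  then show ?thesis by (simp add: chart_deriv_def frechet_derivativeI)
qed

lemma chart_deriv_self:
  assumes "c \<in> A" "p \<in> fst c"
  shows "chart_deriv c (snd c) p v = v"
proof -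
  have "((snd c \<circ> chart_inv c) has_derivative (\<lambda>v. v)) (at (snd c p))"
    by (rule has_derivative_transform_within_open[OF has_derivative_ident open_chart_image[OF assms(1)]])
      (use assms chart_inv_apply in auto)
  then show ?thesis by (simp add: chart_deriv_def frechet_derivativeI)
qed

lemma transition_cocycle:
  assumes "c \<in> A" "d \<in> A" "e \<in> A" "p \<in> fst c" "p \<in> fst d" "p \<in> fst e"
  shows "chart_deriv d (snd e) p (chart_deriv c (snd d) p v) = chart_deriv c (snd e) p v"
  by (rule chart_deriv_change[symmetric]) (use assms transition_has_derivative in auto)

lemma smooth_change_chart:
  assumes "c \<in> A" "d \<in> A" "atlas_open A Q" "Q \<subseteq> fst c"
    and "smooth_on (snd c ` Q) (f \<circ> chart_inv c)"
  shows "smooth_on (snd d ` (fst d \<inter> Q)) (f \<circ> chart_inv d)"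
proof -
  have o: "open (snd d ` (fst d \<inter> Q))" "open (snd c ` Q)"
    using atlas_openD[OF assms(3,2)] atlas_openD[OF assms(3,1)] assms(4) by (simp_all add: Int_absorb1)
  have t: "smooth_on (snd d ` (fst d \<inter> Q)) (snd c \<circ> chart_inv d)"
    by (rule smooth_on_subset[OF smooth_transition[OF assms(2,1)]]) (use assms(4) in auto)
  have "smooth_on (snd d ` (fst d \<inter> Q)) (\<lambda>x. (f \<circ> chart_inv c) ((snd c \<circ> chart_inv d) x))"
    by (rule smooth_on_compose[OF o _ t assms(5)]) (use assms chart_inv_apply in auto)
  then show ?thesis
    by (subst smooth_on_cong[OF o(1)]) (use assms chart_inv_apply in auto)
qed

lemma smooth_in_chart_local:
  assumes "d \<in> A"
    and "\<And>q. q \<in> fst d \<Longrightarrow> \<exists>Q. atlas_open A Q \<and> q \<in> Q \<and> smooth_on (snd d ` (fst d \<inter> Q)) (f \<circ> chart_inv d)"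
  shows "smooth_in_chart d f"
  unfolding smooth_in_chart_def
proof (rule smooth_on_local)
  fix x assume "x \<in> snd d ` fst d"
  then obtain q where q: "q \<in> fst d" "x = snd d q" by auto
  obtain Q where "atlas_open A Q" "q \<in> Q" "smooth_on (snd d ` (fst d \<inter> Q)) (f \<circ> chart_inv d)"
    using assms(2)[OF q(1)] by auto
  then show "\<exists>T. open T \<and> x \<in> T \<and> smooth_on T (f \<circ> chart_inv d)"
    using atlas_openD[OF _ assms(1)] q by (intro exI[of _ "snd d ` (fst d \<inter> Q)"]) auto
qed

lemma smooth_in_chart_cong:
  assumes "c \<in> A" "\<And>q. q \<in> fst c \<Longrightarrow> f q = g q"
  shows "smooth_in_chart c f \<longleftrightarrow> smooth_in_chart c g"
  unfolding smooth_in_chart_def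
  by (rule smooth_on_cong[OF open_chart_image[OF assms(1)]]) (use assms chart_inv_apply in auto)

lemma smooth_in_chart_const: "smooth_in_chart c (\<lambda>q. a)"
  by (simp add: smooth_in_chart_def o_def smooth_on_const)

lemma smooth_in_chart_add:
  "c \<in> A \<Longrightarrow> smooth_in_chart c f \<Longrightarrow> smooth_in_chart c g \<Longrightarrow> smooth_in_chart c (\<lambda>q. f q + g q)"
  by (simp add: smooth_in_chart_def o_def smooth_on_add open_chart_image)

lemma smooth_in_chart_diff:
  "c \<in> A \<Longrightarrow> smooth_in_chart c f \<Longrightarrow> smooth_in_chart c g \<Longrightarrow> smooth_in_chart c (\<lambda>q. f q - g q)"
  by (simp add: smooth_in_chart_def o_def smooth_on_diff open_chart_image)

lemma smooth_in_chart_sum: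
  "c \<in> A \<Longrightarrow> (\<And>i. i \<in> I \<Longrightarrow> smooth_in_chart c (f i)) \<Longrightarrow> smooth_in_chart c (\<lambda>q. \<Sum>i\<in>I. f i q)"
  by (simp add: smooth_in_chart_def o_def smooth_on_sum open_chart_image)

lemma smooth_in_chart_scaleR:
  "c \<in> A \<Longrightarrow> smooth_in_chart c f \<Longrightarrow> smooth_in_chart c g \<Longrightarrow> smooth_in_chart c (\<lambda>q. f q *\<^sub>R g q)"
  by (simp add: smooth_in_chart_def o_def smooth_on_scaleR open_chart_image)

lemma smooth_in_chart_mult:
  fixes f :: "'p \<Rightarrow> real"
  shows "c \<in> A \<Longrightarrow> smooth_in_chart c f \<Longrightarrow> smooth_in_chart c g \<Longrightarrow> smooth_in_chart c (\<lambda>q. f q * g q)"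
  by (simp add: smooth_in_chart_def o_def smooth_on_mult open_chart_image)

lemma smooth_in_chart_bounded_linear:
  "c \<in> A \<Longrightarrow> bounded_linear h \<Longrightarrow> smooth_in_chart c f \<Longrightarrow> smooth_in_chart c (\<lambda>q. h (f q))"
  using smooth_on_bounded_linear[OF open_chart_image]
  by (simp add: smooth_in_chart_def o_def)

lemma smooth_in_chart_deriv:
  assumes c: "c \<in> A" and f: "smooth_in_chart c f" and v: "smooth_in_chart c v"
  shows "smooth_in_chart c (\<lambda>q. chart_deriv c f q (v q))"
proof -
  have "smooth_on (snd c ` fst c) (\<lambda>x. frechet_derivative (f \<circ> chart_inv c) (at x) ((v \<circ> chart_inv c) x))"
    by (rule smooth_on_derivative[OF open_chart_image[OF c] open_chart_image[OF c] _
          f[unfolded smooth_in_chart_def] smooth_on_ident[OF open_chart_image[OF c]]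
          v[unfolded smooth_in_chart_def]]) simp
  then show ?thesis
    unfolding smooth_in_chart_def
    by (subst smooth_on_cong[OF open_chart_image[OF c]])
      (use c chart_inv_apply in \<open>auto simp: chart_deriv_def\<close>)
qed

lemma chart_deriv_const: "chart_deriv c (\<lambda>q. a) p v = 0"
  by (simp add: chart_deriv_def o_def)

section \<open>Local vector fields and cutoff functions\<close>

lemma chart_field_cong: "(\<And>q. q \<in> fst c \<Longrightarrow> u q = v q) \<Longrightarrow> chart_field A c u = chart_field A c v"
  unfolding chart_field_def by (intro ext) auto

lemma chart_field_self: "c \<in> A \<Longrightarrow> p \<in> fst c \<Longrightarrow> chart_field A c v c p = v p"
  by (simp add: chart_field_def chart_deriv_self)

lemma chart_field_add:
  assumes "c \<in> A"
  shows "chart_field A c (\<lambda>q. u q + v q) = (\<lambda>d p. chart_field A c u d p + chart_field A c v d p)"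
  using linear_transition[OF assms] by (intro ext) (simp add: chart_field_def linear_add)

lemma chart_field_scaleR:
  assumes "c \<in> A"
  shows "chart_field A c (\<lambda>q. g q *\<^sub>R v q) = (\<lambda>d p. g p *\<^sub>R chart_field A c v d p)"
  using linear_transition[OF assms] by (intro ext) (simp add: chart_field_def linear_cmul)

text \<open>It is not sufficient that \<open>f\<close> is zero outside \<open>Q\<close>: a product with \<open>f\<close> can be continued by zero to a
  smooth function because \<open>f\<close> vanishes on a neighbourhood of every point outside \<open>Q\<close>.\<close>
definition supported_in :: "'p set \<Rightarrow> ('p \<Rightarrow> real) \<Rightarrow> bool" where
  "supported_in Q f \<longleftrightarrow> (\<forall>q. q \<notin> Q \<longrightarrow> f q = 0) \<and>
     (\<exists>U. atlas_open A U \<and> atlas_points A \<subseteq> Q \<union> U \<and> (\<forall>q\<in>U. f q = 0))"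

lemma supported_in_mono: "supported_in Q f \<Longrightarrow> Q \<subseteq> R \<Longrightarrow> supported_in R f"
  unfolding supported_in_def by blast

lemma smooth_in_chart_supported:
  assumes d: "d \<in> A" and Q: "atlas_open A Q" and f: "supported_in Q f"
    and F: "smooth_on (snd d ` (fst d \<inter> Q)) (F \<circ> chart_inv d)" "\<And>q. f q = 0 \<Longrightarrow> F q = 0"
  shows "smooth_in_chart d F"
proof (rule smooth_in_chart_local[OF d])
  fix q assume q: "q \<in> fst d"
  obtain U where U: "atlas_open A U" "atlas_points A \<subseteq> Q \<union> U" "\<forall>q\<in>U. f q = 0"
    using f unfolding supported_in_def by auto
  have "smooth_on (snd d ` (fst d \<inter> U)) (F \<circ> chart_inv d)"
    by (subst smooth_on_cong[OF atlas_openD[OF U(1) d], of _ "\<lambda>_. 0"])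
      (use U F(2) chart_inv_apply[OF d] in \<open>auto intro: smooth_on_const\<close>)
  moreover have "q \<in> Q \<or> q \<in> U" using U(2) q d by (auto simp: atlas_points_def)
  ultimately show "\<exists>Q. atlas_open A Q \<and> q \<in> Q \<and> smooth_on (snd d ` (fst d \<inter> Q)) (F \<circ> chart_inv d)"
    using Q F(1) U(1) by blast
qed

lemma smooth_fun_supported:
  assumes c: "c \<in> A" and f: "smooth_fun A f" "supported_in (fst c) f" and g: "smooth_in_chart c g"
  shows "smooth_fun A (\<lambda>q. f q * g q)"
  unfolding smooth_fun_def
proof
  fix d assume d: "d \<in> A"
  have "smooth_on (snd d ` (fst d \<inter> fst c)) (\<lambda>x. (f \<circ> chart_inv d) x * (g \<circ> chart_inv d) x)"
  proof (rule smooth_on_mult[OF open_overlap[OF d c]])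
    show "smooth_on (snd d ` (fst d \<inter> fst c)) (f \<circ> chart_inv d)"
      using f(1) d by (auto simp: smooth_fun_def smooth_in_chart_def intro: smooth_on_subset)
    show "smooth_on (snd d ` (fst d \<inter> fst c)) (g \<circ> chart_inv d)"
      using g by (intro smooth_change_chart[OF c d atlas_open_chart[OF c]]) (auto simp: smooth_in_chart_def)
  qed
  then show "smooth_in_chart d (\<lambda>q. f q * g q)"
    by (intro smooth_in_chart_supported[OF d atlas_open_chart[OF c] f(2)]) (auto simp: o_def)
qed

lemma smooth_chart_field:
  assumes c: "c \<in> A" and d: "d \<in> A" and v: "smooth_in_chart c v"
  shows "smooth_on (snd d ` (fst d \<inter> fst c)) (chart_field A c v d \<circ> chart_inv d)"
proof -
  note o = open_overlap[OF c d] open_overlap[OF d c]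
  have "smooth_on (snd d ` (fst d \<inter> fst c))
     (\<lambda>x. frechet_derivative (snd d \<circ> chart_inv c) (at ((snd c \<circ> chart_inv d) x)) ((v \<circ> chart_inv d) x))"
  proof (rule smooth_on_derivative[OF o(2) o(1) _ smooth_transition[OF c d] smooth_transition[OF d c]])
    show "(snd c \<circ> chart_inv d) ` snd d ` (fst d \<inter> fst c) \<subseteq> snd c ` (fst c \<inter> fst d)"
      using chart_inv_apply[OF d] by auto
    show "smooth_on (snd d ` (fst d \<inter> fst c)) (v \<circ> chart_inv d)"
      using v by (intro smooth_change_chart[OF c d atlas_open_chart[OF c]]) (auto simp: smooth_in_chart_def)
  qed
  then show ?thesis
    by (subst smooth_on_cong[OF o(2)])
      (use d chart_inv_apply[OF d] in \<open>auto simp: chart_field_def chart_deriv_def\<close>)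
qed

lemma chart_field_transform:
  assumes "c \<in> A" "d \<in> A" "e \<in> A" "q \<in> fst d" "q \<in> fst e"
  shows "chart_field A c v e q = chart_deriv d (snd e) q (chart_field A c v d q)"
  using transition_cocycle[of c d e q "v q"] linear_0[OF linear_transition[of d e q]] assms
  by (auto simp: chart_field_def)

text \<open>A cutoff function turns a local field into a global one. Linear connections act on global fields only, so
  this is the way in which they are applied to the fields of a local frame.\<close>

lemma vector_field_supported:
  assumes c: "c \<in> A" and f: "smooth_fun A f" "supported_in (fst c) f" and v: "smooth_in_chart c v"
  shows "vector_field A (chart_field A c (\<lambda>q. f q *\<^sub>R v q))"
proof -
  have fv: "smooth_in_chart c (\<lambda>q. f q *\<^sub>R v q)"
    using f(1) c v by (auto simp: smooth_fun_def intro: smooth_in_chart_scaleR)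
  have "smooth_in_chart d (chart_field A c (\<lambda>q. f q *\<^sub>R v q) d)" if "d \<in> A" for d
    by (rule smooth_in_chart_supported[OF that atlas_open_chart[OF c] f(2) smooth_chart_field[OF c that fv]])
      (simp add: chart_field_scaleR[OF c])
  moreover have "chart_field A c v d p = 0" if "d \<notin> A \<or> p \<notin> fst d" for v d p
    using that by (auto simp: chart_field_def)
  ultimately show ?thesis
    unfolding vector_field_def using chart_field_transform[OF c] by blast
qed

lemma vector_field_eq_chart_field:
  assumes "vector_field A X" "c \<in> A" "q \<in> fst c"
  shows "X d q = chart_field A c (X c) d q"
proof (cases "d \<in> A \<and> q \<in> fst d")
  case True
  then have "X d q = chart_deriv c (snd d) q (X c q)"
    using assms unfolding vector_field_def by blast
  then show ?thesis using True assms(3) by (simp only: chart_field_def) simp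
next
  case False
  then have "X d q = 0"
    using assms(1) unfolding vector_field_def by blast
  then show ?thesis using False by (auto simp: chart_field_def)
qed

text \<open>The Hausdorff property enters here. The bump function lives on a compact coordinate ball, and this ball
  is closed in the manifold; thus its complement is open, and the continuation by zero is smooth in every
  chart. On the line with two origins the conclusion fails for a chart around one of the origins and for this
  origin as \<open>p\<close>.\<close>

lemma cutoff_function:
  assumes H: "Hausdorff_space (atlas_topology A)"
    and c: "c \<in> A" "p \<in> fst c" and V: "atlas_open A V" "p \<in> V"
  obtains f W where "smooth_fun A f" "supported_in (fst c \<inter> V) f"
    "atlas_open A W" "p \<in> W" "W \<subseteq> fst c \<inter> V" "\<And>q. q \<in> W \<Longrightarrow> f q = 1"
proof -
  obtain e where e: "e > 0" "cball (snd c p) e \<subseteq> snd c ` (fst c \<inter> V)"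
    using open_contains_cball atlas_openD[OF V(1) c(1)] c V by blast
  define r where "r = e / 2"
  have r: "r > 0" "cball (snd c p) (2 * r) \<subseteq> snd c ` (fst c \<inter> V)" using e by (auto simp: r_def)
  obtain \<phi> :: "'e \<Rightarrow> real" where \<phi>: "smooth_on UNIV \<phi>"
    "\<And>x. x \<in> ball (snd c p) r \<Longrightarrow> \<phi> x = 1" "\<And>x. x \<notin> cball (snd c p) (2 * r) \<Longrightarrow> \<phi> x = 0"
    using bump_function[OF r(1)] by blast
  define K where "K = chart_inv c ` cball (snd c p) (2 * r)"
  have KV: "K \<subseteq> fst c \<inter> V"
    using r(2) chart_inv_apply[OF c(1)] by (auto simp: K_def)
  have K_iff: "q \<in> K \<longleftrightarrow> q \<in> fst c \<and> snd c q \<in> cball (snd c p) (2 * r)" for q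
  proof
    assume "q \<in> K"
    then obtain x where x: "x \<in> cball (snd c p) (2 * r)" "q = chart_inv c x" by (auto simp: K_def)
    then obtain q' where "q' \<in> fst c" "x = snd c q'" using r(2) by blast
    then show "q \<in> fst c \<and> snd c q \<in> cball (snd c p) (2 * r)" using x chart_inv_apply[OF c(1)] by simp
  next
    assume "q \<in> fst c \<and> snd c q \<in> cball (snd c p) (2 * r)"
    then show "q \<in> K" unfolding K_def using chart_inv_apply[OF c(1)] by (metis image_eqI)
  qed
  have "continuous_map (top_of_set (snd c ` fst c)) (atlas_topology A) (chart_inv c)"
    unfolding continuous_map_def
  proof (intro conjI allI impI funcsetI)
    show "chart_inv c x \<in> topspace (atlas_topology A)" if "x \<in> topspace (top_of_set (snd c ` fst c))" for x
      using that c(1) chart_inv_apply[OF c(1)] by (auto simp: topspace_atlas_topology atlas_points_def)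
    fix O' assume "openin (atlas_topology A) O'"
    then have "open (snd c ` (fst c \<inter> O'))"
      using atlas_openD[OF _ c(1)] by (simp add: openin_atlas_topology[OF A])
    moreover have "{x \<in> topspace (top_of_set (snd c ` fst c)). chart_inv c x \<in> O'} = snd c ` (fst c \<inter> O')"
      using chart_inv_apply[OF c(1)] by auto
    ultimately show "openin (top_of_set (snd c ` fst c))
        {x \<in> topspace (top_of_set (snd c ` fst c)). chart_inv c x \<in> O'}"
      by (simp add: openin_open_eq[OF open_chart_image[OF c(1)]] image_mono)
  qed
  then have "compactin (atlas_topology A) K"
    unfolding K_def
    by (rule image_compactin[rotated]) (use r(2) in \<open>auto simp: compactin_subtopology\<close>)
  then have "closedin (atlas_topology A) K"
    using compactin_imp_closedin[OF H] by blast
  then have U: "atlas_open A (atlas_points A - K)"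
    by (simp add: closedin_def topspace_atlas_topology openin_atlas_topology[OF A])
  define f where "f q = (if q \<in> fst c then \<phi> (snd c q) else 0)" for q
  have f0: "f q = 0" if "q \<notin> K" for q
    using that \<phi>(3) K_iff by (auto simp: f_def)
  have supp: "supported_in (fst c \<inter> V) f"
    unfolding supported_in_def using KV f0 U by (intro conjI exI[of _ "atlas_points A - K"]) auto
  have "smooth_fun A f"
    unfolding smooth_fun_def
  proof
    fix d assume d: "d \<in> A"
    have "smooth_on (snd d ` (fst d \<inter> fst c)) (\<lambda>x. \<phi> ((snd c \<circ> chart_inv d) x))"
      by (rule smooth_on_compose[OF open_overlap[OF d c(1)] open_UNIV subset_UNIV smooth_transition[OF d c(1)] \<phi>(1)])
    then have "smooth_on (snd d ` (fst d \<inter> fst c)) (f \<circ> chart_inv d)"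
      by (subst smooth_on_cong[OF open_overlap[OF d c(1)]])
        (use chart_inv_apply[OF d] in \<open>auto simp: f_def\<close>)
    then show "smooth_in_chart d f"
      by (intro smooth_in_chart_supported[OF d atlas_open_chart[OF c(1)] supported_in_mono[OF supp]]) auto
  qed
  moreover have "atlas_open A {q \<in> fst c. snd c q \<in> ball (snd c p) r}"
    by (rule atlas_open_preimage[OF c(1) open_ball])
  moreover have "{q \<in> fst c. snd c q \<in> ball (snd c p) r} \<subseteq> fst c \<inter> V"
    using KV K_iff r(1) by fastforce
  ultimately show ?thesis
    using that[OF _ supp, of "{q \<in> fst c. snd c q \<in> ball (snd c p) r}"] c(2) r(1) \<phi>(2)
    by (simp add: f_def)
qed

end

section \<open>The local form of a linear connection\<close>

locale affine_charts = smooth_charts A for A :: "('p, 'e::euclidean_space) chart set" +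
  fixes nab :: "('p, 'e) conn"
  assumes Hausdorff: "Hausdorff_space (atlas_topology A)"
    and linear_conn: "linear_connection A nab"
begin

lemma
  assumes "vector_field A X" "vector_field A Y"
  shows vector_field_nab: "vector_field A (nab X Y)"
    and nab_add_left: "vector_field A X' \<Longrightarrow>
      nab (\<lambda>c p. X c p + X' c p) Y = (\<lambda>c p. nab X Y c p + nab X' Y c p)"
    and nab_scale_left: "smooth_fun A f \<Longrightarrow> nab (\<lambda>c p. f p *\<^sub>R X c p) Y = (\<lambda>c p. f p *\<^sub>R nab X Y c p)"
    and nab_add_right: "vector_field A Y' \<Longrightarrow>
      nab X (\<lambda>c p. Y c p + Y' c p) = (\<lambda>c p. nab X Y c p + nab X Y' c p)"
    and nab_leibniz: "smooth_fun A f \<Longrightarrow> c \<in> A \<Longrightarrow> p \<in> fst c \<Longrightarrow>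
      nab X (\<lambda>c p. f p *\<^sub>R Y c p) c p = chart_deriv c f p (X c p) *\<^sub>R Y c p + f p *\<^sub>R nab X Y c p"
  using linear_conn assms unfolding linear_connection_def by blast+

text \<open>For a cutoff function \<open>f\<close> with $f(p) = 1$ the fields $f X$ and $f X'$ are equal, and so are $f Y$ and $f Y'$.
  The factor is removed again at $p$ by linearity in the first argument and by the Leibniz rule in the
  second one; the term with the derivative of \<open>f\<close> is the same for \<open>Y\<close> and \<open>Y'\<close>, which agree at $p$.\<close>

lemma nab_local:
  assumes X: "vector_field A X" "vector_field A X'" and Y: "vector_field A Y" "vector_field A Y'"
    and V: "atlas_open A V" "p \<in> V"
    and eq: "\<And>d q. q \<in> V \<Longrightarrow> X d q = X' d q" "\<And>d q. q \<in> V \<Longrightarrow> Y d q = Y' d q"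
  shows "nab X Y d p = nab X' Y' d p"
proof (cases "d \<in> A \<and> p \<in> fst d")
  case False
  then have "Z d p = 0" if "vector_field A Z" for Z
    using that unfolding vector_field_def by blast
  then show ?thesis using vector_field_nab X Y by metis
next
  case True
  then obtain f W where f: "smooth_fun A f" "supported_in (fst d \<inter> V) f" and W: "p \<in> W" "\<And>q. q \<in> W \<Longrightarrow> f q = 1"
    using cutoff_function[OF Hausdorff _ _ V] by metis
  have fp: "f p = 1" using W by simp
  have f0: "f q = 0" if "q \<notin> V" for q
    using f(2) that by (auto simp: supported_in_def)
  have fX: "(\<lambda>d q. f q *\<^sub>R X d q) = (\<lambda>d q. f q *\<^sub>R X' d q)"
    and fY: "(\<lambda>d q. f q *\<^sub>R Y d q) = (\<lambda>d q. f q *\<^sub>R Y' d q)"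
    using eq f0 by (metis scale_zero_left)+
  have "nab X Y d p = nab (\<lambda>d q. f q *\<^sub>R X d q) Y d p"
    using nab_scale_left[OF X(1) Y(1) f(1)] fp by simp
  also have "\<dots> = nab X' Y d p"
    unfolding fX using nab_scale_left[OF X(2) Y(1) f(1)] fp by simp
  also have "\<dots> = nab X' (\<lambda>d q. f q *\<^sub>R Y d q) d p - chart_deriv d f p (X' d p) *\<^sub>R Y d p"
    using nab_leibniz[OF X(2) Y(1) f(1)] True fp by simp
  also have "\<dots> = nab X' (\<lambda>d q. f q *\<^sub>R Y' d q) d p - chart_deriv d f p (X' d p) *\<^sub>R Y' d p"
    unfolding fY using eq(2)[OF V(2)] by simp
  also have "\<dots> = nab X' Y' d p"
    using nab_leibniz[OF X(2) Y(2) f(1)] True fp by simp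
  finally show ?thesis .
qed

text \<open>By locality, any pair of global fields with the right germs computes the induced connection.\<close>

lemma induced_conn_eq_nab:
  assumes "vector_field A X'" "vector_field A Y'" "atlas_open A V" "p \<in> V" "V \<subseteq> Q"
    and "\<And>d q. q \<in> V \<Longrightarrow> X' d q = X d q" "\<And>d q. q \<in> V \<Longrightarrow> Y' d q = Y d q"
  shows "induced_conn A nab Q X Y d p = nab X' Y' d p"
proof -
  let ?P = "\<lambda>w. \<exists>X' Y' V. vector_field A X' \<and> vector_field A Y' \<and>
                openin (atlas_topology A) V \<and> p \<in> V \<and> V \<subseteq> Q \<and>
                (\<forall>d. \<forall>q\<in>V. X' d q = X d q \<and> Y' d q = Y d q) \<and> w = nab X' Y' d p"
  have "(THE w. ?P w) = nab X' Y' d p"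
  proof (rule the_equality)
    show "?P (nab X' Y' d p)"
      using assms by (intro exI[of _ X'] exI[of _ Y'] exI[of _ V]) (simp add: openin_atlas_topology[OF A])
  next
    fix w assume "?P w"
    then obtain X2 Y2 V2 where 2: "vector_field A X2" "vector_field A Y2" "atlas_open A V2" "p \<in> V2"
      "\<And>d q. q \<in> V2 \<Longrightarrow> X2 d q = X d q" "\<And>d q. q \<in> V2 \<Longrightarrow> Y2 d q = Y d q" "w = nab X2 Y2 d p"
      unfolding openin_atlas_topology[OF A] by metis
    show "w = nab X' Y' d p"
      unfolding 2(7)
      by (rule nab_local[OF 2(1) assms(1) 2(2) assms(2) atlas_open_Int[OF 2(3) assms(3)]])
        (use 2(4-6) assms(4,6,7) in auto)
  qed
  then show ?thesis using assms(4,5) by (simp add: induced_conn_def subset_iff)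
qed

text \<open>The connection on component functions in the chart \<open>c\<close>. Computations with a frame take place in this
  one chart; the components in the other charts follow from \<open>induced_conn_chart_field\<close> below.\<close>
definition local_conn :: "('p, 'e) chart \<Rightarrow> ('p \<Rightarrow> 'e) \<Rightarrow> ('p \<Rightarrow> 'e) \<Rightarrow> 'p \<Rightarrow> 'e" where
  "local_conn c u v p = induced_conn A nab (fst c) (chart_field A c u) (chart_field A c v) c p"

lemma induced_conn_chart_field_eq_nab:
  assumes "c \<in> A" "vector_field A X" "vector_field A Y" "atlas_open A W" "W \<subseteq> fst c" "p \<in> W"
    and "\<And>q. q \<in> W \<Longrightarrow> X c q = u q" "\<And>q. q \<in> W \<Longrightarrow> Y c q = v q"
  shows "induced_conn A nab (fst c) (chart_field A c u) (chart_field A c v) d p = nab X Y d p"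
proof (rule induced_conn_eq_nab[OF assms(2-4,6,5)])
  show "X d q = chart_field A c u d q" "Y d q = chart_field A c v d q" if "q \<in> W" for d q
    using vector_field_eq_chart_field[OF assms(2,1), of q d] vector_field_eq_chart_field[OF assms(3,1), of q d]
      assms(5,7,8) that by (auto simp: chart_field_def)
qed

lemma local_conn_eq_nab:
  assumes "c \<in> A" "vector_field A X" "vector_field A Y" "atlas_open A W" "W \<subseteq> fst c" "p \<in> W"
    and "\<And>q. q \<in> W \<Longrightarrow> X c q = u q" "\<And>q. q \<in> W \<Longrightarrow> Y c q = v q"
  shows "local_conn c u v p = nab X Y c p"
  unfolding local_conn_def by (rule induced_conn_chart_field_eq_nab[OF assms])

lemma chart_cutoff:
  assumes "c \<in> A" "p \<in> fst c"
  obtains f W where "smooth_fun A f" "supported_in (fst c) f"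
    "atlas_open A W" "W \<subseteq> fst c" "p \<in> W" "\<And>q. q \<in> W \<Longrightarrow> f q = 1"
  using cutoff_function[OF Hausdorff assms atlas_open_chart[OF assms(1)] assms(2)] by (metis Int_absorb)

lemma local_conn_cong:
  assumes "\<And>q. q \<in> fst c \<Longrightarrow> u q = u' q" "\<And>q. q \<in> fst c \<Longrightarrow> v q = v' q"
  shows "local_conn c u v = local_conn c u' v'"
  unfolding local_conn_def[abs_def] using chart_field_cong[of c, OF assms(1)] chart_field_cong[of c, OF assms(2)] by simp

context
  fixes c assumes c: "c \<in> A"
begin

lemma smooth_fun_in_chart: "smooth_fun A f \<Longrightarrow> smooth_in_chart c f"
  using c by (simp add: smooth_fun_def)

lemma smooth_local_conn:
  assumes u: "smooth_in_chart c u" and v: "smooth_in_chart c v"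
  shows "smooth_in_chart c (local_conn c u v)"
proof (rule smooth_in_chart_local[OF c])
  fix p assume p: "p \<in> fst c"
  obtain f W where f: "smooth_fun A f" "supported_in (fst c) f" and
    W: "atlas_open A W" "W \<subseteq> fst c" "p \<in> W" "\<And>q. q \<in> W \<Longrightarrow> f q = 1"
    using chart_cutoff[OF c p] by blast
  let ?Z = "nab (chart_field A c (\<lambda>q. f q *\<^sub>R u q)) (chart_field A c (\<lambda>q. f q *\<^sub>R v q)) c"
  have vf: "vector_field A (chart_field A c (\<lambda>q. f q *\<^sub>R u q))" "vector_field A (chart_field A c (\<lambda>q. f q *\<^sub>R v q))"
    using vector_field_supported[OF c f] u v by auto
  have "local_conn c u v q = ?Z q" if "q \<in> W" for q
    using that W(2,4) by (intro local_conn_eq_nab[OF c vf W(1,2)]) (auto simp: chart_field_self[OF c])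
  moreover have "smooth_in_chart c ?Z"
    using vector_field_nab[OF vf] c by (simp add: vector_field_def)
  then have "smooth_on (snd c ` (fst c \<inter> W)) (?Z \<circ> chart_inv c)"
    by (auto simp: smooth_in_chart_def intro: smooth_on_subset)
  ultimately have "smooth_on (snd c ` (fst c \<inter> W)) (local_conn c u v \<circ> chart_inv c)"
    by (subst smooth_on_cong[OF atlas_openD[OF W(1) c]]) (auto simp: chart_inv_apply[OF c])
  then show "\<exists>Q. atlas_open A Q \<and> p \<in> Q \<and> smooth_on (snd c ` (fst c \<inter> Q)) (local_conn c u v \<circ> chart_inv c)"
    using W by auto
qed

lemma induced_conn_chart_field:
  assumes u: "smooth_in_chart c u" and v: "smooth_in_chart c v"
  shows "induced_conn A nab (fst c) (chart_field A c u) (chart_field A c v) = chart_field A c (local_conn c u v)"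
proof (intro ext)
  fix d p
  let ?D = "induced_conn A nab (fst c) (chart_field A c u) (chart_field A c v)"
  show "?D d p = chart_field A c (local_conn c u v) d p"
  proof (cases "p \<in> fst c")
    case True
    obtain f W where f: "smooth_fun A f" "supported_in (fst c) f" and
      W: "atlas_open A W" "W \<subseteq> fst c" "p \<in> W" "\<And>q. q \<in> W \<Longrightarrow> f q = 1"
      using chart_cutoff[OF c True] by blast
    let ?X = "chart_field A c (\<lambda>q. f q *\<^sub>R u q)" and ?Y = "chart_field A c (\<lambda>q. f q *\<^sub>R v q)"
    have vf: "vector_field A ?X" "vector_field A ?Y"
      using vector_field_supported[OF c f] u v by auto
    have "?D d p = nab ?X ?Y d p" "local_conn c u v p = nab ?X ?Y c p"
      using W(2,4)
      by (auto intro!: induced_conn_chart_field_eq_nab[OF c vf W(1-3)] local_conn_eq_nab[OF c vf W(1-3)]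
          simp: chart_field_self[OF c])
    then show ?thesis
      using vector_field_eq_chart_field[OF vector_field_nab[OF vf] c True, of d]
      by (simp add: chart_field_def)
  qed (simp add: induced_conn_def chart_field_def)
qed

lemma local_conn_add_right:
  assumes u: "smooth_in_chart c u" and v: "smooth_in_chart c v" "smooth_in_chart c v'" and p: "p \<in> fst c"
  shows "local_conn c u (\<lambda>q. v q + v' q) p = local_conn c u v p + local_conn c u v' p"
proof -
  obtain f W where f: "smooth_fun A f" "supported_in (fst c) f" and
    W: "atlas_open A W" "W \<subseteq> fst c" "p \<in> W" "\<And>q. q \<in> W \<Longrightarrow> f q = 1"
    using chart_cutoff[OF c p] by blast
  let ?F = "\<lambda>u. chart_field A c (\<lambda>q. f q *\<^sub>R u q)"
  have vf: "vector_field A (?F w)" if "smooth_in_chart c w" for w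
    by (rule vector_field_supported[OF c f that])
  have sum: "?F (\<lambda>q. v q + v' q) = (\<lambda>d q. ?F v d q + ?F v' d q)"
    by (simp add: chart_field_add[OF c, symmetric] scaleR_add_right)
  have eq: "local_conn c u w p = nab (?F u) (?F w) c p" if "smooth_in_chart c w" for w
    using that W(2,4)
    by (intro local_conn_eq_nab[OF c vf[OF u] vf[OF that] W(1-3)]) (auto simp: chart_field_self[OF c])
  show ?thesis
    unfolding eq[OF v(1)] eq[OF v(2)] eq[OF smooth_in_chart_add[OF c v]] sum
      nab_add_right[OF vf[OF u] vf[OF v(1)] vf[OF v(2)]] ..
qed

lemma local_conn_add_left:
  assumes u: "smooth_in_chart c u" "smooth_in_chart c u'" and v: "smooth_in_chart c v" and p: "p \<in> fst c"
  shows "local_conn c (\<lambda>q. u q + u' q) v p = local_conn c u v p + local_conn c u' v p"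
proof -
  obtain f W where f: "smooth_fun A f" "supported_in (fst c) f" and
    W: "atlas_open A W" "W \<subseteq> fst c" "p \<in> W" "\<And>q. q \<in> W \<Longrightarrow> f q = 1"
    using chart_cutoff[OF c p] by blast
  let ?F = "\<lambda>u. chart_field A c (\<lambda>q. f q *\<^sub>R u q)"
  have vf: "vector_field A (?F w)" if "smooth_in_chart c w" for w
    by (rule vector_field_supported[OF c f that])
  have sum: "?F (\<lambda>q. u q + u' q) = (\<lambda>d q. ?F u d q + ?F u' d q)"
    by (simp add: chart_field_add[OF c, symmetric] scaleR_add_right)
  have eq: "local_conn c w v p = nab (?F w) (?F v) c p" if "smooth_in_chart c w" for w
    using that W(2,4)
    by (intro local_conn_eq_nab[OF c vf[OF that] vf[OF v] W(1-3)]) (auto simp: chart_field_self[OF c])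
  show ?thesis
    unfolding eq[OF u(1)] eq[OF u(2)] eq[OF smooth_in_chart_add[OF c u]] sum
      nab_add_left[OF vf[OF u(1)] vf[OF v] vf[OF u(2)]] ..
qed

lemma
  assumes u: "smooth_in_chart c u" and v: "smooth_in_chart c v" and g: "smooth_in_chart c (g :: 'p \<Rightarrow> real)"
    and p: "p \<in> fst c"
  shows local_conn_leibniz: "local_conn c u (\<lambda>q. g q *\<^sub>R v q) p
      = chart_deriv c g p (u p) *\<^sub>R v p + g p *\<^sub>R local_conn c u v p"
    and local_conn_scale_left: "local_conn c (\<lambda>q. g q *\<^sub>R u q) v p = g p *\<^sub>R local_conn c u v p"
proof -
  obtain f W where f: "smooth_fun A f" "supported_in (fst c) f" and
    W: "atlas_open A W" "W \<subseteq> fst c" "p \<in> W" "\<And>q. q \<in> W \<Longrightarrow> f q = 1"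
    using chart_cutoff[OF c p] by blast
  let ?F = "\<lambda>u. chart_field A c (\<lambda>q. f q *\<^sub>R u q)"
  define h where "h = (\<lambda>q. f q * g q)"
  have h: "smooth_fun A h" unfolding h_def by (rule smooth_fun_supported[OF c f g])
  have vf: "vector_field A (?F w)" if "smooth_in_chart c w" for w
    by (rule vector_field_supported[OF c f that])
  have vfh: "vector_field A (\<lambda>d q. h q *\<^sub>R ?F w d q)" if "smooth_in_chart c w" for w
  proof -
    have "(\<lambda>d q. h q *\<^sub>R ?F w d q) = ?F (\<lambda>q. (g q * f q) *\<^sub>R w q)"
      by (simp add: chart_field_scaleR[OF c] h_def mult.assoc)
    then show ?thesis
      using that g smooth_fun_in_chart[OF f(1)]
      by (simp only:) (intro vf smooth_in_chart_scaleR smooth_in_chart_mult c)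
  qed
  have eq: "local_conn c u v p = nab (?F u) (?F v) c p"
    using W(2,4)
    by (intro local_conn_eq_nab[OF c vf[OF u] vf[OF v] W(1-3)]) (auto simp: chart_field_self[OF c])
  have at_p: "?F w c p = w p" for w
    using W(3,4) p by (simp add: chart_field_self[OF c])
  have hg: "h p = g p" using W(3,4) by (simp add: h_def)
  have "local_conn c u (\<lambda>q. g q *\<^sub>R v q) p = nab (?F u) (\<lambda>d q. h q *\<^sub>R ?F v d q) c p"
    using W(2,4)
    by (intro local_conn_eq_nab[OF c vf[OF u] vfh[OF v] W(1-3)]) (auto simp: chart_field_self[OF c] h_def)
  also have "\<dots> = chart_deriv c h p (u p) *\<^sub>R v p + g p *\<^sub>R local_conn c u v p"
    by (simp add: nab_leibniz[OF vf[OF u] vf[OF v] h c p] eq at_p hg)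
  also have "chart_deriv c h p = chart_deriv c g p"
    by (rule chart_deriv_cong[OF c W(1) p W(3)]) (simp add: h_def W(4))
  finally show "local_conn c u (\<lambda>q. g q *\<^sub>R v q) p
      = chart_deriv c g p (u p) *\<^sub>R v p + g p *\<^sub>R local_conn c u v p" .
  have "local_conn c (\<lambda>q. g q *\<^sub>R u q) v p = nab (\<lambda>d q. h q *\<^sub>R ?F u d q) (?F v) c p"
    using W(2,4)
    by (intro local_conn_eq_nab[OF c vfh[OF u] vf[OF v] W(1-3)]) (auto simp: chart_field_self[OF c] h_def)
  then show "local_conn c (\<lambda>q. g q *\<^sub>R u q) v p = g p *\<^sub>R local_conn c u v p"
    by (simp add: nab_scale_left[OF vf[OF u] vf[OF v] h] eq hg)
qed

lemma local_conn_sum_right: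
  assumes u: "smooth_in_chart c u" and "finite I" and p: "p \<in> fst c"
    and "\<And>i. i \<in> I \<Longrightarrow> smooth_in_chart c (E i)" "\<And>i. i \<in> I \<Longrightarrow> smooth_in_chart c (g i :: 'p \<Rightarrow> real)"
  shows "local_conn c u (\<lambda>q. \<Sum>i\<in>I. g i q *\<^sub>R E i q) p
      = (\<Sum>i\<in>I. chart_deriv c (g i) p (u p) *\<^sub>R E i p + g i p *\<^sub>R local_conn c u (E i) p)"
  using assms(2,4,5)
proof (induction I)
  case empty
  have "local_conn c u (\<lambda>q. 0 *\<^sub>R 0) p = 0"
    using local_conn_leibniz[OF u smooth_in_chart_const smooth_in_chart_const p, of 0 0]
    by (simp add: chart_deriv_const)
  then show ?case by simp
next
  case (insert i I)
  have "smooth_in_chart c (\<lambda>q. g i q *\<^sub>R E i q)" "smooth_in_chart c (\<lambda>q. \<Sum>i\<in>I. g i q *\<^sub>R E i q)"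
    using insert.prems by (auto intro!: smooth_in_chart_scaleR[OF c] smooth_in_chart_sum[OF c])
  then show ?case
    using insert by (simp add: local_conn_add_right[OF u _ _ p] local_conn_leibniz[OF u _ _ p])
qed

lemma local_conn_sum_left:
  assumes v: "smooth_in_chart c v" and "finite I" and p: "p \<in> fst c"
    and "\<And>i. i \<in> I \<Longrightarrow> smooth_in_chart c (E i)" "\<And>i. i \<in> I \<Longrightarrow> smooth_in_chart c (g i :: 'p \<Rightarrow> real)"
  shows "local_conn c (\<lambda>q. \<Sum>i\<in>I. g i q *\<^sub>R E i q) v p = (\<Sum>i\<in>I. g i p *\<^sub>R local_conn c (E i) v p)"
  using assms(2,4,5)
proof (induction I)
  case empty
  have "local_conn c (\<lambda>q. 0 *\<^sub>R 0) v p = 0"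
    using local_conn_scale_left[OF smooth_in_chart_const v smooth_in_chart_const p, of 0 0] by simp
  then show ?case by simp
next
  case (insert i I)
  have "smooth_in_chart c (\<lambda>q. g i q *\<^sub>R E i q)" "smooth_in_chart c (\<lambda>q. \<Sum>i\<in>I. g i q *\<^sub>R E i q)"
    using insert.prems by (auto intro!: smooth_in_chart_scaleR[OF c] smooth_in_chart_sum[OF c])
  then show ?case
    using insert by (simp add: local_conn_add_left[OF _ _ v p] local_conn_scale_left[OF _ v _ p])
qed

text \<open>For a parallel field \<open>\<pi>\<close> of endomorphisms, $\nabla_u v = \nabla_u (\pi v) = \pi (\nabla_u v)$ if \<open>\<pi>\<close> fixes \<open>v\<close>.
  The condition concerns all multiples of \<open>v\<close> because the global field to which the connection is applied is
  a product of \<open>v\<close> with a cutoff function.\<close>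

lemma local_conn_projection:
  assumes u: "smooth_in_chart c u" and v: "smooth_in_chart c v" and p: "p \<in> fst c"
    and parallel: "\<And>X Y. vector_field A X \<Longrightarrow> vector_field A Y \<Longrightarrow>
       nab X (\<lambda>d q. \<pi> d q (Y d q)) = (\<lambda>d q. \<pi> d q (nab X Y d q))"
    and fixed: "\<And>f :: 'p \<Rightarrow> real. (\<lambda>d q. \<pi> d q (chart_field A c (\<lambda>q. f q *\<^sub>R v q) d q))
        = chart_field A c (\<lambda>q. f q *\<^sub>R v q)"
  shows "\<pi> c p (local_conn c u v p) = local_conn c u v p"
proof -
  obtain f W where f: "smooth_fun A f" "supported_in (fst c) f" and
    W: "atlas_open A W" "W \<subseteq> fst c" "p \<in> W" "\<And>q. q \<in> W \<Longrightarrow> f q = 1"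
    using chart_cutoff[OF c p] by blast
  let ?X = "chart_field A c (\<lambda>q. f q *\<^sub>R u q)" and ?Y = "chart_field A c (\<lambda>q. f q *\<^sub>R v q)"
  have vf: "vector_field A ?X" "vector_field A ?Y"
    using vector_field_supported[OF c f] u v by auto
  have eq: "local_conn c u v p = nab ?X ?Y c p"
    using W(2,4) by (intro local_conn_eq_nab[OF c vf W(1-3)]) (auto simp: chart_field_self[OF c])
  have "nab ?X ?Y c p = nab ?X (\<lambda>d q. \<pi> d q (?Y d q)) c p" unfolding fixed ..
  also have "\<dots> = \<pi> c p (nab ?X ?Y c p)" unfolding parallel[OF vf] ..
  finally show ?thesis unfolding eq ..
qed

end

section \<open>The local form of the curvature\<close>

definition local_bracket :: "('p, 'e) chart \<Rightarrow> ('p \<Rightarrow> 'e) \<Rightarrow> ('p \<Rightarrow> 'e) \<Rightarrow> 'p \<Rightarrow> 'e" where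
  "local_bracket c u v p = chart_deriv c v p (u p) - chart_deriv c u p (v p)"

text \<open>The components of a field in another chart, differentiated along a second field. The first summand is
  the second derivative of the coordinate change along both fields; it cancels in the Lie bracket, because
  it is symmetric.\<close>

lemma chart_deriv_chart_field:
  assumes c: "c \<in> A" "p \<in> fst c" and d: "d \<in> A" "p \<in> fst d" and v: "smooth_in_chart c v"
  shows "chart_deriv d (chart_field A c v d) p (chart_deriv c (snd d) p h)
    = frechet_derivative (\<lambda>y. frechet_derivative (snd d \<circ> chart_inv c) (at y) h) (at (snd c p)) (v p)
      + chart_deriv c (snd d) p (chart_deriv c v p h)"
proof -
  note o = open_overlap[OF c(1) d(1)]
  have p': "snd c p \<in> snd c ` (fst c \<inter> fst d)" using c d by auto
  have "((chart_field A c v d \<circ> chart_inv d) has_derivative chart_deriv d (chart_field A c v d) p) (at (snd d p))"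
    using smooth_on_has_derivative[OF smooth_chart_field[OF c(1) d(1) v], of "snd d p"] c d
    by (simp add: chart_deriv_def[abs_def])
  then have "chart_deriv d (chart_field A c v d) p (chart_deriv c (snd d) p h)
      = chart_deriv c (chart_field A c v d) p h"
    by (rule chart_deriv_change[OF c d, symmetric])
  also have "\<dots> = frechet_derivative (\<lambda>y. frechet_derivative (snd d \<circ> chart_inv c) (at y) ((v \<circ> chart_inv c) y)) (at (snd c p)) h"
  proof -
    have "frechet_derivative (chart_field A c v d \<circ> chart_inv c) (at (snd c p))
        = frechet_derivative (\<lambda>y. frechet_derivative (snd d \<circ> chart_inv c) (at y) ((v \<circ> chart_inv c) y)) (at (snd c p))"
      by (rule frechet_derivative_cong_open[OF o p'])
        (use d(1) chart_inv_apply[OF c(1)] in \<open>auto simp: chart_field_def chart_deriv_def\<close>)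
    then show ?thesis by (simp add: chart_deriv_def)
  qed
  also have "\<dots> = frechet_derivative (\<lambda>y. frechet_derivative (snd d \<circ> chart_inv c) (at y) h) (at (snd c p)) ((v \<circ> chart_inv c) (snd c p))
      + frechet_derivative (snd d \<circ> chart_inv c) (at (snd c p)) (frechet_derivative (v \<circ> chart_inv c) (at (snd c p)) h)"
    by (rule frechet_derivative_along_field[OF o p' smooth_transition[OF c(1) d(1)]
          smooth_on_subset[OF v[unfolded smooth_in_chart_def]]]) auto
  finally show ?thesis using chart_inv_apply[OF c] by (simp add: chart_deriv_def)
qed

lemma lie_bracket_chart_field:
  assumes c: "c \<in> A" and u: "smooth_in_chart c u" and v: "smooth_in_chart c v"
  shows "lie_bracket A (fst c) (chart_field A c u) (chart_field A c v) = chart_field A c (local_bracket c u v)"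
proof (intro ext)
  fix d p
  show "lie_bracket A (fst c) (chart_field A c u) (chart_field A c v) d p = chart_field A c (local_bracket c u v) d p"
  proof (cases "d \<in> A \<and> p \<in> fst c \<inter> fst d")
    case True
    then have d: "d \<in> A" "p \<in> fst d" and p: "p \<in> fst c" by auto
    have "frechet_derivative (\<lambda>y. frechet_derivative (snd d \<circ> chart_inv c) (at y) (u p)) (at (snd c p)) (v p)
        = frechet_derivative (\<lambda>y. frechet_derivative (snd d \<circ> chart_inv c) (at y) (v p)) (at (snd c p)) (u p)"
      by (rule second_derivative_symmetric[OF open_overlap[OF c d(1)] _ smooth_transition[OF c d(1)]])
        (use p d in auto)
    then show ?thesis
      using True chart_deriv_chart_field[OF c p d u, of "v p"] chart_deriv_chart_field[OF c p d v, of "u p"]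
        linear_diff[OF linear_transition[OF c d(1) p d(2)]]
      by (simp add: lie_bracket_def chart_field_def local_bracket_def)
  qed (auto simp: lie_bracket_def chart_field_def)
qed

lemma smooth_local_bracket:
  "c \<in> A \<Longrightarrow> smooth_in_chart c u \<Longrightarrow> smooth_in_chart c v \<Longrightarrow> smooth_in_chart c (local_bracket c u v)"
  unfolding local_bracket_def[abs_def] by (intro smooth_in_chart_diff smooth_in_chart_deriv)

lemma curvature_chart_field:
  assumes c: "c \<in> A" and p: "p \<in> fst c"
    and u: "smooth_in_chart c u" and v: "smooth_in_chart c v" and w: "smooth_in_chart c w"
  shows "curvature A nab (fst c) (chart_field A c u) (chart_field A c v) (chart_field A c w) c p
    = local_conn c u (local_conn c v w) p - local_conn c v (local_conn c u w) p
      - local_conn c (local_bracket c u v) w p"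
  unfolding curvature_def Let_def
  using p u v w
  by (simp add: lie_bracket_chart_field[OF c] induced_conn_chart_field[OF c] smooth_local_conn[OF c]
      smooth_local_bracket[OF c] chart_field_self[OF c])

text \<open>The structure equation. The span of the \<open>E k\<close> need not be the whole tangent space: it is enough that it is
  preserved by the connection. The Leibniz rule applied to $\nabla_v E_i = \omega(v)^l_i E_l$ gives the derivatives
  of the coefficients along \<open>u\<close> and a product of two matrices $\omega$; the latter contribute a commutator.\<close>

lemma curvature_frame:
  assumes c: "c \<in> A" and p: "p \<in> fst c" and I: "finite I" "i \<in> I"
    and u: "smooth_in_chart c u" and v: "smooth_in_chart c v"
    and E: "\<And>k. k \<in> I \<Longrightarrow> smooth_in_chart c (E k)"
    and \<omega>: "\<And>w k l. smooth_in_chart c w \<Longrightarrow> k \<in> I \<Longrightarrow> l \<in> I \<Longrightarrow> smooth_in_chart c (\<omega> w k l :: 'p \<Rightarrow> real)"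
    and conn: "\<And>w k q. smooth_in_chart c w \<Longrightarrow> k \<in> I \<Longrightarrow> q \<in> fst c \<Longrightarrow>
       local_conn c w (E k) q = (\<Sum>l\<in>I. \<omega> w l k q *\<^sub>R E l q)"
  shows "curvature A nab (fst c) (chart_field A c u) (chart_field A c v) (chart_field A c (E i)) c p
    = (\<Sum>l\<in>I. (chart_deriv c (\<omega> v l i) p (u p) - chart_deriv c (\<omega> u l i) p (v p)
        + (\<Sum>r\<in>I. \<omega> v r i p * \<omega> u l r p) - (\<Sum>r\<in>I. \<omega> u r i p * \<omega> v l r p)
        - \<omega> (local_bracket c u v) l i p) *\<^sub>R E l p)"
proof -
  have step: "local_conn c u (local_conn c v (E i)) p
      = (\<Sum>l\<in>I. (chart_deriv c (\<omega> v l i) p (u p) + (\<Sum>r\<in>I. \<omega> v r i p * \<omega> u l r p)) *\<^sub>R E l p)"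
    if u: "smooth_in_chart c u" and v: "smooth_in_chart c v" for u v
  proof -
    have "local_conn c u (local_conn c v (E i)) p = local_conn c u (\<lambda>q. \<Sum>l\<in>I. \<omega> v l i q *\<^sub>R E l q) p"
      using conn[OF v I(2)] by (intro fun_cong[OF local_conn_cong]) auto
    also have "\<dots> = (\<Sum>l\<in>I. chart_deriv c (\<omega> v l i) p (u p) *\<^sub>R E l p + \<omega> v l i p *\<^sub>R local_conn c u (E l) p)"
      by (rule local_conn_sum_right[OF c u I(1) p E \<omega>[OF v _ I(2)]])
    also have "\<dots> = (\<Sum>l\<in>I. chart_deriv c (\<omega> v l i) p (u p) *\<^sub>R E l p)
        + (\<Sum>r\<in>I. \<Sum>l\<in>I. (\<omega> v r i p * \<omega> u l r p) *\<^sub>R E l p)"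
      using conn[OF u _ p] by (simp add: sum.distrib scaleR_sum_right)
    also have "(\<Sum>r\<in>I. \<Sum>l\<in>I. (\<omega> v r i p * \<omega> u l r p) *\<^sub>R E l p)
        = (\<Sum>l\<in>I. (\<Sum>r\<in>I. \<omega> v r i p * \<omega> u l r p) *\<^sub>R E l p)"
      by (subst sum.swap) (simp add: scaleR_sum_left)
    finally show ?thesis by (simp add: scaleR_add_left sum.distrib)
  qed
  have "curvature A nab (fst c) (chart_field A c u) (chart_field A c v) (chart_field A c (E i)) c p
    = local_conn c u (local_conn c v (E i)) p - local_conn c v (local_conn c u (E i)) p
      - local_conn c (local_bracket c u v) (E i) p"
    by (rule curvature_chart_field[OF c p u v E[OF I(2)]])
  also have "local_conn c (local_bracket c u v) (E i) p = (\<Sum>l\<in>I. \<omega> (local_bracket c u v) l i p *\<^sub>R E l p)"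
    by (rule conn[OF smooth_local_bracket[OF c u v] I(2) p])
  finally show ?thesis
    unfolding step[OF u v] step[OF v u] sum_subtractf[symmetric] scaleR_diff_left[symmetric]
    by (simp add: algebra_simps)
qed

end

section \<open>The 1-jet bundle as a smooth manifold\<close>

lemma smooth_on_fst: "open S \<Longrightarrow> smooth_on S f \<Longrightarrow> smooth_on S (\<lambda>x. fst (f x))"
  by (rule smooth_on_bounded_linear[OF _ bounded_linear_fst])

lemma smooth_on_snd: "open S \<Longrightarrow> smooth_on S f \<Longrightarrow> smooth_on S (\<lambda>x. snd (f x))"
  by (rule smooth_on_bounded_linear[OF _ bounded_linear_snd])

lemma smooth_atlas_time: "smooth_atlas time_atlas"
  unfolding smooth_atlas_def
proof (intro conjI ballI)
  fix a b :: "(real, real) chart"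
  assume a: "a \<in> time_atlas"
  then show "inj_on (snd a) (fst a)" by (auto simp: time_atlas_def)
  assume b: "b \<in> time_atlas"
  have oa: "open (snd a ` fst a)" "open (fst b)" "inj_on (snd a) (fst a)"
    and sm: "smooth_on (snd a ` fst a) (chart_inv a)" "smooth_on (fst b) (snd b)"
    using a b by (auto simp: time_atlas_def)
  have eq: "snd a ` (fst a \<inter> fst b) = chart_inv a -` fst b \<inter> snd a ` fst a"
    using oa(3) by (auto simp: image_iff)
  show o: "open (snd a ` (fst a \<inter> fst b))"
    unfolding eq using continuous_open_preimage[OF smooth_on_imp_continuous_on[OF sm(1)] oa(1,2)]
    by (simp add: Int_commute)
  have "smooth_on (snd a ` (fst a \<inter> fst b)) (\<lambda>x. snd b (chart_inv a x))"
    by (rule smooth_on_compose[OF o oa(2) _ smooth_on_subset[OF sm(1)] sm(2)]) (use oa(3) in auto)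
  then show "smooth_on (snd a ` (fst a \<inter> fst b)) (snd b \<circ> chart_inv a)"
    by (simp add: o_def)
qed

interpretation time: smooth_charts time_atlas
  by unfold_locales (rule smooth_atlas_time)

lemma time_chart_ident: "(UNIV, \<lambda>t. t) \<in> time_atlas"
  by (auto simp: time_atlas_def smooth_on_ident inv_into_def)

abbreviation time_rate :: "(real, real) chart \<Rightarrow> (real, real) chart \<Rightarrow> real \<Rightarrow> real" where
  "time_rate a b t \<equiv> chart_deriv a (snd b) t 1"

text \<open>The derivative of the standard time with respect to the coordinate of \<open>a\<close>, which converts the velocity
  of a curve into the fibre coordinate $y$.\<close>
definition inverse_rate :: "(real, real) chart \<Rightarrow> real \<Rightarrow> real" where
  "inverse_rate a t = frechet_derivative (chart_inv a) (at (snd a t)) 1"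

lemma inverse_rate_change:
  assumes "a \<in> time_atlas" "b \<in> time_atlas" "t \<in> fst a" "t \<in> fst b"
  shows "inverse_rate b t = time_rate b a t * inverse_rate a t"
proof -
  have d: "(chart_inv a has_derivative frechet_derivative (chart_inv a) (at (snd a t))) (at (snd a t))"
    using assms by (intro smooth_on_has_derivative[of "snd a ` fst a"]) (auto simp: time_atlas_def)
  then have "(((\<lambda>t. t) \<circ> chart_inv a) has_derivative frechet_derivative (chart_inv a) (at (snd a t))) (at (snd a t))"
    by (simp add: o_def)
  from time.chart_deriv_change[OF assms(2,4,1,3) this, of 1]
  have "inverse_rate b t = frechet_derivative (chart_inv a) (at (snd a t)) (time_rate b a t *\<^sub>R 1)"
    by (simp add: inverse_rate_def chart_deriv_def o_def)
  then show ?thesis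
    using linear_cmul[OF has_derivative_linear[OF d], of "time_rate b a t" 1] by (simp add: inverse_rate_def)
qed

lemma inverse_rate_nonzero:
  assumes "a \<in> time_atlas" "t \<in> fst a"
  shows "inverse_rate a t \<noteq> 0"
proof -
  have "inverse_rate (UNIV, \<lambda>t. t) t = 1"
    by (simp add: inverse_rate_def inv_into_def)
  then show ?thesis
    using inverse_rate_change[OF assms(1) time_chart_ident assms(2)] by auto
qed

definition jet_time :: "'m jet \<Rightarrow> real" where
  "jet_time e = fst (SOME z. z \<in> e)"

definition jet_point :: "'m jet \<Rightarrow> 'm" where
  "jet_point e = snd (SOME z. z \<in> e) (jet_time e)"

definition jet_velocity :: "('m, 'e::euclidean_space) chart \<Rightarrow> 'm jet \<Rightarrow> 'e" where
  "jet_velocity b e = vector_derivative (snd b \<circ> snd (SOME z. z \<in> e)) (at (jet_time e))"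

locale jet_base = base: smooth_charts A for A :: "('m, 'e::euclidean_space) chart set"
begin

lemma smooth_curve_in_chart:
  assumes "smooth_curve_at A t f" "b \<in> A" "f t \<in> fst b"
  obtains J where "open J" "t \<in> J" "f ` J \<subseteq> fst b" "smooth_on J (snd b \<circ> f)"
proof -
  obtain I where I: "open I" "t \<in> I" "open {s \<in> I. f s \<in> fst b}" "smooth_on {s \<in> I. f s \<in> fst b} (snd b \<circ> f)"
    using assms unfolding smooth_curve_at_def by blast
  show ?thesis by (rule that[OF I(3) _ _ I(4)]) (use I(2) assms(3) in auto)
qed

lemma curve_has_velocity:
  assumes "smooth_curve_at A t f" "b \<in> A" "f t \<in> fst b"
  shows "((snd b \<circ> f) has_vector_derivative vector_derivative (snd b \<circ> f) (at t)) (at t)"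
proof -
  obtain J where "t \<in> J" "smooth_on J (snd b \<circ> f)"
    using smooth_curve_in_chart[OF assms] by blast
  then show ?thesis
    using smooth_on_differentiable vector_derivative_works by blast
qed

lemma velocity_change:
  assumes f: "smooth_curve_at A t f" and b: "b \<in> A" "f t \<in> fst b" and d: "d \<in> A" "f t \<in> fst d"
  shows "vector_derivative (snd d \<circ> f) (at t) = chart_deriv b (snd d) (f t) (vector_derivative (snd b \<circ> f) (at t))"
proof -
  obtain J where J: "open J" "t \<in> J" "f ` J \<subseteq> fst b"
    using smooth_curve_in_chart[OF f b] by metis
  let ?v = "vector_derivative (snd b \<circ> f) (at t)"
  have D: "((snd d \<circ> chart_inv b) has_derivative chart_deriv b (snd d) (f t)) (at ((snd b \<circ> f) t))"
    using base.transition_has_derivative[OF b(1) d(1) b(2) d(2)] by simp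
  have "((snd d \<circ> chart_inv b) \<circ> (snd b \<circ> f) has_derivative chart_deriv b (snd d) (f t) \<circ> (\<lambda>r. r *\<^sub>R ?v)) (at t)"
    using diff_chain_at[OF curve_has_velocity[OF f b, unfolded has_vector_derivative_def] D] .
  then have "(snd d \<circ> f has_derivative chart_deriv b (snd d) (f t) \<circ> (\<lambda>r. r *\<^sub>R ?v)) (at t)"
    by (rule has_derivative_transform_within_open[OF _ J(1,2)])
      (use J(3) base.chart_inv_apply[OF b(1)] in auto)
  then have "(snd d \<circ> f has_vector_derivative chart_deriv b (snd d) (f t) ?v) (at t)"
    using linear_cmul[OF base.linear_transition[OF b(1) d(1) b(2) d(2)]]
    by (simp add: has_vector_derivative_def o_def)
  then show ?thesis by (rule vector_derivative_at)
qed

text \<open>Equal velocities in one chart are equal in all charts, since a velocity transforms by the Jacobian.\<close>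

lemma jet_relI:
  assumes "smooth_curve_at A t f" "smooth_curve_at A t g" "f t = g t"
    and b: "b \<in> A" "f t \<in> fst b" "vector_derivative (snd b \<circ> f) (at t) = vector_derivative (snd b \<circ> g) (at t)"
  shows "((t, f), (t, g)) \<in> jet_rel A"
proof -
  have "vector_derivative (snd c \<circ> f) (at t) = vector_derivative (snd c \<circ> g) (at t)"
    if c: "c \<in> A" "f t \<in> fst c" for c
  proof -
    have g: "g t \<in> fst b" "g t \<in> fst c" using assms(3) b(2) c(2) by simp_all
    show ?thesis
      unfolding velocity_change[OF assms(1) b(1,2) c] velocity_change[OF assms(2) b(1) g(1) c(1) g(2)]
      by (simp add: assms(3) b(3))
  qed
  then show ?thesis using assms(1-3) by (simp add: jet_rel_def)
qed

lemma equiv_jet_rel: "equiv {(t, f). smooth_curve_at A t f} (jet_rel A)"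
proof (rule equivI)
  show "jet_rel A \<subseteq> {(t, f). smooth_curve_at A t f} \<times> {(t, f). smooth_curve_at A t f}"
    by (auto simp: jet_rel_def)
  show "refl_on {(t, f). smooth_curve_at A t f} (jet_rel A)"
    by (rule refl_onI) (auto simp: jet_rel_def)
  show "sym (jet_rel A)" by (rule symI) (auto simp: jet_rel_def)
  show "trans (jet_rel A)"
  proof (rule transI)
    fix x y z :: "real \<times> (real \<Rightarrow> 'm)"
    assume "(x, y) \<in> jet_rel A" "(y, z) \<in> jet_rel A"
    then show "(x, z) \<in> jet_rel A"
      by (cases x, cases y, cases z) (simp add: jet_rel_def)
  qed
qed

text \<open>The point, the time and the velocity of a jet may be computed from any curve that represents it, so the
  choices made in the definitions above and in \<^const>\<open>jet_chart\<close> are immaterial.\<close>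

lemma jet_representative:
  assumes "e \<in> jet_space A" "z \<in> e"
  shows "e = jet_rel A `` {z}" "smooth_curve_at A (fst z) (snd z)"
    "jet_time e = fst z" "jet_point e = snd z (fst z)"
    "\<And>b. b \<in> A \<Longrightarrow> jet_point e \<in> fst b \<Longrightarrow> jet_velocity b e = vector_derivative (snd b \<circ> snd z) (at (fst z))"
proof -
  let ?z = "SOME z. z \<in> e"
  have "?z \<in> e" using assms(2) by (rule someI)
  then have "(?z, z) \<in> jet_rel A"
    using quotient_eq_iff[OF equiv_jet_rel, of e e ?z z] assms unfolding jet_space_def by blast
  then show "smooth_curve_at A (fst z) (snd z)"
    "jet_time e = fst z" "jet_point e = snd z (fst z)"
    "\<And>b. b \<in> A \<Longrightarrow> jet_point e \<in> fst b \<Longrightarrow> jet_velocity b e = vector_derivative (snd b \<circ> snd z) (at (fst z))"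
    by (auto simp: jet_rel_def jet_time_def jet_point_def jet_velocity_def split: prod.splits)
  show "e = jet_rel A `` {z}"
    using assms equiv_class_eq_iff[OF equiv_jet_rel] unfolding jet_space_def
    by (metis (no_types, lifting) Image_singleton_iff equiv_jet_rel quotientE equiv_class_eq)
qed

lemma jet_obtain:
  assumes "e \<in> jet_space A"
  obtains t f where "(t, f) \<in> e"
  using assms in_quotient_imp_non_empty[OF equiv_jet_rel, of e] unfolding jet_space_def by auto

lemma jet_of_curve:
  assumes "smooth_curve_at A t f"
  shows "jet_rel A `` {(t, f)} \<in> jet_space A" "(t, f) \<in> jet_rel A `` {(t, f)}"
  using quotientI[of "(t, f)" "{(t, f). smooth_curve_at A t f}" "jet_rel A"] assms
  by (simp_all add: jet_space_def) (simp add: jet_rel_def)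

lemma jet_eqI:
  assumes e: "e \<in> jet_space A" "e' \<in> jet_space A" and eq: "jet_time e = jet_time e'" "jet_point e = jet_point e'"
    and b: "b \<in> A" "jet_point e \<in> fst b" "jet_velocity b e = jet_velocity b e'"
  shows "e = e'"
proof -
  obtain t f where f: "(t, f) \<in> e" by (rule jet_obtain[OF e(1)])
  obtain s g where g: "(s, g) \<in> e'" by (rule jet_obtain[OF e(2)])
  note F = jet_representative[OF e(1) f, simplified] and G = jet_representative[OF e(2) g, simplified]
  have s: "s = t" using F G eq by simp
  have "((t, f), (t, g)) \<in> jet_rel A"
    using F G eq b by (intro jet_relI[of t f g b]) (auto simp: s)
  then show ?thesis
    unfolding F(1) G(1) s by (intro equiv_class_eq[OF equiv_jet_rel])
qed

lemma jet_chart_domain: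
  "fst (jet_chart A a b) = {e \<in> jet_space A. jet_time e \<in> fst a \<and> jet_point e \<in> fst b}"
proof -
  have "(\<exists>(t, f)\<in>e. t \<in> fst a \<and> f t \<in> fst b) \<longleftrightarrow> jet_time e \<in> fst a \<and> jet_point e \<in> fst b"
    if e: "e \<in> jet_space A" for e
  proof -
    obtain t f where f: "(t, f) \<in> e" by (rule jet_obtain[OF e])
    have "s = jet_time e" "g s = jet_point e" if "(s, g) \<in> e" for s g
      using jet_representative(3,4)[OF e that] by simp_all
    then show ?thesis using f by fastforce
  qed
  then show ?thesis by (auto simp: jet_chart_def)
qed

lemma jet_chart_apply:
  assumes a: "a \<in> time_atlas" and b: "b \<in> A" and e: "e \<in> fst (jet_chart A a b)"
  shows "snd (jet_chart A a b) e
    = (snd a (jet_time e), snd b (jet_point e), inverse_rate a (jet_time e) *\<^sub>R jet_velocity b e)"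
proof -
  have e': "e \<in> jet_space A" "jet_time e \<in> fst a" "jet_point e \<in> fst b"
    using e by (auto simp: jet_chart_domain)
  define z where "z = (SOME z. z \<in> e)"
  have "z \<in> e" unfolding z_def using jet_obtain[OF e'(1)] someI by metis
  note z = jet_representative[OF e'(1) this]
  have ia: "chart_inv a (snd a (jet_time e)) = jet_time e"
    by (rule time.chart_inv_apply[OF a e'(2)])
  have "(chart_inv a has_derivative frechet_derivative (chart_inv a) (at (snd a (jet_time e)))) (at (snd a (jet_time e)))"
    using a e'(2) by (intro smooth_on_has_derivative[of "snd a ` fst a"]) (auto simp: time_atlas_def)
  then have "(chart_inv a has_derivative (\<lambda>h. h *\<^sub>R inverse_rate a (jet_time e))) (at (snd a (jet_time e)))"
    unfolding inverse_rate_def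
    by (metis (no_types, lifting) linear_cmul[OF has_derivative_linear] ext mult.right_neutral real_scaleR_def)
  then have "(chart_inv a has_vector_derivative inverse_rate a (jet_time e)) (at (snd a (jet_time e)))"
    by (simp add: has_vector_derivative_def)
  moreover have "((snd b \<circ> snd z) has_vector_derivative jet_velocity b e) (at (chart_inv a (snd a (jet_time e))))"
    unfolding ia using curve_has_velocity[OF z(2) b] z(3,4) e'(3) z(5)[OF b e'(3)] by simp
  ultimately have "((snd b \<circ> snd z) \<circ> chart_inv a has_vector_derivative
      inverse_rate a (jet_time e) *\<^sub>R jet_velocity b e) (at (snd a (jet_time e)))"
    by (rule vector_diff_chain_at)
  from vector_derivative_at[OF this] show ?thesis
    unfolding jet_chart_def snd_conv Let_def z_def[symmetric] case_prod_beta z(3)[symmetric] z(4)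
    by (simp add: o_assoc)
qed

text \<open>A straight line in the chart has any prescribed initial value and velocity.\<close>

lemma jet_exists:
  assumes a: "a \<in> time_atlas" "t \<in> fst a" and b: "b \<in> A" "q \<in> fst b"
  obtains e where "e \<in> fst (jet_chart A a b)" "jet_time e = t" "jet_point e = q"
    "snd (jet_chart A a b) e = (snd a t, snd b q, y)"
proof -
  define v where "v = y /\<^sub>R inverse_rate a t"
  define l where "l s = snd b q + (s - t) *\<^sub>R v" for s
  define f where "f s = chart_inv b (l s)" for s
  define I where "I = l -` (snd b ` fst b)"
  have cl: "continuous_on UNIV l" by (auto simp: l_def intro!: continuous_intros)
  have sl: "smooth_on UNIV l"
    unfolding l_def
    by (intro smooth_on_add smooth_on_scaleR smooth_on_diff smooth_on_const smooth_on_ident open_UNIV)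
  have oI: "open I"
    unfolding I_def using continuous_open_preimage[OF cl open_UNIV base.open_chart_image[OF b(1)]] by simp
  have ft: "f t = q" using base.chart_inv_apply[OF b] by (simp add: f_def l_def)
  have tI: "t \<in> I" using b by (simp add: I_def l_def)
  have bf: "snd b (f s) = l s" if "s \<in> I" for s
    using that by (auto simp: I_def f_def f_inv_into_f)
  have fb: "f s \<in> fst b" if "s \<in> I" for s
    using that by (auto simp: I_def f_def inv_into_into)
  have sc: "smooth_curve_at A t f"
    unfolding smooth_curve_at_def
  proof (intro exI[of _ I] conjI ballI oI tI)
    show "f ` I \<subseteq> atlas_points A" using fb b by (auto simp: atlas_points_def)
    fix c assume c: "c \<in> A"
    have eq: "{s \<in> I. f s \<in> fst c} = l -` (snd b ` (fst b \<inter> fst c))"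
    proof (intro set_eqI iffI)
      fix s assume "s \<in> {s \<in> I. f s \<in> fst c}"
      then show "s \<in> l -` (snd b ` (fst b \<inter> fst c))"
        using bf[of s] fb[of s] by (auto intro!: image_eqI[of _ _ "f s"])
    next
      fix s assume "s \<in> l -` (snd b ` (fst b \<inter> fst c))"
      then obtain q' where "l s = snd b q'" "q' \<in> fst b" "q' \<in> fst c" by auto
      then show "s \<in> {s \<in> I. f s \<in> fst c}"
        using base.chart_inv_apply[OF b(1)] by (auto simp: I_def f_def)
    qed
    show o: "open {s \<in> I. f s \<in> fst c}"
      unfolding eq using continuous_open_preimage[OF cl open_UNIV base.open_overlap[OF b(1) c]] by simp
    have "smooth_on {s \<in> I. f s \<in> fst c} (\<lambda>s. (snd c \<circ> chart_inv b) (l s))"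
      by (rule smooth_on_compose[OF o base.open_overlap[OF b(1) c] _ smooth_on_subset[OF sl]
            base.smooth_transition[OF b(1) c]]) (auto simp: eq)
    then show "smooth_on {s \<in> I. f s \<in> fst c} (snd c \<circ> f)"
      by (simp add: f_def o_def)
  qed
  have "(l has_vector_derivative v) (at t)"
    unfolding l_def has_vector_derivative_def by (auto intro!: derivative_eq_intros)
  then have "((snd b \<circ> f) has_vector_derivative v) (at t)"
    by (rule has_vector_derivative_transform_within_open[OF _ oI tI]) (simp add: bf)
  then have v: "vector_derivative (snd b \<circ> f) (at t) = v"
    by (rule vector_derivative_at)
  define e where "e = jet_rel A `` {(t, f)}"
  note E = jet_of_curve[OF sc, folded e_def]
  note R = jet_representative[OF E, simplified]
  have dom: "e \<in> fst (jet_chart A a b)"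
    using E(1) R(3,4) a b ft by (simp add: jet_chart_domain)
  show ?thesis
    using R(3,4) R(5)[OF b(1)] b ft v inverse_rate_nonzero[OF a]
    by (intro that[OF dom]) (simp_all add: jet_chart_apply[OF a(1) b(1) dom] v_def)
qed

lemma jet_chart_image:
  assumes a: "a \<in> time_atlas" and b: "b \<in> A"
  shows "snd (jet_chart A a b) ` {e \<in> fst (jet_chart A a b). jet_time e \<in> P \<and> jet_point e \<in> Q}
    = (snd a ` (fst a \<inter> P)) \<times> (snd b ` (fst b \<inter> Q)) \<times> UNIV"
proof (intro equalityI subsetI)
  fix z assume "z \<in> snd (jet_chart A a b) ` {e \<in> fst (jet_chart A a b). jet_time e \<in> P \<and> jet_point e \<in> Q}"
  then obtain e where "e \<in> fst (jet_chart A a b)" "jet_time e \<in> P" "jet_point e \<in> Q" "z = snd (jet_chart A a b) e"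
    by auto
  then show "z \<in> (snd a ` (fst a \<inter> P)) \<times> (snd b ` (fst b \<inter> Q)) \<times> UNIV"
    by (simp add: jet_chart_apply[OF a b]) (auto simp: jet_chart_domain)
next
  fix z assume "z \<in> (snd a ` (fst a \<inter> P)) \<times> (snd b ` (fst b \<inter> Q)) \<times> (UNIV :: 'e set)"
  then obtain t q y where z: "t \<in> fst a" "t \<in> P" "q \<in> fst b" "q \<in> Q" "z = (snd a t, snd b q, y)" by auto
  obtain e where "e \<in> fst (jet_chart A a b)" "jet_time e = t" "jet_point e = q"
    "snd (jet_chart A a b) e = z"
    using jet_exists[OF a z(1) b z(3), of y] z(5) by metis
  then show "z \<in> snd (jet_chart A a b) ` {e \<in> fst (jet_chart A a b). jet_time e \<in> P \<and> jet_point e \<in> Q}"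
    using z by (auto intro!: image_eqI[of _ _ e])
qed

lemma jet_overlap:
  "fst (jet_chart A a b) \<inter> fst (jet_chart A a' b')
    = {e \<in> fst (jet_chart A a b). jet_time e \<in> fst a' \<and> jet_point e \<in> fst b'}"
  by (auto simp: jet_chart_domain)

text \<open>The coordinate change $(t, x, y) \mapsto (\tilde t, \tilde x, \frac{\partial \tilde x}{\partial x} \frac{dt}{d \tilde t} y)$. The factor
  $dt / d \tilde t$ is taken as the derivative of the inverse time change at $\tilde t$, which is smooth by the
  same argument as the other factors, without a division.\<close>
definition jet_transition :: "(real, real) chart \<Rightarrow> ('m, 'e) chart \<Rightarrow> (real, real) chart \<Rightarrow> ('m, 'e) chart
    \<Rightarrow> real \<times> 'e \<times> 'e \<Rightarrow> real \<times> 'e \<times> 'e" where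
  "jet_transition a b a' b' z =
     ((snd a' \<circ> chart_inv a) (fst z), (snd b' \<circ> chart_inv b) (fst (snd z)),
      frechet_derivative (snd a \<circ> chart_inv a') (at ((snd a' \<circ> chart_inv a) (fst z))) 1 *\<^sub>R
      frechet_derivative (snd b' \<circ> chart_inv b) (at (fst (snd z))) (snd (snd z)))"

lemma jet_transition_apply:
  assumes a: "a \<in> time_atlas" "a' \<in> time_atlas" and b: "b \<in> A" "b' \<in> A"
    and e: "e \<in> fst (jet_chart A a b)" "e \<in> fst (jet_chart A a' b')"
  shows "jet_transition a b a' b' (snd (jet_chart A a b) e) = snd (jet_chart A a' b') e"
proof -
  have e': "e \<in> jet_space A" "jet_time e \<in> fst a" "jet_point e \<in> fst b" "jet_time e \<in> fst a'" "jet_point e \<in> fst b'"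
    using e by (auto simp: jet_chart_domain)
  obtain t f where f: "(t, f) \<in> e" by (rule jet_obtain[OF e'(1)])
  note R = jet_representative[OF e'(1) f, simplified]
  have "jet_velocity b' e = chart_deriv b (snd b') (jet_point e) (jet_velocity b e)"
    using velocity_change[OF R(2) b(1) _ b(2)] R(4,5) b e' by simp
  then show ?thesis
    using time.chart_inv_apply[OF a(1) e'(2)] base.chart_inv_apply[OF b(1) e'(3)]
      inverse_rate_change[OF a e'(2,4)]
      linear_cmul[OF base.linear_transition[OF b e'(3,5)], of "inverse_rate a (jet_time e)" "jet_velocity b e"]
    by (simp add: jet_transition_def jet_chart_apply[OF a(1) b(1) e(1)] jet_chart_apply[OF a(2) b(2) e(2)]
        chart_deriv_def)
qed

lemma smooth_jet_transition:
  assumes a: "a \<in> time_atlas" "a' \<in> time_atlas" and b: "b \<in> A" "b' \<in> A"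
  shows "smooth_on (snd a ` (fst a \<inter> fst a') \<times> snd b ` (fst b \<inter> fst b') \<times> UNIV) (jet_transition a b a' b')"
proof -
  let ?S = "snd a ` (fst a \<inter> fst a') \<times> snd b ` (fst b \<inter> fst b') \<times> (UNIV :: 'e set)"
  note oa = time.open_overlap[OF a] time.open_overlap[OF a(2,1)] and ob = base.open_overlap[OF b]
  have o: "open ?S" by (intro open_Times oa ob open_UNIV)
  have s: "smooth_on ?S fst" "smooth_on ?S (\<lambda>z. fst (snd z))" "smooth_on ?S (\<lambda>z. snd (snd z))"
    using smooth_on_ident[OF o] by (auto intro!: smooth_on_fst smooth_on_snd o)
  have 1: "smooth_on ?S (\<lambda>z. (snd a' \<circ> chart_inv a) (fst z))"
    by (rule smooth_on_compose[OF o oa(1) _ s(1) time.smooth_transition[OF a]]) auto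
  have 2: "smooth_on ?S (\<lambda>z. (snd b' \<circ> chart_inv b) (fst (snd z)))"
    by (rule smooth_on_compose[OF o ob _ s(2) base.smooth_transition[OF b]]) auto
  have 3: "smooth_on ?S (\<lambda>z. frechet_derivative (snd a \<circ> chart_inv a') (at ((snd a' \<circ> chart_inv a) (fst z))) 1)"
    by (rule smooth_on_derivative[OF o oa(2) _ time.smooth_transition[OF a(2,1)] 1 smooth_on_const])
      (use time.chart_inv_apply[OF a(1)] in auto)
  have 4: "smooth_on ?S (\<lambda>z. frechet_derivative (snd b' \<circ> chart_inv b) (at (fst (snd z))) (snd (snd z)))"
    by (rule smooth_on_derivative[OF o ob _ base.smooth_transition[OF b] s(2,3)]) auto
  show ?thesis
    unfolding jet_transition_def[abs_def] by (intro smooth_on_Pair smooth_on_scaleR o 1 2 3 4)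
qed

lemma jet_chart_inj:
  assumes a: "a \<in> time_atlas" and b: "b \<in> A"
  shows "inj_on (snd (jet_chart A a b)) (fst (jet_chart A a b))"
proof (rule inj_onI)
  fix e e' assume e: "e \<in> fst (jet_chart A a b)" "e' \<in> fst (jet_chart A a b)"
    and eq: "snd (jet_chart A a b) e = snd (jet_chart A a b) e'"
  have D: "e \<in> jet_space A" "e' \<in> jet_space A" "jet_time e \<in> fst a" "jet_time e' \<in> fst a"
    "jet_point e \<in> fst b" "jet_point e' \<in> fst b"
    using e by (auto simp: jet_chart_domain)
  have E: "snd a (jet_time e) = snd a (jet_time e')" "snd b (jet_point e) = snd b (jet_point e')"
    "inverse_rate a (jet_time e) *\<^sub>R jet_velocity b e = inverse_rate a (jet_time e') *\<^sub>R jet_velocity b e'"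
    using eq by (simp_all add: jet_chart_apply[OF a b] e)
  have t: "jet_time e = jet_time e'" and q: "jet_point e = jet_point e'"
    using time.chart_inv_apply[OF a] base.chart_inv_apply[OF b] D E by metis+
  have "jet_velocity b e = jet_velocity b e'"
    using E(3) inverse_rate_nonzero[OF a D(3)] by (simp add: t)
  then show "e = e'" using jet_eqI[OF D(1,2) t q b D(5)] by simp
qed

lemma jet_chart_inv_apply:
  assumes "a \<in> time_atlas" "b \<in> A" "e \<in> fst (jet_chart A a b)"
  shows "chart_inv (jet_chart A a b) (snd (jet_chart A a b) e) = e"
  using jet_chart_inj[OF assms(1,2)] assms(3) by simp

lemma jet_transition_eq:
  assumes a: "a \<in> time_atlas" "a' \<in> time_atlas" and b: "b \<in> A" "b' \<in> A"
    and z: "z \<in> snd a ` (fst a \<inter> fst a') \<times> snd b ` (fst b \<inter> fst b') \<times> UNIV"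
  shows "(snd (jet_chart A a' b') \<circ> chart_inv (jet_chart A a b)) z = jet_transition a b a' b' z"
proof -
  from z obtain e where e: "e \<in> fst (jet_chart A a b)" "e \<in> fst (jet_chart A a' b')" "z = snd (jet_chart A a b) e"
    unfolding jet_chart_image[OF a(1) b(1), symmetric] jet_overlap[symmetric] by auto
  then show ?thesis
    using jet_transition_apply[OF a b e(1,2)] jet_chart_inv_apply[OF a(1) b(1) e(1)] by simp
qed

lemma smooth_atlas_jet: "smooth_atlas (jet_atlas A)"
  unfolding smooth_atlas_def
proof (intro conjI ballI)
  fix c d assume c: "c \<in> jet_atlas A"
  then obtain a b where ab: "a \<in> time_atlas" "b \<in> A" "c = jet_chart A a b" by (auto simp: jet_atlas_def)
  show "inj_on (snd c) (fst c)" unfolding ab(3) by (rule jet_chart_inj[OF ab(1,2)])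
  assume d: "d \<in> jet_atlas A"
  then obtain a' b' where ab': "a' \<in> time_atlas" "b' \<in> A" "d = jet_chart A a' b'" by (auto simp: jet_atlas_def)
  have im: "snd c ` (fst c \<inter> fst d) = snd a ` (fst a \<inter> fst a') \<times> snd b ` (fst b \<inter> fst b') \<times> UNIV"
    unfolding ab(3) ab'(3) jet_overlap jet_chart_image[OF ab(1,2)] ..
  show o: "open (snd c ` (fst c \<inter> fst d))"
    unfolding im by (intro open_Times time.open_overlap ab ab' base.open_overlap open_UNIV)
  show "smooth_on (snd c ` (fst c \<inter> fst d)) (snd d \<circ> chart_inv c)"
    using smooth_jet_transition[OF ab(1) ab'(1) ab(2) ab'(2)] o
    unfolding im
    by (subst smooth_on_cong[of _ _ "jet_transition a b a' b'"])
      (auto simp only: ab(3) ab'(3) jet_transition_eq[OF ab(1) ab'(1) ab(2) ab'(2)])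
qed

sublocale jet: smooth_charts "jet_atlas A"
  by unfold_locales (rule smooth_atlas_jet)

lemma jet_chart_in_atlas: "a \<in> time_atlas \<Longrightarrow> b \<in> A \<Longrightarrow> jet_chart A a b \<in> jet_atlas A"
  unfolding jet_atlas_def by blast

text \<open>Jets over different points of \<open>M\<close> are separated by neighbourhoods of these points. Jets over the same
  point lie in one chart, whatever their times are, since the time line has a global coordinate.\<close>

lemma Hausdorff_jet:
  assumes H: "Hausdorff_space (atlas_topology A)"
  shows "Hausdorff_space (atlas_topology (jet_atlas A))"
  unfolding Hausdorff_space_def jet.topspace_atlas_topology
proof (intro allI impI, elim conjE)
  fix e e' assume e: "e \<in> atlas_points (jet_atlas A)" "e' \<in> atlas_points (jet_atlas A)" and ne: "e \<noteq> e'"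
  let ?a = "(UNIV, \<lambda>t. t) :: (real, real) chart"
  have "e \<in> jet_space A \<and> jet_point e \<in> atlas_points A" if e: "e \<in> atlas_points (jet_atlas A)" for e
  proof -
    from e obtain a b where "b \<in> A" "e \<in> fst (jet_chart A a b)"
      unfolding atlas_points_def jet_atlas_def by blast
    then show ?thesis by (auto simp: jet_chart_domain atlas_points_def)
  qed
  then have js: "e \<in> jet_space A" "e' \<in> jet_space A"
    and base: "jet_point e \<in> atlas_points A" "jet_point e' \<in> atlas_points A"
    using e by auto
  have open_pre: "atlas_open (jet_atlas A) {e \<in> atlas_points (jet_atlas A). jet_point e \<in> Q}"
    if Q: "atlas_open A Q" for Q
    unfolding atlas_open_def
  proof (intro conjI ballI)
    fix c assume c: "c \<in> jet_atlas A"
    then obtain a b where ab: "a \<in> time_atlas" "b \<in> A" "c = jet_chart A a b" by (auto simp: jet_atlas_def)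
    have "fst c \<inter> {e \<in> atlas_points (jet_atlas A). jet_point e \<in> Q} = {e \<in> fst c. jet_time e \<in> UNIV \<and> jet_point e \<in> Q}"
      using c by (auto simp: atlas_points_def)
    then have "snd c ` (fst c \<inter> {e \<in> atlas_points (jet_atlas A). jet_point e \<in> Q})
        = snd a ` (fst a \<inter> UNIV) \<times> snd b ` (fst b \<inter> Q) \<times> UNIV"
      by (simp only: ab(3) jet_chart_image[OF ab(1,2)])
    then show "open (snd c ` (fst c \<inter> {e \<in> atlas_points (jet_atlas A). jet_point e \<in> Q}))"
      using time.open_chart_image[OF ab(1)] base.atlas_openD[OF Q ab(2)] by (simp add: open_Times)
  qed auto
  show "\<exists>U V. openin (atlas_topology (jet_atlas A)) U \<and> openin (atlas_topology (jet_atlas A)) V \<and>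
     e \<in> U \<and> e' \<in> V \<and> disjnt U V"
  proof (cases "jet_point e = jet_point e'")
    case False
    then obtain Q Q' where "atlas_open A Q" "atlas_open A Q'" "jet_point e \<in> Q" "jet_point e' \<in> Q'" "disjnt Q Q'"
      using H base unfolding Hausdorff_space_def base.topspace_atlas_topology openin_atlas_topology[OF base.A]
      by metis
    then show ?thesis
      using open_pre e unfolding openin_atlas_topology[OF jet.A]
      by (intro exI[of _ "{e \<in> atlas_points (jet_atlas A). jet_point e \<in> Q}"]
          exI[of _ "{e \<in> atlas_points (jet_atlas A). jet_point e \<in> Q'}"]) (auto simp: disjnt_def)
  next
    case True
    obtain b where b: "b \<in> A" "jet_point e \<in> fst b" using base by (auto simp: atlas_points_def)
    define c where "c = jet_chart A ?a b"
    have c: "c \<in> jet_atlas A" "e \<in> fst c" "e' \<in> fst c"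
      using b True js time_chart_ident by (auto simp: c_def jet_chart_in_atlas jet_chart_domain)
    then have "snd c e \<noteq> snd c e'" using ne jet.chart_inv_apply by metis
    then obtain U V where "open U" "open V" "snd c e \<in> U" "snd c e' \<in> V" "U \<inter> V = {}"
      using hausdorff by metis
    then show ?thesis
      using jet.atlas_open_preimage[OF c(1)] c unfolding openin_atlas_topology[OF jet.A]
      by (intro exI[of _ "{e \<in> fst c. snd c e \<in> U}"] exI[of _ "{e \<in> fst c. snd c e \<in> V}"])
        (auto simp: disjnt_def)
  qed
qed

text \<open>Only the blocks of the Jacobian that have a simple form are computed. The derivatives of $\tilde y$ with
  respect to $t$ and $x$ contain second derivatives of the coordinate changes, but the transformation law of a
  nonlinear connection refers to them directly.\<close>

lemma
  assumes a: "a \<in> time_atlas" "a' \<in> time_atlas" and b: "b \<in> A" "b' \<in> A"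
    and p: "p \<in> fst (jet_chart A a b)" "p \<in> fst (jet_chart A a' b')"
  shows jacobian_time: "fst (chart_deriv (jet_chart A a b) (snd (jet_chart A a' b')) p h)
      = chart_deriv a (snd a') (jet_time p) (fst h)" (is "fst (?J h) = _")
    and jacobian_base: "fst (snd (chart_deriv (jet_chart A a b) (snd (jet_chart A a' b')) p h))
      = chart_deriv b (snd b') (jet_point p) (fst (snd h))"
    and jacobian_vertical: "snd (snd (chart_deriv (jet_chart A a b) (snd (jet_chart A a' b')) p (0, 0, w)))
      = time_rate a' a (jet_time p) *\<^sub>R chart_deriv b (snd b') (jet_point p) w"
proof -
  have dom: "jet_time p \<in> fst a" "jet_point p \<in> fst b" "jet_time p \<in> fst a'" "jet_point p \<in> fst b'"
    using p by (auto simp: jet_chart_domain)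
  define S where "S = snd a ` (fst a \<inter> fst a') \<times> snd b ` (fst b \<inter> fst b') \<times> (UNIV :: 'e set)"
  have oS: "open S" unfolding S_def by (intro open_Times time.open_overlap a b base.open_overlap open_UNIV)
  define z where "z = snd (jet_chart A a b) p"
  have z: "fst z = snd a (jet_time p)" "fst (snd z) = snd b (jet_point p)"
    unfolding z_def using p by (simp_all add: jet_chart_apply[OF a(1) b(1)])
  have zS: "z \<in> S" using z dom by (auto simp: S_def mem_Times_iff)
  have D: "(jet_transition a b a' b' has_derivative ?J) (at z)"
    using jet.transition_has_derivative[OF jet_chart_in_atlas[OF a(1) b(1)] jet_chart_in_atlas[OF a(2) b(2)] p] unfolding z_def[symmetric]
    by (rule has_derivative_transform_within_open[OF _ oS zS])
      (simp only: S_def jet_transition_eq[OF a b])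
  have fst_eq: "fst (?J h) = chart_deriv a (snd a') (jet_time p) (fst h)" for h
  proof -
    have "((\<lambda>w. fst (jet_transition a b a' b' w)) has_derivative (\<lambda>h. fst (?J h))) (at z)"
      by (rule bounded_linear.has_derivative[OF bounded_linear_fst D])
    moreover have "((\<lambda>w. (snd a' \<circ> chart_inv a) (fst w)) has_derivative
        (\<lambda>h. chart_deriv a (snd a') (jet_time p) (fst h))) (at z)"
      using has_derivative_compose[OF bounded_linear.has_derivative[OF bounded_linear_fst has_derivative_ident],
          of "snd a' \<circ> chart_inv a" "chart_deriv a (snd a') (jet_time p)" z UNIV]
        time.transition_has_derivative[OF a dom(1,3)] z by simp
    ultimately have "(\<lambda>h. fst (?J h)) = (\<lambda>h. chart_deriv a (snd a') (jet_time p) (fst h))"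
      by (intro has_derivative_unique) (simp_all add: jet_transition_def)
    then show ?thesis by meson
  qed
  have snd_eq: "fst (snd (?J h)) = chart_deriv b (snd b') (jet_point p) (fst (snd h))" for h
  proof -
    have "((\<lambda>w. fst (snd (jet_transition a b a' b' w))) has_derivative (\<lambda>h. fst (snd (?J h)))) (at z)"
      by (intro bounded_linear.has_derivative[OF bounded_linear_fst] bounded_linear.has_derivative[OF bounded_linear_snd] D)
    moreover have "((\<lambda>w. (snd b' \<circ> chart_inv b) (fst (snd w))) has_derivative
        (\<lambda>h. chart_deriv b (snd b') (jet_point p) (fst (snd h)))) (at z)"
      using has_derivative_compose[OF bounded_linear.has_derivative[OF bounded_linear_fst
            bounded_linear.has_derivative[OF bounded_linear_snd has_derivative_ident]],
          of "snd b' \<circ> chart_inv b" "chart_deriv b (snd b') (jet_point p)" z UNIV]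
        base.transition_has_derivative[OF b dom(2,4)] z by simp
    ultimately have "(\<lambda>h. fst (snd (?J h))) = (\<lambda>h. chart_deriv b (snd b') (jet_point p) (fst (snd h)))"
      by (intro has_derivative_unique) (simp_all add: jet_transition_def)
    then show ?thesis by meson
  qed
  let ?k = "chart_deriv a' (snd a) (jet_time p) 1" and ?B = "chart_deriv b (snd b') (jet_point p)"
  define u where "u = (0 :: real, 0 :: 'e, w)"
  have line: "((\<lambda>s. z + s *\<^sub>R u) has_derivative (\<lambda>s. s *\<^sub>R u)) (at 0)"
    by (auto intro!: derivative_eq_intros)
  have D0: "(jet_transition a b a' b' has_derivative ?J) (at (z + 0 *\<^sub>R u))"
    using D by simp
  have "((\<lambda>s. snd (snd (jet_transition a b a' b' (z + s *\<^sub>R u)))) has_derivative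
      (\<lambda>s. snd (snd (?J (s *\<^sub>R u))))) (at 0)"
    by (intro bounded_linear.has_derivative[OF bounded_linear_snd] has_derivative_compose[OF line D0])
  moreover have "((\<lambda>s. snd (snd (jet_transition a b a' b' (z + s *\<^sub>R u)))) has_derivative
      (\<lambda>s. ?k *\<^sub>R ?B (s *\<^sub>R w))) (at 0)"
  proof -
    have lin: "linear ?B" by (rule base.linear_transition[OF b dom(2,4)])
    have "snd (snd (jet_transition a b a' b' (z + s *\<^sub>R u))) = ?k *\<^sub>R ?B (snd (snd z)) + s *\<^sub>R ?k *\<^sub>R ?B w" for s
      using linear_add[OF lin] linear_cmul[OF lin] time.chart_inv_apply[OF a(1) dom(1)]
      by (simp add: jet_transition_def z chart_deriv_def scaleR_add_right u_def)
    then show ?thesis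
      using linear_cmul[OF lin] by (auto intro!: derivative_eq_intros)
  qed
  ultimately have "(\<lambda>s. snd (snd (?J (s *\<^sub>R u)))) = (\<lambda>s. ?k *\<^sub>R ?B (s *\<^sub>R w))"
    by (rule has_derivative_unique)
  then have "snd (snd (?J (1 *\<^sub>R u))) = ?k *\<^sub>R ?B (1 *\<^sub>R w)"
    by meson
  then show "snd (snd (?J (0, 0, w))) = ?k *\<^sub>R ?B w" by (simp add: u_def)
  show "fst (?J h) = chart_deriv a (snd a') (jet_time p) (fst h)" by (rule fst_eq)
  show "fst (snd (?J h)) = ?B (fst (snd h))" by (rule snd_eq)
qed

lemma
  assumes c: "c \<in> jet_atlas A" "p \<in> fst c" and d: "d \<in> jet_atlas A" "p \<in> fst d"
  shows jet_jacobian_t: "fst (chart_deriv c (snd d) p h) = fst (chart_deriv c (snd d) p (1, 0, 0)) * fst h"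
    and jet_jacobian_x: "fst (snd (chart_deriv c (snd d) p h)) = fst (snd (chart_deriv c (snd d) p (0, fst (snd h), 0)))"
    and jet_jacobian_y: "snd (snd (chart_deriv c (snd d) p (0, 0, w)))
        = fst (chart_deriv d (snd c) p (1, 0, 0)) *\<^sub>R fst (snd (chart_deriv c (snd d) p (0, w, 0)))"
proof -
  obtain a b where ab: "a \<in> time_atlas" "b \<in> A" "c = jet_chart A a b" using c by (auto simp: jet_atlas_def)
  obtain a' b' where ab': "a' \<in> time_atlas" "b' \<in> A" "d = jet_chart A a' b'" using d by (auto simp: jet_atlas_def)
  note p = c(2)[unfolded ab(3)] d(2)[unfolded ab'(3)]
  note J = jacobian_time[OF ab(1) ab'(1) ab(2) ab'(2) p] jacobian_base[OF ab(1) ab'(1) ab(2) ab'(2) p]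
    jacobian_vertical[OF ab(1) ab'(1) ab(2) ab'(2) p] jacobian_time[OF ab'(1) ab(1) ab'(2) ab(2) p(2,1)]
  have "jet_time p \<in> fst a" "jet_time p \<in> fst a'" using p by (auto simp: jet_chart_domain)
  then show "fst (chart_deriv c (snd d) p h) = fst (chart_deriv c (snd d) p (1, 0, 0)) * fst h"
    using linear_cmul[OF time.linear_transition[OF ab(1) ab'(1)], of "jet_time p" "fst h" 1]
    by (simp add: ab(3) ab'(3) J mult.commute)
  show "fst (snd (chart_deriv c (snd d) p h)) = fst (snd (chart_deriv c (snd d) p (0, fst (snd h), 0)))"
    by (simp add: ab(3) ab'(3) J)
  show "snd (snd (chart_deriv c (snd d) p (0, 0, w)))
        = fst (chart_deriv d (snd c) p (1, 0, 0)) *\<^sub>R fst (snd (chart_deriv c (snd d) p (0, w, 0)))"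
    by (simp add: ab(3) ab'(3) J)
qed

end

section \<open>The adapted frame\<close>

lemma sum_axis: "(\<Sum>j\<in>UNIV. g j *\<^sub>R axis j (1 :: real)) = (\<chi> j. g j)"
  by (simp add: vec_eq_iff axis_def if_distrib cong: if_cong)

lemma sum_e_y: "(\<Sum>j\<in>UNIV. g j *\<^sub>R (e_y j :: 'n::finite jcoord)) = (0, 0, \<chi> j. g j)"
  by (simp add: prod_eq_iff fst_sum snd_sum sum_axis)

lemma delta_t_eq: "delta_t \<Gamma> c p = (1, 0, - (\<chi> j. M_comp \<Gamma> c j p))"
  unfolding delta_t_def sum_e_y by simp

lemma delta_x_eq: "delta_x \<Gamma> c i p = (0, axis i 1, - (\<chi> j. N_comp \<Gamma> c j i p))"
  unfolding delta_x_def sum_e_y by simp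

lemma sum_delta_x:
  "(\<Sum>i\<in>UNIV. a i *\<^sub>R delta_x \<Gamma> c i p) = (0, \<chi> i. a i, - (\<chi> j. \<Sum>i\<in>UNIV. a i * N_comp \<Gamma> c j i p))"
  by (simp add: delta_x_eq prod_eq_iff fst_sum snd_sum sum_axis vec_eq_iff sum_negf)

lemma sum_partial_y: "(\<Sum>k\<in>UNIV. a k *\<^sub>R partial_y k p) = (0, 0, \<chi> k. a k)"
  unfolding partial_y_def by (rule sum_e_y)

lemma t_coeff_scale: "t_coeff \<Gamma> c p (a *\<^sub>R delta_t \<Gamma> c p) = a"
  unfolding t_coeff_def by (rule the_equality) (auto simp: delta_t_eq)

lemma x_coeff_sum: "x_coeff \<Gamma> c p (\<Sum>k\<in>UNIV. a k *\<^sub>R delta_x \<Gamma> c k p) = a"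
  unfolding x_coeff_def by (rule the_equality) (auto simp: sum_delta_x vec_eq_iff fun_eq_iff)

lemma y_coeff_sum: "y_coeff p (\<Sum>k\<in>UNIV. a k *\<^sub>R partial_y k p) = a"
  unfolding y_coeff_def by (rule the_equality) (auto simp: sum_partial_y vec_eq_iff fun_eq_iff)

locale gamma_linear_jets = jet_base A for A :: "('m, real^'n::finite) chart set" +
  fixes \<Gamma> :: "('m, 'n) nonlinear_conn" and nab :: "('m jet, 'n jcoord) conn"
  assumes Hausdorff_base: "Hausdorff_space (atlas_topology A)"
    and nonlinear: "nonlinear_connection A \<Gamma>"
    and gamma_linear: "Gamma_linear_connection A \<Gamma> nab"
begin

sublocale conn: affine_charts "jet_atlas A" nab
  by unfold_locales (use Hausdorff_jet[OF Hausdorff_base] gamma_linear in \<open>auto simp: Gamma_linear_connection_def\<close>)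

abbreviation jacobian :: "('m, 'n) jchart \<Rightarrow> ('m, 'n) jchart \<Rightarrow> 'm jet \<Rightarrow> 'n jcoord \<Rightarrow> 'n jcoord" where
  "jacobian c d p \<equiv> chart_deriv c (snd d) p"

context
  fixes c d p
  assumes c: "c \<in> jet_atlas A" "p \<in> fst c" and d: "d \<in> jet_atlas A" "p \<in> fst d"
begin

lemma linear_jacobian: "linear (jacobian c d p)"
  by (rule jet.linear_transition[OF c(1) d(1) c(2) d(2)])

lemma jacobian_inverse: "jacobian c d p (jacobian d c p h) = h" "jacobian d c p (jacobian c d p h) = h"
  using jet.transition_cocycle[OF d(1) c(1) d(1) d(2) c(2) d(2)] jet.chart_deriv_self[OF d]
    jet.transition_cocycle[OF c(1) d(1) c(1) c(2) d(2) c(2)] jet.chart_deriv_self[OF c] by auto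

lemma time_jacobian_factor: "t_part (jacobian c d p e_t) * t_part (jacobian d c p e_t) = 1"
  using jet_jacobian_t[OF c d, of "jacobian d c p e_t"] by (simp add: jacobian_inverse)

lemma x_part_jacobian: "x_part (jacobian c d p (a, u, w)) $ k = (\<Sum>j\<in>UNIV. u $ j * x_part (jacobian c d p (e_x j)) $ k)"
proof -
  have "(0, u, 0) = (\<Sum>j\<in>UNIV. u $ j *\<^sub>R (e_x j :: 'n jcoord))"
    by (simp add: prod_eq_iff fst_sum snd_sum sum_axis vec_eq_iff)
  then have "jacobian c d p (0, u, 0) = (\<Sum>j\<in>UNIV. u $ j *\<^sub>R jacobian c d p (e_x j))"
    by (simp only: linear_sum[OF linear_jacobian] linear_cmul[OF linear_jacobian])
  then show ?thesis
    using jet_jacobian_x[OF c d, of "(a, u, w)"] by (simp add: fst_sum snd_sum)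
qed

end

context
  fixes c d p
  assumes c: "c \<in> jet_atlas A" "p \<in> fst c" and d: "d \<in> jet_atlas A" "p \<in> fst d"
begin

lemma jacobian_vertical_vector: "jacobian c d p (0, 0, w) = (0, 0, t_part (jacobian d c p e_t) *\<^sub>R x_part (jacobian c d p (0, w, 0)))"
  using jet_jacobian_t[OF c d, of "(0, 0, w)"] jet_jacobian_y[OF c d, of w] x_part_jacobian[OF c d, of 0 0 w]
  by (simp add: prod_eq_iff vec_eq_iff)

text \<open>The inhomogeneous term in the law for \<open>M\<close> compensates the derivative of $\tilde y$ with respect to $t$. Thus
  the line spanned by $\delta / \delta t$ is the same in all charts.\<close>

lemma delta_t_transform: "jacobian c d p (delta_t \<Gamma> c p) = t_part (jacobian c d p e_t) *\<^sub>R delta_t \<Gamma> d p"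
proof -
  let ?m = "\<chi> j. M_comp \<Gamma> c j p"
  have eq: "jacobian c d p (delta_t \<Gamma> c p) = jacobian c d p e_t - jacobian c d p (0, 0, ?m)"
    using linear_diff[OF linear_jacobian[OF c d], of e_t "(0, 0, ?m)"] by (simp add: delta_t_eq)
  have M: "M_comp \<Gamma> d k p = (\<Sum>j\<in>UNIV. M_comp \<Gamma> c j p * (t_part (jacobian d c p e_t))\<^sup>2 * x_part (jacobian c d p (e_x j)) $ k)
               - t_part (jacobian d c p e_t) * y_part (jacobian c d p e_t) $ k" for k
    using nonlinear c d unfolding nonlinear_connection_def Let_def by blast
  have "t_part (jacobian c d p e_t) * M_comp \<Gamma> d k p
      = t_part (jacobian d c p e_t) * (\<Sum>j\<in>UNIV. M_comp \<Gamma> c j p * x_part (jacobian c d p (e_x j)) $ k) - y_part (jacobian c d p e_t) $ k" for k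
  proof -
    have "t_part (jacobian c d p e_t) * M_comp \<Gamma> d k p
      = (t_part (jacobian c d p e_t) * t_part (jacobian d c p e_t)) * (t_part (jacobian d c p e_t) * (\<Sum>j\<in>UNIV. M_comp \<Gamma> c j p * x_part (jacobian c d p (e_x j)) $ k))
        - (t_part (jacobian c d p e_t) * t_part (jacobian d c p e_t)) * y_part (jacobian c d p e_t) $ k"
      unfolding M by (simp add: sum_distrib_left right_diff_distrib power2_eq_square algebra_simps)
    then show ?thesis by (simp add: time_jacobian_factor[OF c d])
  qed
  then show ?thesis
    unfolding eq jacobian_vertical_vector unfolding delta_t_eq
    using x_part_jacobian[OF c d, of 1 0 0]
    by (simp add: prod_eq_iff vec_eq_iff x_part_jacobian[OF c d, of _ ?m])
qed

text \<open>The inhomogeneous term in the law for \<open>N\<close> compensates the derivatives of $\tilde y$ with respect to $x$. The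
  two Jacobians in that law are inverse to each other on the horizontal coordinates, which is the fact
  \<open>inv\<close> below.\<close>

lemma delta_x_transform: "jacobian c d p (delta_x \<Gamma> c i p) = (\<Sum>l\<in>UNIV. x_part (jacobian c d p (e_x i)) $ l *\<^sub>R delta_x \<Gamma> d l p)"
proof -
  let ?m = "\<chi> j. N_comp \<Gamma> c j i p" and ?X = "x_part (jacobian c d p (e_x i))"
  have eq: "jacobian c d p (delta_x \<Gamma> c i p) = jacobian c d p (e_x i) - jacobian c d p (0, 0, ?m)"
    using linear_diff[OF linear_jacobian[OF c d], of "e_x i" "(0, 0, ?m)"] by (simp add: delta_x_eq)
  have N: "N_comp \<Gamma> d k l p = (\<Sum>i\<in>UNIV. \<Sum>j\<in>UNIV. N_comp \<Gamma> c j i p * t_part (jacobian d c p e_t)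
                   * x_part (jacobian d c p (e_x l)) $ i * x_part (jacobian c d p (e_x j)) $ k)
               - (\<Sum>i\<in>UNIV. x_part (jacobian d c p (e_x l)) $ i * y_part (jacobian c d p (e_x i)) $ k)" for k l
    using nonlinear c d unfolding nonlinear_connection_def Let_def by blast
  have inv: "(\<Sum>l\<in>UNIV. ?X $ l * x_part (jacobian d c p (e_x l)) $ i') = (if i' = i then 1 else 0)" for i'
  proof -
    have "(\<Sum>l\<in>UNIV. ?X $ l * x_part (jacobian d c p (e_x l)) $ i') = x_part (jacobian d c p (0, ?X, 0)) $ i'"
      by (rule x_part_jacobian[OF d c, symmetric])
    also have "x_part (jacobian d c p (0, ?X, 0)) = x_part (jacobian d c p (jacobian c d p (e_x i)))"
      using jet_jacobian_x[OF d c, of "jacobian c d p (e_x i)"] by simp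
    finally show ?thesis by (simp add: jacobian_inverse[OF c d] axis_def)
  qed
  have "(\<Sum>l\<in>UNIV. ?X $ l * N_comp \<Gamma> d k l p)
      = t_part (jacobian d c p e_t) * (\<Sum>j\<in>UNIV. N_comp \<Gamma> c j i p * x_part (jacobian c d p (e_x j)) $ k) - y_part (jacobian c d p (e_x i)) $ k" for k
  proof -
    have "(\<Sum>l\<in>UNIV. ?X $ l * N_comp \<Gamma> d k l p)
      = (\<Sum>i'\<in>UNIV. (\<Sum>l\<in>UNIV. ?X $ l * x_part (jacobian d c p (e_x l)) $ i')
          * ((\<Sum>j\<in>UNIV. N_comp \<Gamma> c j i' p * t_part (jacobian d c p e_t) * x_part (jacobian c d p (e_x j)) $ k) - y_part (jacobian c d p (e_x i')) $ k))"
      unfolding N sum_subtractf[symmetric] sum_distrib_left sum_distrib_right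
      by (subst sum.swap) (simp add: sum_distrib_left sum_distrib_right algebra_simps)
    also have "\<dots> = (\<Sum>j\<in>UNIV. N_comp \<Gamma> c j i p * t_part (jacobian d c p e_t) * x_part (jacobian c d p (e_x j)) $ k) - y_part (jacobian c d p (e_x i)) $ k"
      unfolding inv by (simp add: if_distrib[of "\<lambda>x. x * _"] cong: if_cong)
    finally show ?thesis by (simp add: sum_distrib_left mult_ac)
  qed
  then show ?thesis
    unfolding eq jacobian_vertical_vector sum_delta_x
    using jet_jacobian_t[OF c d, of "e_x i"]
    by (simp add: prod_eq_iff vec_eq_iff x_part_jacobian[OF c d, of _ ?m])
qed

end

lemma smooth_delta_t: "c \<in> jet_atlas A \<Longrightarrow> smooth_in_chart c (delta_t \<Gamma> c)"
  using nonlinear unfolding delta_t_def[abs_def] nonlinear_connection_def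
  by (intro jet.smooth_in_chart_diff jet.smooth_in_chart_sum jet.smooth_in_chart_scaleR jet.smooth_in_chart_const) auto

lemma smooth_delta_x: "c \<in> jet_atlas A \<Longrightarrow> smooth_in_chart c (delta_x \<Gamma> c i)"
  using nonlinear unfolding delta_x_def[abs_def] nonlinear_connection_def
  by (intro jet.smooth_in_chart_diff jet.smooth_in_chart_sum jet.smooth_in_chart_scaleR jet.smooth_in_chart_const) auto

lemma smooth_partial_y: "c \<in> jet_atlas A \<Longrightarrow> smooth_in_chart c (partial_y i)"
  unfolding partial_y_def[abs_def] by (rule jet.smooth_in_chart_const)

lemma smooth_M: "c \<in> jet_atlas A \<Longrightarrow> smooth_in_chart c (M_comp \<Gamma> c j)"
  and smooth_N: "c \<in> jet_atlas A \<Longrightarrow> smooth_in_chart c (N_comp \<Gamma> c j i)"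
  using nonlinear unfolding nonlinear_connection_def by auto

section \<open>The connection in the adapted frame\<close>

text \<open>To be applied to the three projections of a nonlinear connection. The condition on \<open>v\<close> has to be verified
  in every chart, not only in the chart whose frame is considered; this is where the transformation laws of
  the adapted frame are used.\<close>

lemma local_conn_in_summand:
  assumes c: "c \<in> jet_atlas A" and u: "smooth_in_chart c u" and v: "smooth_in_chart c v" and p: "p \<in> fst c"
    and parallel: "\<And>X Y. vector_field (jet_atlas A) X \<Longrightarrow> vector_field (jet_atlas A) Y \<Longrightarrow>
       nab X (\<lambda>d q. \<pi> d q (Y d q)) = (\<lambda>d q. \<pi> d q (nab X Y d q))"
    and \<pi>: "\<And>d q a w. \<pi> d q (a *\<^sub>R w) = a *\<^sub>R \<pi> d q w"
    and fixed: "\<And>d q. d \<in> jet_atlas A \<Longrightarrow> q \<in> fst c \<Longrightarrow> q \<in> fst d \<Longrightarrow>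
       \<pi> d q (jacobian c d q (v q)) = jacobian c d q (v q)"
  shows "\<pi> c p (conn.local_conn c u v p) = conn.local_conn c u v p"
proof (rule conn.local_conn_projection[OF c u v p parallel])
  fix f :: "'m jet \<Rightarrow> real"
  have "\<pi> d q (chart_field (jet_atlas A) c v d q) = chart_field (jet_atlas A) c v d q" for d q
    using fixed[of d q] \<pi>[of d q 0 0] by (simp add: chart_field_def)
  then show "(\<lambda>d q. \<pi> d q (chart_field (jet_atlas A) c (\<lambda>q. f q *\<^sub>R v q) d q))
      = chart_field (jet_atlas A) c (\<lambda>q. f q *\<^sub>R v q)"
    by (simp add: jet.chart_field_scaleR[OF c] \<pi>)
qed

text \<open>The matrices of the connection in the three parts of the frame, with the upper index before the lower
  one. For a frame vector in place of \<open>w\<close> they are, by definition, the adapted coefficients.\<close>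
definition conn_t where
  "conn_t c w q = t_coeff \<Gamma> c q (conn.local_conn c w (delta_t \<Gamma> c) q)"
definition conn_x where
  "conn_x c w l i q = x_coeff \<Gamma> c q (conn.local_conn c w (delta_x \<Gamma> c i) q) l"
definition conn_y where
  "conn_y c w l i q = y_coeff q (conn.local_conn c w (partial_y i) q) l"

lemma
  assumes c: "c \<in> jet_atlas A" and w: "smooth_in_chart c w" and q: "q \<in> fst c"
  shows local_conn_delta_t: "conn.local_conn c w (delta_t \<Gamma> c) q = conn_t c w q *\<^sub>R delta_t \<Gamma> c q"
    and conn_t_eq: "conn_t c w q = t_part (conn.local_conn c w (delta_t \<Gamma> c) q)"
proof -
  let ?w = "conn.local_conn c w (delta_t \<Gamma> c) q"
  have eq: "t_part ?w *\<^sub>R delta_t \<Gamma> c q = ?w"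
  proof (rule local_conn_in_summand[OF c w smooth_delta_t[OF c] q, of "\<lambda>d q w. t_part w *\<^sub>R delta_t \<Gamma> d q"])
    show "nab X (\<lambda>d q. t_part (Y d q) *\<^sub>R delta_t \<Gamma> d q) = (\<lambda>d q. t_part (nab X Y d q) *\<^sub>R delta_t \<Gamma> d q)"
      if "vector_field (jet_atlas A) X" "vector_field (jet_atlas A) Y" for X Y
      using gamma_linear that unfolding Gamma_linear_connection_def h_R_def by blast
    show "t_part (jacobian c d q (delta_t \<Gamma> c q)) *\<^sub>R delta_t \<Gamma> d q = jacobian c d q (delta_t \<Gamma> c q)"
      if "d \<in> jet_atlas A" "q \<in> fst c" "q \<in> fst d" for d q
      unfolding delta_t_transform[OF c that(2,1,3)] by (simp add: delta_t_eq)
  qed simp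
  show "conn_t c w q = t_part ?w"
    unfolding conn_t_def by (subst eq[symmetric]) (rule t_coeff_scale)
  then show "?w = conn_t c w q *\<^sub>R delta_t \<Gamma> c q" using eq by simp
qed

lemma
  assumes c: "c \<in> jet_atlas A" and w: "smooth_in_chart c w" and q: "q \<in> fst c"
  shows local_conn_delta_x: "conn.local_conn c w (delta_x \<Gamma> c i) q = (\<Sum>l\<in>UNIV. conn_x c w l i q *\<^sub>R delta_x \<Gamma> c l q)"
    and conn_x_eq: "conn_x c w l i q = x_part (conn.local_conn c w (delta_x \<Gamma> c i) q) $ l"
proof -
  let ?w = "conn.local_conn c w (delta_x \<Gamma> c i) q"
  have eq: "(\<Sum>k\<in>UNIV. x_part ?w $ k *\<^sub>R delta_x \<Gamma> c k q) = ?w"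
  proof (rule local_conn_in_summand[OF c w smooth_delta_x[OF c] q, of "\<lambda>d q w. \<Sum>k\<in>UNIV. x_part w $ k *\<^sub>R delta_x \<Gamma> d k q"])
    show "nab X (\<lambda>d q. \<Sum>k\<in>UNIV. x_part (Y d q) $ k *\<^sub>R delta_x \<Gamma> d k q)
        = (\<lambda>d q. \<Sum>k\<in>UNIV. x_part (nab X Y d q) $ k *\<^sub>R delta_x \<Gamma> d k q)"
      if "vector_field (jet_atlas A) X" "vector_field (jet_atlas A) Y" for X Y
      using gamma_linear that unfolding Gamma_linear_connection_def h_M_def by blast
    show "(\<Sum>k\<in>UNIV. x_part (jacobian c d q (delta_x \<Gamma> c i q)) $ k *\<^sub>R delta_x \<Gamma> d k q) = jacobian c d q (delta_x \<Gamma> c i q)"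
      if "d \<in> jet_atlas A" "q \<in> fst c" "q \<in> fst d" for d q
      unfolding delta_x_transform[OF c that(2,1,3)] by (simp add: sum_delta_x)
  qed (simp add: scaleR_sum_right)
  have *: "conn_x c w l i q = x_part ?w $ l" for l
    unfolding conn_x_def by (subst eq[symmetric]) (simp only: x_coeff_sum)
  then show "conn_x c w l i q = x_part ?w $ l" .
  show "?w = (\<Sum>l\<in>UNIV. conn_x c w l i q *\<^sub>R delta_x \<Gamma> c l q)" using eq by (simp add: *)
qed

lemma
  assumes c: "c \<in> jet_atlas A" and w: "smooth_in_chart c w" and q: "q \<in> fst c"
  shows local_conn_partial_y: "conn.local_conn c w (partial_y i) q = (\<Sum>l\<in>UNIV. conn_y c w l i q *\<^sub>R partial_y l q)"
    and conn_y_eq: "conn_y c w l i q = y_part (conn.local_conn c w (partial_y i) q) $ l"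
proof -
  let ?w = "conn.local_conn c w (partial_y i) q"
  define v where "v d q w = (\<lambda>j. y_part w $ j + M_comp \<Gamma> d j q * t_part w + (\<Sum>i\<in>UNIV. N_comp \<Gamma> d j i q * x_part w $ i))"
    for d q w
  have eq: "(\<Sum>j\<in>UNIV. v c q ?w j *\<^sub>R partial_y j q) = ?w"
  proof (rule local_conn_in_summand[OF c w smooth_partial_y[OF c] q, of "\<lambda>d q w. \<Sum>j\<in>UNIV. v d q w j *\<^sub>R partial_y j q"])
    show "nab X (\<lambda>d q. \<Sum>j\<in>UNIV. v d q (Y d q) j *\<^sub>R partial_y j q)
        = (\<lambda>d q. \<Sum>j\<in>UNIV. v d q (nab X Y d q) j *\<^sub>R partial_y j q)"
      if "vector_field (jet_atlas A) X" "vector_field (jet_atlas A) Y" for X Y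
      using gamma_linear that unfolding Gamma_linear_connection_def v_proj_def v_def by blast
    show "(\<Sum>j\<in>UNIV. v d q (jacobian c d q (partial_y i q)) j *\<^sub>R partial_y j q) = jacobian c d q (partial_y i q)"
      if "d \<in> jet_atlas A" "q \<in> fst c" "q \<in> fst d" for d q
      unfolding partial_y_def jacobian_vertical_vector[OF c that(2,1,3)] sum_e_y by (simp add: v_def vec_eq_iff)
  qed (simp add: v_def scaleR_sum_right sum_distrib_left algebra_simps)
  then have "?w = (0, 0, \<chi> j. v c q ?w j)" by (simp add: sum_partial_y)
  then have "v c q ?w j = y_part ?w $ j" for j
    by (metis snd_conv vec_lambda_beta)
  then have eq': "(\<Sum>j\<in>UNIV. y_part ?w $ j *\<^sub>R partial_y j q) = ?w" using eq by simp
  have *: "conn_y c w l i q = y_part ?w $ l" for l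
    unfolding conn_y_def by (subst eq'[symmetric]) (simp only: y_coeff_sum)
  then show "conn_y c w l i q = y_part ?w $ l" .
  show "?w = (\<Sum>l\<in>UNIV. conn_y c w l i q *\<^sub>R partial_y l q)" using eq' by (simp add: *)
qed

lemma
  assumes c: "c \<in> jet_atlas A" and w: "smooth_in_chart c w"
  shows smooth_conn_t: "smooth_in_chart c (conn_t c w)"
    and smooth_conn_x: "smooth_in_chart c (conn_x c w l i)"
    and smooth_conn_y: "smooth_in_chart c (conn_y c w l i)"
proof -
  have "smooth_in_chart c (\<lambda>q. t_part (conn.local_conn c w (delta_t \<Gamma> c) q))"
    by (intro jet.smooth_in_chart_bounded_linear[OF c bounded_linear_fst] conn.smooth_local_conn[OF c w] smooth_delta_t[OF c])
  then show "smooth_in_chart c (conn_t c w)"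
    by (subst jet.smooth_in_chart_cong[OF c conn_t_eq[OF c w]])
  have "smooth_in_chart c (\<lambda>q. x_part (conn.local_conn c w (delta_x \<Gamma> c i) q) $ l)"
    by (intro jet.smooth_in_chart_bounded_linear[OF c bounded_linear_vec_nth]
        jet.smooth_in_chart_bounded_linear[OF c bounded_linear_fst]
        jet.smooth_in_chart_bounded_linear[OF c bounded_linear_snd] conn.smooth_local_conn[OF c w] smooth_delta_x[OF c])
  then show "smooth_in_chart c (conn_x c w l i)"
    by (subst jet.smooth_in_chart_cong[OF c conn_x_eq[OF c w]])
  have "smooth_in_chart c (\<lambda>q. y_part (conn.local_conn c w (partial_y i) q) $ l)"
    by (intro jet.smooth_in_chart_bounded_linear[OF c bounded_linear_vec_nth]
        jet.smooth_in_chart_bounded_linear[OF c bounded_linear_snd] conn.smooth_local_conn[OF c w] smooth_partial_y[OF c])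
  then show "smooth_in_chart c (conn_y c w l i)"
    by (subst jet.smooth_in_chart_cong[OF c conn_y_eq[OF c w]])
qed

section \<open>Curvature in the adapted frame\<close>

lemma
  assumes c: "c \<in> jet_atlas A" and p: "p \<in> fst c"
  shows chart_deriv_delta_t: "chart_deriv c (delta_t \<Gamma> c) p h = - (\<Sum>r\<in>UNIV. chart_deriv c (M_comp \<Gamma> c r) p h *\<^sub>R partial_y r p)"
    and chart_deriv_delta_x: "chart_deriv c (delta_x \<Gamma> c i) p h = - (\<Sum>r\<in>UNIV. chart_deriv c (N_comp \<Gamma> c r i) p h *\<^sub>R partial_y r p)"
    and chart_deriv_partial_y: "chart_deriv c (partial_y i) p h = 0"
proof -
  have *: "chart_deriv c (\<lambda>q. a - (\<Sum>r\<in>UNIV. g r q *\<^sub>R e_y r)) p h = - (\<Sum>r\<in>UNIV. chart_deriv c (g r) p h *\<^sub>R e_y r)"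
    if "\<And>r. smooth_in_chart c (g r)" for a :: "'n jcoord" and g
  proof -
    have "((\<lambda>x. a - (\<Sum>r\<in>UNIV. (g r \<circ> chart_inv c) x *\<^sub>R e_y r)) has_derivative
        (\<lambda>h. 0 - (\<Sum>r\<in>UNIV. chart_deriv c (g r) p h *\<^sub>R e_y r))) (at (snd c p))"
      by (intro has_derivative_diff has_derivative_const has_derivative_sum
          bounded_linear.has_derivative[OF bounded_linear_scaleR_left]
          jet.smooth_in_chart_has_derivative[OF that p])
    then show ?thesis by (simp add: chart_deriv_def o_def frechet_derivativeI del: scaleR_Pair)
  qed
  show "chart_deriv c (delta_t \<Gamma> c) p h = - (\<Sum>r\<in>UNIV. chart_deriv c (M_comp \<Gamma> c r) p h *\<^sub>R partial_y r p)"
    unfolding delta_t_def[abs_def] partial_y_def by (rule *) (rule smooth_M[OF c])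
  show "chart_deriv c (delta_x \<Gamma> c i) p h = - (\<Sum>r\<in>UNIV. chart_deriv c (N_comp \<Gamma> c r i) p h *\<^sub>R partial_y r p)"
    unfolding delta_x_def[abs_def] partial_y_def by (rule *) (rule smooth_N[OF c])
  show "chart_deriv c (partial_y i) p h = 0"
    unfolding partial_y_def[abs_def] by (rule jet.chart_deriv_const)
qed

text \<open>Only the vertical components of the frame vectors vary, so all brackets are vertical. The last equation
  has vanishing coefficients; it is written like the others in order to be used in the same way.\<close>

lemma
  assumes c: "c \<in> jet_atlas A" and p: "p \<in> fst c"
  shows bracket_x_t: "conn.local_bracket c (delta_x \<Gamma> c k) (delta_t \<Gamma> c) p
      = (\<Sum>r\<in>UNIV. (- torsion_R1 \<Gamma> c r k p) *\<^sub>R partial_y r p)"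
    and bracket_x_x: "conn.local_bracket c (delta_x \<Gamma> c k) (delta_x \<Gamma> c j) p
      = (\<Sum>r\<in>UNIV. (- torsion_R \<Gamma> c r j k p) *\<^sub>R partial_y r p)"
    and bracket_y_t: "conn.local_bracket c (partial_y k) (delta_t \<Gamma> c) p
      = (\<Sum>r\<in>UNIV. (- d_y c k (M_comp \<Gamma> c r) p) *\<^sub>R partial_y r p)"
    and bracket_y_x: "conn.local_bracket c (partial_y k) (delta_x \<Gamma> c j) p
      = (\<Sum>r\<in>UNIV. (- d_y c k (N_comp \<Gamma> c r j) p) *\<^sub>R partial_y r p)"
    and bracket_y_y: "conn.local_bracket c (partial_y k) (partial_y j) p
      = (\<Sum>r\<in>UNIV. (- 0) *\<^sub>R partial_y r p)"
  unfolding conn.local_bracket_def chart_deriv_delta_t[OF c p] chart_deriv_delta_x[OF c p] chart_deriv_partial_y[OF c p]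
    torsion_R1_def torsion_R_def d_t_def d_x_def d_y_def
  by (simp_all add: sum_subtractf scaleR_diff_left sum_negf)

lemma
  assumes c: "c \<in> jet_atlas A" and f: "smooth_in_chart c f"
  shows smooth_d_t: "smooth_in_chart c (d_t \<Gamma> c f)"
    and smooth_d_x: "smooth_in_chart c (d_x \<Gamma> c i f)"
    and smooth_d_y: "smooth_in_chart c (d_y c i f)"
  unfolding d_t_def[abs_def] d_x_def[abs_def] d_y_def[abs_def]
  using assms by (auto intro: jet.smooth_in_chart_deriv smooth_delta_t smooth_delta_x smooth_partial_y)

text \<open>The curvature for two fields with a vertical bracket. Since the connection is linear in its first
  argument, the term $- \omega([u, v])$ of the structure equation becomes a sum over the coefficients of the
  vertical derivatives, that is a sum $C \cdot g$.\<close>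

context
  fixes c u v g p
  assumes c: "c \<in> jet_atlas A" and p: "p \<in> fst c"
    and u: "smooth_in_chart c u" and v: "smooth_in_chart c v"
    and g: "\<And>r. smooth_in_chart c (g r :: 'm jet \<Rightarrow> real)"
    and bracket: "\<And>q. q \<in> fst c \<Longrightarrow> conn.local_bracket c u v q = (\<Sum>r\<in>UNIV. (- g r q) *\<^sub>R partial_y r q)"
begin

lemma local_conn_bracket:
  assumes "smooth_in_chart c w"
  shows "conn.local_conn c (conn.local_bracket c u v) w p
    = - (\<Sum>r\<in>UNIV. g r p *\<^sub>R conn.local_conn c (partial_y r) w p)"
proof -
  have "smooth_in_chart c (\<lambda>q. - g r q)" for r
    by (rule jet.smooth_in_chart_bounded_linear[OF c bounded_linear_minus[OF bounded_linear_ident] g])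
  then have "conn.local_conn c (\<lambda>q. \<Sum>r\<in>UNIV. (- g r q) *\<^sub>R partial_y r q) w p
      = (\<Sum>r\<in>UNIV. (- g r p) *\<^sub>R conn.local_conn c (partial_y r) w p)"
    by (intro conn.local_conn_sum_left[OF c assms _ p] smooth_partial_y[OF c]) auto
  moreover have "conn.local_conn c (conn.local_bracket c u v) w
      = conn.local_conn c (\<lambda>q. \<Sum>r\<in>UNIV. (- g r q) *\<^sub>R partial_y r q) w"
    by (rule conn.local_conn_cong) (simp_all add: bracket)
  ultimately show ?thesis by (simp add: sum_negf)
qed

lemma curvature_delta_t:
  "t_coeff \<Gamma> c p (curvature (jet_atlas A) nab (fst c) (chart_field (jet_atlas A) c u)
      (chart_field (jet_atlas A) c v) (chart_field (jet_atlas A) c (delta_t \<Gamma> c)) c p)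
    = chart_deriv c (conn_t c v) p (u p) - chart_deriv c (conn_t c u) p (v p)
      + (\<Sum>r\<in>UNIV. conn_t c (partial_y r) p * g r p)"
proof -
  have br: "conn_t c (conn.local_bracket c u v) p = - (\<Sum>r\<in>UNIV. conn_t c (partial_y r) p * g r p)"
    unfolding conn_t_eq[OF c conn.smooth_local_bracket[OF c u v] p] conn_t_eq[OF c smooth_partial_y[OF c] p]
      local_conn_bracket[OF smooth_delta_t[OF c]]
    by (simp add: fst_sum mult.commute)
  (* a frame with one element, for which the commutator of the matrices is zero *)
  have "curvature (jet_atlas A) nab (fst c) (chart_field (jet_atlas A) c u)
      (chart_field (jet_atlas A) c v) (chart_field (jet_atlas A) c (delta_t \<Gamma> c)) c p
    = (\<Sum>l\<in>{()}. (chart_deriv c (conn_t c v) p (u p) - chart_deriv c (conn_t c u) p (v p)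
        + (\<Sum>r\<in>{()}. conn_t c v p * conn_t c u p) - (\<Sum>r\<in>{()}. conn_t c u p * conn_t c v p)
        - conn_t c (conn.local_bracket c u v) p) *\<^sub>R delta_t \<Gamma> c p)"
    by (rule conn.curvature_frame[OF c p _ _ u v, of "{()}" "()" "\<lambda>_. delta_t \<Gamma> c" "\<lambda>w _ _. conn_t c w"])
      (auto intro: smooth_delta_t[OF c] smooth_conn_t[OF c] simp: local_conn_delta_t[OF c])
  then show ?thesis by (simp add: t_coeff_scale br)
qed

lemma curvature_delta_x:
  "x_coeff \<Gamma> c p (curvature (jet_atlas A) nab (fst c) (chart_field (jet_atlas A) c u)
      (chart_field (jet_atlas A) c v) (chart_field (jet_atlas A) c (delta_x \<Gamma> c i)) c p) l
    = chart_deriv c (conn_x c v l i) p (u p) - chart_deriv c (conn_x c u l i) p (v p)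
      + (\<Sum>r\<in>UNIV. conn_x c v r i p * conn_x c u l r p) - (\<Sum>r\<in>UNIV. conn_x c u r i p * conn_x c v l r p)
      + (\<Sum>r\<in>UNIV. conn_x c (partial_y r) l i p * g r p)"
proof -
  have br: "conn_x c (conn.local_bracket c u v) l i p = - (\<Sum>r\<in>UNIV. conn_x c (partial_y r) l i p * g r p)" for l
    unfolding conn_x_eq[OF c conn.smooth_local_bracket[OF c u v] p] conn_x_eq[OF c smooth_partial_y[OF c] p]
      local_conn_bracket[OF smooth_delta_x[OF c]]
    by (simp add: fst_sum snd_sum mult.commute)
  have "curvature (jet_atlas A) nab (fst c) (chart_field (jet_atlas A) c u)
      (chart_field (jet_atlas A) c v) (chart_field (jet_atlas A) c (delta_x \<Gamma> c i)) c p
    = (\<Sum>l\<in>UNIV. (chart_deriv c (conn_x c v l i) p (u p) - chart_deriv c (conn_x c u l i) p (v p)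
        + (\<Sum>r\<in>UNIV. conn_x c v r i p * conn_x c u l r p) - (\<Sum>r\<in>UNIV. conn_x c u r i p * conn_x c v l r p)
        - conn_x c (conn.local_bracket c u v) l i p) *\<^sub>R delta_x \<Gamma> c l p)"
    by (rule conn.curvature_frame[OF c p _ _ u v, of UNIV i "delta_x \<Gamma> c" "conn_x c"])
      (auto intro: smooth_delta_x[OF c] smooth_conn_x[OF c] simp: local_conn_delta_x[OF c])
  then show ?thesis by (simp add: x_coeff_sum br)
qed

lemma curvature_partial_y:
  "y_coeff p (curvature (jet_atlas A) nab (fst c) (chart_field (jet_atlas A) c u)
      (chart_field (jet_atlas A) c v) (chart_field (jet_atlas A) c (partial_y i)) c p) l
    = chart_deriv c (conn_y c v l i) p (u p) - chart_deriv c (conn_y c u l i) p (v p)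
      + (\<Sum>r\<in>UNIV. conn_y c v r i p * conn_y c u l r p) - (\<Sum>r\<in>UNIV. conn_y c u r i p * conn_y c v l r p)
      + (\<Sum>r\<in>UNIV. conn_y c (partial_y r) l i p * g r p)"
proof -
  have br: "conn_y c (conn.local_bracket c u v) l i p = - (\<Sum>r\<in>UNIV. conn_y c (partial_y r) l i p * g r p)" for l
    unfolding conn_y_eq[OF c conn.smooth_local_bracket[OF c u v] p] conn_y_eq[OF c smooth_partial_y[OF c] p]
      local_conn_bracket[OF smooth_partial_y[OF c]]
    by (simp add: snd_sum mult.commute)
  have "curvature (jet_atlas A) nab (fst c) (chart_field (jet_atlas A) c u)
      (chart_field (jet_atlas A) c v) (chart_field (jet_atlas A) c (partial_y i)) c p
    = (\<Sum>l\<in>UNIV. (chart_deriv c (conn_y c v l i) p (u p) - chart_deriv c (conn_y c u l i) p (v p)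
        + (\<Sum>r\<in>UNIV. conn_y c v r i p * conn_y c u l r p) - (\<Sum>r\<in>UNIV. conn_y c u r i p * conn_y c v l r p)
        - conn_y c (conn.local_bracket c u v) l i p) *\<^sub>R partial_y l p)"
    by (rule conn.curvature_frame[OF c p _ _ u v, of UNIV i partial_y "conn_y c"])
      (auto intro: smooth_partial_y[OF c] smooth_conn_y[OF c] simp: local_conn_partial_y[OF c])
  then show ?thesis by (simp add: y_coeff_sum br)
qed

end

end

section \<open>Covariant derivatives of the coefficients\<close>

lemma sum_range_inj: "inj h \<Longrightarrow> (\<Sum>r\<in>range h. f r) = (\<Sum>r\<in>UNIV. f (h r))"
  by (simp add: sum.reindex)

lemma inj_dindex: "inj Hor" "inj Ver"
  by (auto intro: injI)

text \<open>The two time indices of $\bar C$ give terms that cancel each other.\<close>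

lemma
  shows connection_terms_Cbar: "connection_terms (dir_coeff a h v) (Cbar_tensor Cbar) [Tm] [Tm, Ver k] p
      = - (\<Sum>r\<in>UNIV. Cbar r p * v r k)"
    and connection_terms_C: "connection_terms (dir_coeff a h v) (C_tensor C) [Hor l] [Hor i, Ver k] p
      = (\<Sum>r\<in>UNIV. C r i k p * h l r) - (\<Sum>r\<in>UNIV. C l r k p * h r i) - (\<Sum>r\<in>UNIV. C l i r p * v r k)"
    and connection_terms_Cv: "connection_terms (dir_coeff a h v) (Cv_tensor Cv) [Ver l] [Ver i, Ver k] p
      = (\<Sum>r\<in>UNIV. Cv r i k p * v l r) - (\<Sum>r\<in>UNIV. Cv l r k p * v r i) - (\<Sum>r\<in>UNIV. Cv l i r p * v r k)"
  by (simp_all add: connection_terms_def Cbar_tensor_def C_tensor_def Cv_tensor_def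
      lessThan_Suc numeral_2_eq_2 sum_range_inj inj_dindex)

lemma tensor_components:
  "Cbar_tensor Cbar [Tm] [Tm, Ver k] = Cbar k"
  "C_tensor C [Hor l] [Hor i, Ver k] = C l i k"
  "Cv_tensor Cv [Ver l] [Ver i, Ver k] = Cv l i k"
  by (simp_all add: fun_eq_iff Cbar_tensor_def C_tensor_def Cv_tensor_def)

section \<open>Curvature d-tensors\<close>

theorem theorem3p6:
  fixes A :: "('m, real^'n::finite) chart set"
    and \<Gamma> :: "('m, 'n) nonlinear_conn"
    and nab :: "('m jet, 'n jcoord) conn"
    and c :: "('m, 'n) jchart"
    and p :: "'m jet"
    and i j k l :: 'n
  assumes "smooth_manifold A"
    and "nonlinear_connection A \<Gamma>"
    and "Gamma_linear_connection A \<Gamma> nab"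
    and "c \<in> jet_atlas A"
    and "adapted_coefficients A \<Gamma> nab c = (Gbar, G, Gv, Lbar, L, Lv, Cbar, C, Cv)"
    and "curvature_t A \<Gamma> nab c = (Rbar1, Rbar, Pbar1, Pbar, Sbar)"
    and "curvature_x A \<Gamma> nab c = (R1, R, P1, P, S)"
    and "curvature_y A \<Gamma> nab c = (Rv1, Rv, Pv1, Pv, Sv)"
    and "p \<in> fst c"
  shows
    "Rbar1 k p = d_x \<Gamma> c k Gbar p - d_t \<Gamma> c (Lbar k) p
       + (\<Sum>r\<in>UNIV. Cbar r p * torsion_R1 \<Gamma> c r k p) \<and>
     Rbar j k p = d_x \<Gamma> c k (Lbar j) p - d_x \<Gamma> c j (Lbar k) p
       + (\<Sum>r\<in>UNIV. Cbar r p * torsion_R \<Gamma> c r j k p) \<and>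
     Pbar1 k p = d_y c k Gbar p
       - cov_t \<Gamma> c Gbar G Gv (Cbar_tensor Cbar) [Tm] [Tm, Ver k] p
       + (\<Sum>r\<in>UNIV. Cbar r p * torsion_P1 \<Gamma> c Gv r k p) \<and>
     Pbar j k p = d_y c k (Lbar j) p
       - cov_x \<Gamma> c Lbar L Lv j (Cbar_tensor Cbar) [Tm] [Tm, Ver k] p
       + (\<Sum>r\<in>UNIV. Cbar r p * torsion_P \<Gamma> c Lv r j k p) \<and>
     Sbar j k p = d_y c k (Cbar j) p - d_y c j (Cbar k) p \<and>

     R1 l i k p = d_x \<Gamma> c k (G l i) p - d_t \<Gamma> c (L l i k) p
       + (\<Sum>r\<in>UNIV. G r i p * L l r k p) - (\<Sum>r\<in>UNIV. L r i k p * G l r p)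
       + (\<Sum>r\<in>UNIV. C l i r p * torsion_R1 \<Gamma> c r k p) \<and>
     R l i j k p = d_x \<Gamma> c k (L l i j) p - d_x \<Gamma> c j (L l i k) p
       + (\<Sum>r\<in>UNIV. L r i j p * L l r k p) - (\<Sum>r\<in>UNIV. L r i k p * L l r j p)
       + (\<Sum>r\<in>UNIV. C l i r p * torsion_R \<Gamma> c r j k p) \<and>
     P1 l i k p = d_y c k (G l i) p
       - cov_t \<Gamma> c Gbar G Gv (C_tensor C) [Hor l] [Hor i, Ver k] p
       + (\<Sum>r\<in>UNIV. C l i r p * torsion_P1 \<Gamma> c Gv r k p) \<and>
     P l i j k p = d_y c k (L l i j) p
       - cov_x \<Gamma> c Lbar L Lv j (C_tensor C) [Hor l] [Hor i, Ver k] p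
       + (\<Sum>r\<in>UNIV. C l i r p * torsion_P \<Gamma> c Lv r j k p) \<and>
     S l i j k p = d_y c k (C l i j) p - d_y c j (C l i k) p
       + (\<Sum>r\<in>UNIV. C r i j p * C l r k p) - (\<Sum>r\<in>UNIV. C r i k p * C l r j p) \<and>

     Rv1 l i k p = d_x \<Gamma> c k (Gv l i) p - d_t \<Gamma> c (Lv l i k) p
       + (\<Sum>r\<in>UNIV. Gv r i p * Lv l r k p) - (\<Sum>r\<in>UNIV. Lv r i k p * Gv l r p)
       + (\<Sum>r\<in>UNIV. Cv l i r p * torsion_R1 \<Gamma> c r k p) \<and>
     Rv l i j k p = d_x \<Gamma> c k (Lv l i j) p - d_x \<Gamma> c j (Lv l i k) p
       + (\<Sum>r\<in>UNIV. Lv r i j p * Lv l r k p) - (\<Sum>r\<in>UNIV. Lv r i k p * Lv l r j p)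
       + (\<Sum>r\<in>UNIV. Cv l i r p * torsion_R \<Gamma> c r j k p) \<and>
     Pv1 l i k p = d_y c k (Gv l i) p
       - cov_t \<Gamma> c Gbar G Gv (Cv_tensor Cv) [Ver l] [Ver i, Ver k] p
       + (\<Sum>r\<in>UNIV. Cv l i r p * torsion_P1 \<Gamma> c Gv r k p) \<and>
     Pv l i j k p = d_y c k (Lv l i j) p
       - cov_x \<Gamma> c Lbar L Lv j (Cv_tensor Cv) [Ver l] [Ver i, Ver k] p
       + (\<Sum>r\<in>UNIV. Cv l i r p * torsion_P \<Gamma> c Lv r j k p) \<and>
     Sv l i j k p = d_y c k (Cv l i j) p - d_y c j (Cv l i k) p
       + (\<Sum>r\<in>UNIV. Cv r i j p * Cv l r k p) - (\<Sum>r\<in>UNIV. Cv r i k p * Cv l r j p)"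
proof -
  interpret gamma_linear_jets A \<Gamma> nab
    using assms(1-3) by unfold_locales (auto simp: smooth_manifold_def)
  note c = assms(4) and p = assms(9)
  let ?t = "delta_t \<Gamma> c" and ?x = "delta_x \<Gamma> c"
  have coeffs: "Gbar = conn_t c ?t" "G = conn_x c ?t" "Gv = conn_y c ?t"
    "Lbar = (\<lambda>j. conn_t c (?x j))" "L = (\<lambda>k i j. conn_x c (?x j) k i)" "Lv = (\<lambda>k i j. conn_y c (?x j) k i)"
    "Cbar = (\<lambda>j. conn_t c (partial_y j))" "C = (\<lambda>k i j. conn_x c (partial_y j) k i)"
    "Cv = (\<lambda>k i j. conn_y c (partial_y j) k i)"
    using assms(5)
    unfolding adapted_coefficients_def Let_def prod.inject conn_t_def[abs_def] conn_x_def[abs_def] conn_y_def[abs_def]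
      conn.local_conn_def[symmetric]
    by auto
  note smooth = smooth_delta_t[OF c] smooth_delta_x[OF c] smooth_partial_y[OF c] smooth_M[OF c] smooth_N[OF c]
    smooth_d_t[OF c] smooth_d_x[OF c] smooth_d_y[OF c] jet.smooth_in_chart_const
  have sR1: "smooth_in_chart c (torsion_R1 \<Gamma> c r k)" for r k
    unfolding torsion_R1_def[abs_def] by (intro jet.smooth_in_chart_diff c smooth)
  have sR: "smooth_in_chart c (torsion_R \<Gamma> c r j k)" for r j k
    unfolding torsion_R_def[abs_def] by (intro jet.smooth_in_chart_diff c smooth)
  note br_xt = c p smooth(2,1) sR1 bracket_x_t[OF c]
  note br_xx = c p smooth(2,2) sR bracket_x_x[OF c]
  note br_yt = c p smooth(3,1) smooth(8)[OF smooth(4)] bracket_y_t[OF c]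
  note br_yx = c p smooth(3,2) smooth(8)[OF smooth(5)] bracket_y_x[OF c]
  note br_yy = c p smooth(3,3) smooth(9) bracket_y_y[OF c]
  note curv_t = assms(6)[unfolded curvature_t_def Let_def prod.inject]
  note curv_x = assms(7)[unfolded curvature_x_def Let_def prod.inject]
  note curv_y = assms(8)[unfolded curvature_y_def Let_def prod.inject]
  note defs = d_t_def d_x_def d_y_def
  note cov = cov_t_def cov_x_def connection_terms_Cbar connection_terms_C connection_terms_Cv tensor_components
    torsion_P1_def torsion_P_def right_diff_distrib sum_subtractf
  have T: "Rbar1 k p = chart_deriv c Gbar p (?x k p) - chart_deriv c (Lbar k) p (?t p) + (\<Sum>r\<in>UNIV. Cbar r p * torsion_R1 \<Gamma> c r k p)"
    "Rbar j k p = chart_deriv c (Lbar j) p (?x k p) - chart_deriv c (Lbar k) p (?x j p) + (\<Sum>r\<in>UNIV. Cbar r p * torsion_R \<Gamma> c r j k p)"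
    "Pbar1 k p = chart_deriv c Gbar p (partial_y k p) - chart_deriv c (Cbar k) p (?t p) + (\<Sum>r\<in>UNIV. Cbar r p * d_y c k (M_comp \<Gamma> c r) p)"
    "Pbar j k p = chart_deriv c (Lbar j) p (partial_y k p) - chart_deriv c (Cbar k) p (?x j p) + (\<Sum>r\<in>UNIV. Cbar r p * d_y c k (N_comp \<Gamma> c r j) p)"
    "Sbar j k p = chart_deriv c (Cbar j) p (partial_y k p) - chart_deriv c (Cbar k) p (partial_y j p) + (\<Sum>r\<in>UNIV. Cbar r p * 0)"
    using curv_t curvature_delta_t[OF br_xt] curvature_delta_t[OF br_xx] curvature_delta_t[OF br_yt]
      curvature_delta_t[OF br_yx] curvature_delta_t[OF br_yy]
    by (auto simp: coeffs)
  have X: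
    "R1 l i k p = chart_deriv c (G l i) p (?x k p) - chart_deriv c (L l i k) p (?t p)
      + (\<Sum>r\<in>UNIV. G r i p * L l r k p) - (\<Sum>r\<in>UNIV. L r i k p * G l r p)
      + (\<Sum>r\<in>UNIV. C l i r p * torsion_R1 \<Gamma> c r k p)"
    "R l i j k p = chart_deriv c (L l i j) p (?x k p) - chart_deriv c (L l i k) p (?x j p)
      + (\<Sum>r\<in>UNIV. L r i j p * L l r k p) - (\<Sum>r\<in>UNIV. L r i k p * L l r j p)
      + (\<Sum>r\<in>UNIV. C l i r p * torsion_R \<Gamma> c r j k p)"
    "P1 l i k p = chart_deriv c (G l i) p (partial_y k p) - chart_deriv c (C l i k) p (?t p)
      + (\<Sum>r\<in>UNIV. G r i p * C l r k p) - (\<Sum>r\<in>UNIV. C r i k p * G l r p)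
      + (\<Sum>r\<in>UNIV. C l i r p * d_y c k (M_comp \<Gamma> c r) p)"
    "P l i j k p = chart_deriv c (L l i j) p (partial_y k p) - chart_deriv c (C l i k) p (?x j p)
      + (\<Sum>r\<in>UNIV. L r i j p * C l r k p) - (\<Sum>r\<in>UNIV. C r i k p * L l r j p)
      + (\<Sum>r\<in>UNIV. C l i r p * d_y c k (N_comp \<Gamma> c r j) p)"
    "S l i j k p = chart_deriv c (C l i j) p (partial_y k p) - chart_deriv c (C l i k) p (partial_y j p)
      + (\<Sum>r\<in>UNIV. C r i j p * C l r k p) - (\<Sum>r\<in>UNIV. C r i k p * C l r j p)
      + (\<Sum>r\<in>UNIV. C l i r p * 0)"
    using curv_x curvature_delta_x[OF br_xt] curvature_delta_x[OF br_xx] curvature_delta_x[OF br_yt]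
      curvature_delta_x[OF br_yx] curvature_delta_x[OF br_yy]
    by (auto simp: coeffs)
  have Y:
    "Rv1 l i k p = chart_deriv c (Gv l i) p (?x k p) - chart_deriv c (Lv l i k) p (?t p)
      + (\<Sum>r\<in>UNIV. Gv r i p * Lv l r k p) - (\<Sum>r\<in>UNIV. Lv r i k p * Gv l r p)
      + (\<Sum>r\<in>UNIV. Cv l i r p * torsion_R1 \<Gamma> c r k p)"
    "Rv l i j k p = chart_deriv c (Lv l i j) p (?x k p) - chart_deriv c (Lv l i k) p (?x j p)
      + (\<Sum>r\<in>UNIV. Lv r i j p * Lv l r k p) - (\<Sum>r\<in>UNIV. Lv r i k p * Lv l r j p)
      + (\<Sum>r\<in>UNIV. Cv l i r p * torsion_R \<Gamma> c r j k p)"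
    "Pv1 l i k p = chart_deriv c (Gv l i) p (partial_y k p) - chart_deriv c (Cv l i k) p (?t p)
      + (\<Sum>r\<in>UNIV. Gv r i p * Cv l r k p) - (\<Sum>r\<in>UNIV. Cv r i k p * Gv l r p)
      + (\<Sum>r\<in>UNIV. Cv l i r p * d_y c k (M_comp \<Gamma> c r) p)"
    "Pv l i j k p = chart_deriv c (Lv l i j) p (partial_y k p) - chart_deriv c (Cv l i k) p (?x j p)
      + (\<Sum>r\<in>UNIV. Lv r i j p * Cv l r k p) - (\<Sum>r\<in>UNIV. Cv r i k p * Lv l r j p)
      + (\<Sum>r\<in>UNIV. Cv l i r p * d_y c k (N_comp \<Gamma> c r j) p)"
    "Sv l i j k p = chart_deriv c (Cv l i j) p (partial_y k p) - chart_deriv c (Cv l i k) p (partial_y j p)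
      + (\<Sum>r\<in>UNIV. Cv r i j p * Cv l r k p) - (\<Sum>r\<in>UNIV. Cv r i k p * Cv l r j p)
      + (\<Sum>r\<in>UNIV. Cv l i r p * 0)"
    using curv_y curvature_partial_y[OF br_xt] curvature_partial_y[OF br_xx] curvature_partial_y[OF br_yt]
      curvature_partial_y[OF br_yx] curvature_partial_y[OF br_yy]
    by (auto simp: coeffs)
  (* In the formulas with P the vertical coefficients G and L occur twice, with opposite signs: in the covariant
     derivative of C, at its last index, and in the torsion. What remains is the commutator and C times the
     derivative of M or N. *)
  show ?thesis
    by (intro conjI) (simp_all add: T X Y defs cov algebra_simps)
qed

end
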